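(* Let $n\geq 3$ and $d\geq 1$ be integers. The group $\Gamma_d(n)$ is generated by the elements $e_{ij}^d$ for $1\leq i,j\leq n$ with $i\neq j$, together with the elements $e_{k1}e_{1k}^de_{k1}^{-1}$ for $2\leq k\leq n$.
   Context: For integers $n\geq 1$ and $d\geq 2$, $\Gamma_d(n)=\{X\in \mathrm{SL}(n;\mathbb{Z}) \mid X\equiv I \pmod d\}$ is the level $d$ principal congruence subgroup of $\mathrm{SL}(n;\mathbb{Z})$; and $\Gamma_1(n)=\mathrm{SL}(n;\mathbb{Z})$. For $1\leq i,j\leq n$ with $i\neq j$, $e_{ij}\in \mathrm{SL}(n;\mathbb{Z})$ is the matrix whose $(i,j)$ entry and diagonal entries are $1$ and whose other entries are $0$. *)

theory Defs
  imports "Jordan_Normal_Form.Determinant" "HOL-Algebra.Generated_Groups" "HOL-Number_Theory.Cong"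
begin

definition SL :: "nat \<Rightarrow> int mat monoid" where
  "SL n = \<lparr>carrier = {X \<in> carrier_mat n n. det X = 1}, mult = (*), one = 1\<^sub>m n\<rparr>"

lemma group_SL: "group (SL n)"
proof (rule groupI)
  fix X assume "X \<in> carrier (SL n)"
  then have X: "X \<in> carrier_mat n n" "det X = 1" by (auto simp: SL_def)
  have adj: "adj_mat X \<in> carrier_mat n n" "adj_mat X * X = 1\<^sub>m n"
    using adj_mat[OF X(1)] X(2) by auto
  moreover have "det (adj_mat X) = 1"
    using det_mult[OF adj(1) X(1)] X(2) adj(2) by simp
  ultimately show "\<exists>Y \<in> carrier (SL n). Y \<otimes>\<^bsub>SL n\<^esub> X = \<one>\<^bsub>SL n\<^esub>"
    by (auto simp: SL_def)
qed (auto simp: SL_def det_mult)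

text \<open>For \<open>d = 1\<close> the congruence is vacuous, so this also covers the convention
  that the level 1 subgroup is the whole of \<open>SL n\<close>.\<close>

definition Gamma :: "nat \<Rightarrow> nat \<Rightarrow> int mat set" where
  "Gamma d n = {X \<in> carrier (SL n).
     \<forall>r < n. \<forall>s < n. [X $$ (r, s) = 1\<^sub>m n $$ (r, s)] (mod int d)}"

lemma Gamma_1: "Gamma 1 n = carrier (SL n)"
  by (auto simp: Gamma_def)

text \<open>Matrix entries are indexed from 0 in the library, whereas the indices \<open>i\<close>, \<open>j\<close> here
  range over \<open>{1..n}\<close>.\<close>

definition elem_mat :: "nat \<Rightarrow> nat \<Rightarrow> nat \<Rightarrow> int mat" where
  "elem_mat n i j = mat n n (\<lambda>(r, s). if r = s \<or> (Suc r = i \<and> Suc s = j) then 1 else 0)"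

lemma elem_mat_in_SL:
  assumes "i \<noteq> j"
  shows "elem_mat n i j \<in> carrier (SL n)"
proof -
  have c: "elem_mat n i j \<in> carrier_mat n n" by (simp add: elem_mat_def)
  have d: "prod_list (diag_mat (elem_mat n i j)) = 1"
    by (simp add: prod_list_diag_prod elem_mat_def)
  have "det (elem_mat n i j) = 1"
  proof (cases "i < j")
    case True
    have "upper_triangular (elem_mat n i j)"
      using True by (auto simp: elem_mat_def)
    from det_upper_triangular[OF this c] d show ?thesis by simp
  next
    case False
    have "det (elem_mat n i j) = prod_list (diag_mat (elem_mat n i j))"
      by (rule det_lower_triangular[OF _ c]) (use False assms in \<open>auto simp: elem_mat_def\<close>)
    with d show ?thesis by simp
  qed
  with c show ?thesis by (simp add: SL_def)
qed

end

theory Submission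
  imports Defs "HOL-Number_Theory.Residue_Primitive_Roots"
begin

text \<open>Write \<open>x\<^sub>i\<^sub>j(t)\<close> for the elementary matrix with entry \<open>t\<close> in place \<open>(i,j)\<close> and \<open>H\<close> for the group
generated by the listed elements. The inclusion of \<open>H\<close> in \<open>\<Gamma>\<^sub>d(n)\<close> is clear. The converse has
three parts.

\<^item> \<open>H\<close> is normalised by all elementary matrices (\<open>conj_x_closed\<close>). The only conjugates
  \<open>x\<^sub>k\<^sub>l(1) x\<^sub>i\<^sub>j(d) x\<^sub>k\<^sub>l(-1)\<close> that are not products of \<open>d\<close>-th powers by the commutator relations
  are those with \<open>(k,l) = (j,i)\<close>. Writing \<open>x\<^sub>i\<^sub>j(d)\<close> as a commutator through a third index expresses
  all of them by the \<open>n - 1\<close> conjugates that belong to the generating set.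

\<^item> Modulo \<open>H\<close>, every element of \<open>\<Gamma>\<^sub>d(n)\<close> becomes a matrix that differs from the identity only in
  its upper left 2-by-2 block (\<open>Gamma_subset_R\<close>): row and column operations by multiples of \<open>d\<close> are
  multiplications by elements of \<open>H\<close>, conjugation by elementary matrices is harmless since \<open>H\<close> is
  normalised, and for blocks of size at least 3 there is a spare column to work with.

\<^item> Such a block is a word in \<open>x\<^sub>1\<^sub>2(s)\<close> and \<open>x\<^sub>2\<^sub>1(s)\<close>, by the Euclidean algorithm. In the quotient
  by \<open>H\<close> the elements \<open>x\<^sub>i\<^sub>j(s)\<close> satisfy the Steinberg relations and depend on \<open>s\<close> modulo \<open>d\<close> only.
  It remains to see that in any such group, if moreover \<open>(x\<^sub>1\<^sub>2(1) x\<^sub>2\<^sub>1(-1) x\<^sub>1\<^sub>2(1))\<^sup>4 = 1\<close> in it, a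
  word whose matrix is trivial modulo \<open>d\<close> is trivial (\<open>word_value_zero_mod\<close>). This amounts to the computation of \<open>K\<^sub>2\<close> of the ring of integers modulo \<open>d\<close>.

For the last statement, idempotents modulo \<open>d\<close> split the system of the \<open>x\<^sub>i\<^sub>j\<close> into commuting systems
of prime power period \<open>q\<close> (\<open>word_value_split\<close>), so that the coefficient ring may be assumed local.
Over a local ring every invertible 2-by-2 matrix has one of its upper entries invertible, and
accordingly is lower triangular times diagonal times upper triangular, or lower times antidiagonal
times lower. The same normal forms exist in the group, with the standard elements \<open>h(u)\<close> and \<open>w(u)\<close> in
place of the diagonal and antidiagonal matrices, and they are stable under multiplication by the
\<open>x\<^sub>i\<^sub>j(s)\<close> as soon as \<open>h\<close> is multiplicative (\<open>word_normal_form\<close>). The defect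
\<open>{u,v} = h(uv) h(u)\<^sup>-\<^sup>1 h(v)\<^sup>-\<^sup>1\<close> is central, bimultiplicative and skew symmetric, and
\<open>{u, 1 - u} = 1\<close>. If \<open>q\<close> is odd, the units are generated by one element \<open>g\<close>; some unit \<open>u\<close> is such
that \<open>u\<close> and \<open>1 - u\<close> are both odd powers of \<open>g\<close>, whence \<open>{g,g} = 1\<close> (\<open>symb_zero_odd_prime_power\<close>).
If \<open>q\<close> is a power of 2, the units are \<open>\<plusminus>3\<^sup>i\<close>. Then \<open>{-1,-1} = 1\<close> is the
extra relation, which holds for integral matrices already, and \<open>{3,-1} = 1\<close> comes out of computing
\<open>x\<^sub>1\<^sub>2(-2) x\<^sub>2\<^sub>1(2)\<close> twice, from \<open>2 = 1 + 1\<close> and from \<open>2 = 3 + (-1)\<close> (\<open>symb_three_minus_one\<close>).\<close>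

section \<open>Conjugation in additively written groups\<close>

text \<open>Abstract groups are written additively, without being commutative: in the class \<open>group_add\<close> the
rewrite rules \<open>free_group_simps\<close>, together with cancellation, decide all identities of free groups.\<close>
definition cj :: "'g::group_add \<Rightarrow> 'g \<Rightarrow> 'g" where
  "cj g h = g + h - g"

lemmas free_group_simps = diff_conv_add_uminus add.assoc minus_add

lemma cj_add: "cj g (h + h') = cj g h + cj g h'"
  by (simp add: cj_def free_group_simps del: add_uminus_conv_diff)

lemma cj_zero [simp]: "cj g 0 = 0" "cj 0 g = g"
  by (simp_all add: cj_def)

lemma cj_uminus: "cj g (- h) = - cj g h"
  by (simp add: cj_def free_group_simps del: add_uminus_conv_diff)

lemma cj_diff: "cj g (h - h') = cj g h - cj g h'"
  by (simp add: cj_def free_group_simps del: add_uminus_conv_diff)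

lemma cj_cj: "cj (g + g') h = cj g (cj g' h)"
  by (simp add: cj_def free_group_simps del: add_uminus_conv_diff)

lemma cj_distrib: "cj g (cj h h') = cj (cj g h) (cj g h')"
  by (simp add: cj_def free_group_simps del: add_uminus_conv_diff)

lemma cj_eq_iff: "cj g h = h' \<longleftrightarrow> g + h = h' + g"
  by (metis cj_def add_diff_cancel diff_add_cancel)

lemma cj_fixed_sym: "cj g h = h \<longleftrightarrow> cj h g = g"
  unfolding cj_eq_iff by (rule eq_commute)

lemma cj_minus_cancel [simp]: "cj (- g) (cj g h) = h" "cj g (cj (- g) h) = h"
  by (simp_all add: cj_cj[symmetric])

section \<open>Steinberg relations\<close>

text \<open>The relations among the elementary matrices \<open>x\<^sub>i\<^sub>j(s)\<close> that hold over any ring. \<open>x_chain\<close> is the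
commutator relation \<open>[x\<^sub>i\<^sub>j(s), x\<^sub>j\<^sub>k(t)] = x\<^sub>i\<^sub>k(st)\<close>.\<close>
locale steinberg =
  fixes I :: "'i set" and x :: "'i \<Rightarrow> 'i \<Rightarrow> int \<Rightarrow> 'g::group_add"
  assumes x_add: "\<lbrakk>i \<in> I; j \<in> I; i \<noteq> j\<rbrakk> \<Longrightarrow> x i j (s + t) = x i j s + x i j t"
    and x_chain: "\<lbrakk>i \<in> I; j \<in> I; k \<in> I; i \<noteq> j; j \<noteq> k; i \<noteq> k\<rbrakk>
      \<Longrightarrow> x i j s + x j k t = x i k (s * t) + x j k t + x i j s"
    and x_comm: "\<lbrakk>i \<in> I; j \<in> I; k \<in> I; l \<in> I; i \<noteq> j; k \<noteq> l; j \<noteq> k; i \<noteq> l\<rbrakk>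
      \<Longrightarrow> x i j s + x k l t = x k l t + x i j s"
begin

lemma x_zero: "\<lbrakk>i \<in> I; j \<in> I; i \<noteq> j\<rbrakk> \<Longrightarrow> x i j 0 = 0"
  using x_add[of i j 0 0] by (metis add.right_neutral add_left_imp_eq)

lemma x_minus: "\<lbrakk>i \<in> I; j \<in> I; i \<noteq> j\<rbrakk> \<Longrightarrow> x i j (- s) = - x i j s"
  using x_add[of i j s "- s"] x_zero[of i j] by (simp add: minus_unique)

text \<open>In the form of conjugation formulas the relations can be used for rewriting. Conjugation of \<open>x\<^sub>j\<^sub>i\<close>
by \<open>x\<^sub>i\<^sub>j\<close> is the one case without such a formula.\<close>
lemma cj_x_commute: "\<lbrakk>i \<in> I; j \<in> I; k \<in> I; l \<in> I; i \<noteq> j; k \<noteq> l; j \<noteq> k; i \<noteq> l\<rbrakk>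
  \<Longrightarrow> cj (x i j s) (x k l t) = x k l t"
  by (simp add: cj_eq_iff x_comm)

lemma cj_x_right: "\<lbrakk>i \<in> I; j \<in> I; k \<in> I; i \<noteq> j; j \<noteq> k; i \<noteq> k\<rbrakk>
  \<Longrightarrow> cj (x i j s) (x j k t) = x i k (s * t) + x j k t"
  by (simp add: cj_eq_iff x_chain)

lemma cj_x_left:
  assumes "i \<in> I" "j \<in> I" "k \<in> I" "i \<noteq> j" "j \<noteq> k" "i \<noteq> k"
  shows "cj (x i j s) (x k i t) = x k j (- (t * s)) + x k i t"
proof -
  have "x k i t + x i j s = x k j (t * s) + (x i j s + x k i t)"
    using assms x_chain[of k i j t s] by (simp add: add.assoc)
  then have "x i j s + x k i t = - x k j (t * s) + (x k i t + x i j s)"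
    by simp
  then show ?thesis
    using assms by (simp add: cj_eq_iff x_minus add.assoc)
qed

lemmas cj_x = cj_x_commute cj_x_right cj_x_left

end

section \<open>The generated subgroup is normal\<close>

text \<open>The situation of the theorem, with \<open>piv\<close> in the role of the index 1: \<open>H\<close> contains all \<open>x\<^sub>i\<^sub>j(q)\<close> and
the conjugates \<open>H_z\<close> of those in the row of \<open>piv\<close>.\<close>
locale steinberg_subgroup = steinberg I x for I :: "'i set" and x :: "'i \<Rightarrow> 'i \<Rightarrow> int \<Rightarrow> 'g::group_add" +
  fixes H :: "'g set" and q :: int and piv :: 'i
  assumes H_add: "a \<in> H \<Longrightarrow> b \<in> H \<Longrightarrow> a + b \<in> H"
    and H_minus: "a \<in> H \<Longrightarrow> - a \<in> H"
    and piv_in: "piv \<in> I"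
    and H_x: "\<lbrakk>i \<in> I; j \<in> I; i \<noteq> j\<rbrakk> \<Longrightarrow> x i j q \<in> H"
    and H_z: "\<lbrakk>k \<in> I; k \<noteq> piv\<rbrakk> \<Longrightarrow> cj (x k piv 1) (x piv k q) \<in> H"
    and third: "\<lbrakk>k \<in> I; k \<noteq> piv\<rbrakk> \<Longrightarrow> \<exists>j\<in>I. j \<noteq> k \<and> j \<noteq> piv"
begin

lemma H_diff: "a \<in> H \<Longrightarrow> b \<in> H \<Longrightarrow> a - b \<in> H"
  using H_add[of a "- b"] H_minus[of b] by simp

lemma H_x_minus: "\<lbrakk>i \<in> I; j \<in> I; i \<noteq> j\<rbrakk> \<Longrightarrow> x i j (- q) \<in> H"
  by (simp add: x_minus H_x H_minus)

lemma H_x_sign: "\<lbrakk>e = 1 \<or> e = -1; i \<in> I; j \<in> I; i \<noteq> j\<rbrakk> \<Longrightarrow> x i j (e * q) \<in> H \<and> x i j (- (e * q)) \<in> H \<and> x i j (- (q * e)) \<in> H"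
  using H_x H_x_minus by auto

lemmas H_closed = H_add H_minus H_diff H_x H_x_minus


text \<open>Expand \<open>x\<^sub>i\<^sub>j(q) = [x\<^sub>i\<^sub>p(1), x\<^sub>p\<^sub>j(q)]\<close> with \<open>p = piv\<close>: conjugation by \<open>x\<^sub>j\<^sub>i(e)\<close> turns the two factors into
\<open>x\<^sub>j\<^sub>p(e) x\<^sub>i\<^sub>p(1)\<close> and \<open>x\<^sub>p\<^sub>i(-qe) x\<^sub>p\<^sub>j(q)\<close>, and only conjugates at \<open>piv\<close> are left.\<close>
lemma conj_opposite_of_z:
  assumes ij: "i \<in> I" "j \<in> I" "i \<noteq> piv" "j \<noteq> piv" "i \<noteq> j"
    and e: "e = 1 \<or> e = -1"
    and z: "cj (x j piv e) (x piv j q) \<in> H"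
  shows "cj (x j i e) (x i j q) \<in> H"
proof -
  note [simp] = ij piv_in ij(3-5)[symmetric]
  have "x i j q = cj (x i piv 1) (x piv j q) - x piv j q"
    by (simp add: cj_x)
  then have "cj (x j i e) (x i j q) = cj (cj (x j i e) (x i piv 1)) (cj (x j i e) (x piv j q)) - cj (x j i e) (x piv j q)"
    by (simp only: cj_diff cj_distrib[of "x j i e"])
  also have "\<dots> = cj (x j piv e + x i piv 1) (x piv i (- (q * e))) + cj (x j piv e + x i piv 1) (x piv j q)
      - (x piv i (- (q * e)) + x piv j q)"
    by (simp add: cj_x cj_add)
  also have "cj (x j piv e + x i piv 1) (x piv i (- (q * e))) = cj (x i piv 1 + x j piv e) (x piv i (- (q * e)))"
    using x_comm[of j piv i piv] by simp
  finally show ?thesis using e z H_z[of i]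
    by (auto simp: cj_add cj_cj cj_x x_minus cj_uminus intro!: H_closed)
qed

lemma cj_opposite_plane:
  assumes k: "k \<in> I" "k \<noteq> piv" and j: "j \<in> I" "j \<noteq> piv" "j \<noteq> k"
  shows "cj (x j piv s) (cj (x j k 1) (x k j r))
    = x j piv (- (r * s)) + x k piv (- (r * s)) + cj (x j k 1) (x k j r)"
proof -
  note [simp] = k j piv_in k(2)[symmetric] j(2,3)[symmetric]
  show ?thesis by (subst cj_distrib) (simp add: cj_x cj_add)
qed

text \<open>The identity on which the rest of this section depends. It comes from
\<open>x\<^sub>p\<^sub>k(q) = [x\<^sub>p\<^sub>j(q), x\<^sub>j\<^sub>k(1)]\<close> with \<open>p = piv\<close> and relates the conjugates at \<open>k\<close> and \<open>j\<close> with opposite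
signs \<open>t\<close> and \<open>-t\<close>; all other terms are harmless. For \<open>t = -1\<close> it provides the conjugate by the
inverse (\<open>z_minus_in_H\<close>). For \<open>t = 1\<close> it rewrites the generator at \<open>k\<close> by elements whose further
conjugates by \<open>x\<^sub>k\<^sub>p\<close> and \<open>x\<^sub>p\<^sub>k\<close> can be computed (\<open>col_conj_z_same\<close>, \<open>row_conj_z_same\<close>).\<close>
lemma z_expansion:
  assumes k: "k \<in> I" "k \<noteq> piv" and j: "j \<in> I" "j \<noteq> piv" "j \<noteq> k"
    and t: "t = 1 \<or> t = -1"
  shows "cj (x k piv t) (x piv k q) = x k j (t * q) + x piv j q
    - (x j piv q + x k piv q + cj (x j k 1) (x k j (t * q)) + x j k (t * q) + x piv k (- q)
       + cj (x j piv (- t)) (x piv j q))"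
proof -
  note [simp] = k j piv_in k(2)[symmetric] j(2,3)[symmetric]
  have "x piv k q = x piv j q - cj (x j k 1) (x piv j q)"
    by (simp add: cj_x x_minus free_group_simps del: add_uminus_conv_diff)
  then have "cj (x k piv t) (x piv k q)
      = cj (x k piv t) (x piv j q) - cj (cj (x k piv t) (x j k 1)) (cj (x k piv t) (x piv j q))"
    by (simp only: cj_diff cj_distrib[of "x k piv t"])
  also have "\<dots> = x k j (t * q) + x piv j q - cj (x j piv (- t) + x j k 1) (x k j (t * q) + x piv j q)"
    by (simp add: cj_x)
  also have "cj (x j piv (- t) + x j k 1) (x k j (t * q) + x piv j q)
     = cj (x j piv (- t)) (cj (x j k 1) (x k j (t * q))) + cj (x j piv (- t)) (cj (x j k 1) (x piv j q))"
    by (simp add: cj_cj cj_add)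
  also have "cj (x j piv (- t)) (cj (x j k 1) (x piv j q)) = x j k (t * q) + x piv k (- q) + cj (x j piv (- t)) (x piv j q)"
    by (simp add: cj_x cj_add mult.commute)
  also have "cj (x j piv (- t)) (cj (x j k 1) (x k j (t * q))) = x j piv q + x k piv q + cj (x j k 1) (x k j (t * q))"
    using cj_opposite_plane[OF k j, of "- t" "t * q"] t by auto
  finally show ?thesis by (simp add: add.assoc)
qed

lemma z_minus_in_H: 
  assumes k: "k \<in> I" "k \<noteq> piv"
  shows "cj (x k piv (-1)) (x piv k q) \<in> H"
proof -
  obtain j where j: "j \<in> I" "j \<noteq> piv" "j \<noteq> k" using third k by blast
  note [simp] = k j piv_in k(2)[symmetric] j(2,3)[symmetric]
  have "cj (x j k 1) (x k j q) \<in> H" using conj_opposite_of_z[of k j 1] H_z by simp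
  then have 1: "cj (x j k 1) (x k j (- q)) \<in> H"
    using H_minus by (fastforce simp: x_minus cj_uminus)
  show ?thesis
    using 1 H_z[of j] z_expansion[OF k j, of "-1"] by (auto intro!: H_closed)
qed

lemma z_sign_in_H: "\<lbrakk>k \<in> I; k \<noteq> piv; e = 1 \<or> e = -1\<rbrakk> \<Longrightarrow> cj (x k piv e) (x piv k q) \<in> H"
  using H_z z_minus_in_H by auto

lemma conj_opposite_in_H: "\<lbrakk>i \<in> I; j \<in> I; i \<noteq> piv; j \<noteq> piv; i \<noteq> j; e = 1 \<or> e = -1\<rbrakk> \<Longrightarrow> cj (x j i e) (x i j q) \<in> H"
  using z_sign_in_H conj_opposite_of_z by auto

lemma col_conj_z_other:
  assumes k: "k \<in> I" "k \<noteq> piv" and j: "j \<in> I" "j \<noteq> piv" "j \<noteq> k"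
    and e: "e = 1 \<or> e = -1" "e' = 1 \<or> e' = -1"
  shows "cj (x k piv e) (cj (x j piv e') (x piv j q)) \<in> H"
proof -
  note [simp] = k j piv_in k(2)[symmetric] j(2,3)[symmetric]
  have "cj (x k piv e) (cj (x j piv e') (x piv j q)) = cj (x j piv e') (x k j (e * q) + x piv j q)"
    by (subst cj_distrib) (simp add: cj_x)
  also have "\<dots> = x k piv (- (e * q * e')) + x k j (e * q) + cj (x j piv e') (x piv j q)"
    by (simp add: cj_add cj_x)
  finally show ?thesis using e z_sign_in_H[of j e'] H_x_sign[of e] H_x_sign[of "e * e'"]
    by (auto simp: H_add H_x H_x_minus)
qed

lemma col_conj_z_same:
  assumes k: "k \<in> I" "k \<noteq> piv" and e: "e = 1 \<or> e = -1"
  shows "cj (x k piv e) (cj (x k piv 1) (x piv k q)) \<in> H"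
proof -
  obtain j where j: "j \<in> I" "j \<noteq> piv" "j \<noteq> k" using third k by blast
  note [simp] = k j piv_in k(2)[symmetric] j(2,3)[symmetric]
  show ?thesis using e
  proof
    assume e1: "e = -1"
    then have "cj (x k piv e) (cj (x k piv 1) (x piv k q)) = x piv k q"
      by (simp add: x_minus)
    then show ?thesis by (simp add: H_x)
  next
    assume e1: "e = 1"
    have "cj (x k piv 1) (cj (x j k 1) (x k j q)) = cj (x j piv (- 1)) (cj (x j k 1) (x k j q))"
      by (subst cj_distrib) (simp add: cj_x cj_cj)
    also have "\<dots> \<in> H"
      using conj_opposite_in_H[of k j 1] by (auto simp: cj_opposite_plane[OF k j] intro!: H_closed)
    finally have 1: "cj (x k piv 1) (cj (x j k 1) (x k j q)) \<in> H" .
    have 2: "cj (x k piv 1) (cj (x j piv (- 1)) (x piv j q)) \<in> H"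
      using col_conj_z_other[OF k j] by simp
    have 3: "cj (x k piv 1) (x piv k q) \<in> H" using H_z by simp
    show ?thesis unfolding e1 using 1 2 3
      by (subst z_expansion[OF k j, of 1]) (auto simp: cj_add cj_diff cj_x x_minus cj_uminus intro!: H_closed)
  qed
qed

text \<open>The same argument for the opposite pair of indices, starting from
\<open>x\<^sub>k\<^sub>p(q) = [x\<^sub>k\<^sub>j(q), x\<^sub>j\<^sub>p(1)]\<close>.\<close>
lemma row_conj_col:
  assumes k: "k \<in> I" "k \<noteq> piv" and e: "e = 1 \<or> e = -1"
  shows "cj (x piv k e) (x k piv q) \<in> H"
proof -
  obtain j where j: "j \<in> I" "j \<noteq> piv" "j \<noteq> k" using third k by blast
  note [simp] = k j piv_in k(2)[symmetric] j(2,3)[symmetric]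
  have zm: "cj (x j piv 1) (x piv j (e * q)) \<in> H"
    using e H_z[of j] H_minus[OF H_z[of j]] by (auto simp: x_minus cj_uminus)
  have yy: "cj (x j k (- e)) (x k j q) \<in> H" by (rule conj_opposite_in_H) (use e in auto)
  have "x k piv q = x k j q - cj (x j piv 1) (x k j q)"
    by (simp add: cj_x x_minus free_group_simps del: add_uminus_conv_diff)
  then have "cj (x piv k e) (x k piv q)
      = cj (x piv k e) (x k j q) - cj (cj (x piv k e) (x j piv 1)) (cj (x piv k e) (x k j q))"
    by (simp only: cj_diff cj_distrib[of "x piv k e"])
  also have "\<dots> = x piv j (e * q) + x k j q - cj (x j k (- e) + x j piv 1) (x piv j (e * q) + x k j q)"
    by (simp add: cj_x)
  also have "cj (x j k (- e) + x j piv 1) (x piv j (e * q) + x k j q)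
     = cj (x j k (- e) + x j piv 1) (x piv j (e * q)) + cj (x j k (- e)) (cj (x j piv 1) (x k j q))"
    by (simp add: cj_cj cj_add)
  also have "x j k (- e) + x j piv 1 = x j piv 1 + x j k (- e)"
    by (simp add: x_comm)
  also have "cj (x j piv 1 + x j k (- e)) (x piv j (e * q))
      = x j k (e * q * e) + x piv k (e * q * e) + cj (x j piv 1) (x piv j (e * q))"
    by (simp add: cj_cj cj_x cj_add)
  also have "cj (x j k (- e)) (cj (x j piv 1) (x k j q))
      = x j piv (e * q) + x k piv (- q) + cj (x j k (- e)) (x k j q)"
    by (simp add: cj_x cj_add)
  also have "e * q * e = q" using e by auto
  finally show ?thesis using zm yy H_x_sign[OF e]
    by (simp add: H_diff H_add H_x H_x_minus)
qed

lemma row_conj_z_other: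
  assumes k: "k \<in> I" "k \<noteq> piv" and j: "j \<in> I" "j \<noteq> piv" "j \<noteq> k"
    and e: "e = 1 \<or> e = -1" "e' = 1 \<or> e' = -1"
  shows "cj (x piv k e) (cj (x j piv e') (x piv j q)) \<in> H"
proof -
  note [simp] = k j piv_in k(2)[symmetric] j(2,3)[symmetric]
  have "cj (x piv k e) (cj (x j piv e') (x piv j q)) = cj (x j k (- (e' * e)) + x j piv e') (x piv j q)"
    by (subst cj_distrib) (simp add: cj_x)
  also have "x j k (- (e' * e)) + x j piv e' = x j piv e' + x j k (- (e' * e))"
    by (simp add: x_comm)
  also have "cj \<dots> (x piv j q) = x j k (e' * (q * (e' * e))) + x piv k (q * (e' * e)) + cj (x j piv e') (x piv j q)"
    by (simp add: cj_cj cj_x cj_add)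
  finally show ?thesis using e z_sign_in_H[of j e'] H_x_sign[of "e' * (e' * e)"] H_x_sign[of "e' * e"]
    by (auto simp: H_add H_x H_x_minus)
qed

lemma row_conj_z_same:
  assumes k: "k \<in> I" "k \<noteq> piv" and e: "e = 1 \<or> e = -1"
  shows "cj (x piv k e) (cj (x k piv 1) (x piv k q)) \<in> H"
proof -
  obtain j where j: "j \<in> I" "j \<noteq> piv" "j \<noteq> k" using third k by blast
  note [simp] = k j piv_in k(2)[symmetric] j(2,3)[symmetric]
  have "cj (x piv k e) (cj (x j k 1) (x k j q)) = cj (x j k 1) (x piv j (e * q) + x k j q)"
    by (subst cj_distrib) (simp add: cj_x)
  also have "\<dots> = x piv k (- (e * q)) + x piv j (e * q) + cj (x j k 1) (x k j q)"
    by (simp add: cj_add cj_x)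
  finally have 1: "cj (x piv k e) (cj (x j k 1) (x k j q)) \<in> H"
    using H_x_sign[OF e] conj_opposite_in_H[of k j 1] by (simp add: H_add)
  have 2: "cj (x piv k e) (cj (x j piv (- 1)) (x piv j q)) \<in> H"
    using row_conj_z_other[OF k j] e by simp
  have 3: "cj (x piv k e) (x k piv q) \<in> H" using row_conj_col[OF k e] .
  have 4: "x piv j (e * q) \<in> H" using H_x_sign[OF e] by simp
  have "cj (x piv k e) (cj (x k piv 1) (x piv k q)) = x piv j (e * q) + x k j q + x piv j q
    - (x j k (- (q * e)) + x j piv q + cj (x piv k e) (x k piv q) + cj (x piv k e) (cj (x j k 1) (x k j q))
       + x j k q + x piv k (- q) + cj (x piv k e) (cj (x j piv (- 1)) (x piv j q)))"
    by (subst z_expansion[OF k j, of 1]) (simp_all add: cj_add cj_diff cj_x add.assoc)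
  then show ?thesis using 1 2 3 4 H_x_sign[OF e] by (simp add: H_add H_diff H_x H_x_minus)
qed

lemma conj_generator_x:
  assumes k: "k \<in> I" "k \<noteq> piv" and e: "e = 1 \<or> e = -1"
    and g: "g = x k piv e \<or> g = x piv k e" and ij: "i \<in> I" "j \<in> I" "i \<noteq> j"
  shows "cj g (x i j q) \<in> H"
proof -
  have gen: "cj (x a b e) (x i j q) \<in> H" if ab: "a \<in> I" "b \<in> I" "a \<noteq> b" "\<not> (i = b \<and> j = a)" for a b
  proof -
    have qe: "x c d (- (q * e)) \<in> H" "x c d (e * q) \<in> H" if "c \<in> I" "d \<in> I" "c \<noteq> d" for c d
      using H_x_sign[OF e that] by auto
    consider "b = i" "a \<noteq> j" | "b \<noteq> i" "a = j" | "b \<noteq> i" "a \<noteq> j" using ab by blast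
    then show ?thesis
    proof cases
      case 1
      then show ?thesis using cj_x_left[of a b j e q] cj_x_right[of a b j e q] ab ij qe
        by (simp add: H_add H_x)
    next
      case 2
      then show ?thesis using cj_x_left[of a b i e q] ab ij qe
        by (simp add: H_add H_x)
    next
      case 3
      then show ?thesis using cj_x_commute[of a b i j e q] ab ij by (simp add: H_x)
    qed
  qed
  have "cj (x k piv e) (x i j q) \<in> H"
    by (cases "i = piv \<and> j = k") (simp_all add: gen k piv_in z_sign_in_H[OF k e])
  moreover have "cj (x piv k e) (x i j q) \<in> H"
    by (cases "i = k \<and> j = piv") (simp_all add: gen k k(2)[symmetric] piv_in row_conj_col[OF k e])
  ultimately show ?thesis using g by (elim disjE) simp_all
qed

lemma conj_generator_z:
  assumes k: "k \<in> I" "k \<noteq> piv" and e: "e = 1 \<or> e = -1"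
    and g: "g = x k piv e \<or> g = x piv k e" and l: "l \<in> I" "l \<noteq> piv"
  shows "cj g (cj (x l piv 1) (x piv l q)) \<in> H"
proof -
  have "cj (x k piv e) (cj (x l piv 1) (x piv l q)) \<in> H"
    by (cases "l = k") (simp_all add: col_conj_z_same[OF k e] col_conj_z_other[OF k l _ e])
  moreover have "cj (x piv k e) (cj (x l piv 1) (x piv l q)) \<in> H"
    by (cases "l = k") (simp_all add: row_conj_z_same[OF k e] row_conj_z_other[OF k l _ e])
  ultimately show ?thesis using g by (elim disjE) simp_all
qed

text \<open>Since \<open>x\<^sub>i\<^sub>j(1) = [x\<^sub>i\<^sub>p(1), x\<^sub>p\<^sub>j(1)]\<close> with \<open>p = piv\<close>, conjugation by the elements in the row and the column of
\<open>piv\<close> is all that matters. The hypothesis \<open>gen\<close> says that conjugation has to be tested on generators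
of \<open>H\<close> only.\<close>
lemma conj_x_closed:
  assumes gen: "\<And>a h. \<lbrakk>\<And>i j. \<lbrakk>i \<in> I; j \<in> I; i \<noteq> j\<rbrakk> \<Longrightarrow> cj a (x i j q) \<in> H;
      \<And>k. \<lbrakk>k \<in> I; k \<noteq> piv\<rbrakk> \<Longrightarrow> cj a (cj (x k piv 1) (x piv k q)) \<in> H; h \<in> H\<rbrakk> \<Longrightarrow> cj a h \<in> H"
    and ij: "i \<in> I" "j \<in> I" "i \<noteq> j" and h: "h \<in> H"
  shows "cj (x i j t) h \<in> H"
proof -
  define N where "N = {a. \<forall>h\<in>H. cj a h \<in> H}"
  have N_add: "a + b \<in> N" if "a \<in> N" "b \<in> N" for a b
    using that by (simp add: N_def cj_cj)
  have border: "x k piv e \<in> N \<and> x piv k e \<in> N" if k: "k \<in> I" "k \<noteq> piv" and e: "e = 1 \<or> e = - 1" for k e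
    unfolding N_def
    using gen[of "x k piv e"] gen[of "x piv k e"] conj_generator_x[OF k e] conj_generator_z[OF k e] by simp
  have one: "x i j e \<in> N" if e: "e = 1 \<or> e = - 1" for e
  proof (cases "i = piv \<or> j = piv")
    case True
    then show ?thesis using border[OF _ _ e] ij by auto
  next
    case False
    have "x i piv e + x piv j 1 = x i j e + x piv j 1 + x i piv e"
      using x_chain[of i piv j e 1] ij False piv_in by auto
    then have "x i j e = (x i piv e + x piv j 1) + (x i piv (- e) + x piv j (- 1))"
      using ij False not_sym[of j piv] piv_in by (auto simp: x_minus free_group_simps simp del: add_uminus_conv_diff)
    moreover have "x i piv e \<in> N" "x i piv (- e) \<in> N" "x piv j 1 \<in> N" "x piv j (- 1) \<in> N"
      using border[of i e] border[of i "- e"] border[of j 1] border[of j "- 1"] e ij False by auto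
    ultimately show ?thesis using N_add by simp
  qed
  have "x i j t \<in> N"
  proof (induction t rule: int_induct[where k = 0])
    case base
    then show ?case using ij by (simp add: x_zero N_def)
  next
    case (step1 t)
    then show ?case using ij N_add[OF _ one[of 1]] by (simp add: x_add)
  next
    case (step2 t)
    have "x i j (t + - 1) \<in> N" unfolding x_add[OF ij] by (rule N_add[OF step2(2) one]) simp
    then show ?case by simp
  qed
  then show ?thesis using h by (simp add: N_def)
qed

end

section \<open>Monomial and diagonal elements over the integers modulo q\<close>

text \<open>A Steinberg system over the integers modulo \<open>q\<close>: by \<open>x_period\<close> the element \<open>x\<^sub>i\<^sub>j(s)\<close> depends on the
residue class of \<open>s\<close> only. The coefficients stay integers, as \<open>q\<close> is a variable. Units of the
residue ring are therefore carried along as pairs \<open>inv_pair u u'\<close> of mutually inverse residues.\<close>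
locale steinberg_mod = steinberg I x for I :: "'i set" and x :: "'i \<Rightarrow> 'i \<Rightarrow> int \<Rightarrow> 'g::group_add" +
  fixes q :: int
  assumes x_period: "\<lbrakk>i \<in> I; j \<in> I; i \<noteq> j\<rbrakk> \<Longrightarrow> x i j q = 0"
    and third_index: "\<lbrakk>i \<in> I; j \<in> I\<rbrakk> \<Longrightarrow> \<exists>k\<in>I. k \<noteq> i \<and> k \<noteq> j"
begin

lemma x_multiple_zero:
  assumes ij: "i \<in> I" "j \<in> I" "i \<noteq> j"
  shows "x i j (q * m) = 0"
proof (induction m rule: int_induct[where k = 0])
  case base
  then show ?case using ij by (simp add: x_zero)
next
  case (step1 m)
  then show ?case using ij by (simp add: algebra_simps x_add x_period)
next
  case (step2 m)
  have "q * m = q * (m - 1) + q" by (simp add: algebra_simps)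
  with step2 ij x_add[of i j "q * (m - 1)" q] show ?case by (simp add: x_period)
qed

lemma x_cong:
  assumes ij: "i \<in> I" "j \<in> I" "i \<noteq> j" and st: "[s = t] (mod q)"
  shows "x i j s = x i j t"
proof -
  obtain m where "s = t + q * m"
    using st by (metis cong_iff_lin cong_sym_eq)
  then show ?thesis using ij by (simp add: x_add x_multiple_zero)
qed

lemma x_left_comm: "\<lbrakk>i \<in> I; j \<in> I; k \<in> I; l \<in> I; i \<noteq> j; k \<noteq> l; j \<noteq> k; i \<noteq> l\<rbrakk>
  \<Longrightarrow> x i j s + (x k l t + z) = x k l t + (x i j s + z)"
  by (simp add: add.assoc[symmetric] x_comm)

definition inv_pair :: "int \<Rightarrow> int \<Rightarrow> bool" where
  "inv_pair u u' \<longleftrightarrow> [u * u' = 1] (mod q)"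

lemma inv_pair_one [simp]: "inv_pair 1 1"
  by (simp add: inv_pair_def)

lemma inv_pair_uminus: "inv_pair u u' \<Longrightarrow> inv_pair (- u) (- u')"
  by (simp add: inv_pair_def)

lemma inv_pair_commute: "inv_pair u u' \<Longrightarrow> inv_pair u' u"
  by (simp add: inv_pair_def mult.commute)

lemma inv_pair_mult: "inv_pair u u' \<Longrightarrow> inv_pair v v' \<Longrightarrow> inv_pair (u * v) (u' * v')"
  using cong_mult[of "u * u'" 1 q "v * v'" 1] by (simp add: inv_pair_def mult_ac)

text \<open>The way in which congruences with inverses are verified: exhibit the difference as a multiple of
\<open>u u' - 1\<close>.\<close>
lemma cong_of_inv_pair: "\<lbrakk>inv_pair u u'; s - t = c * (u * u' - 1)\<rbrakk> \<Longrightarrow> [s = t] (mod q)"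
  unfolding inv_pair_def cong_iff_dvd_diff by simp

lemma x_inv_pair: "\<lbrakk>inv_pair u u'; i \<in> I; j \<in> I; i \<noteq> j; s - t = c * (u * u' - 1)\<rbrakk> \<Longrightarrow> x i j s = x i j t"
  by (metis x_cong cong_of_inv_pair)

text \<open>For elementary matrices these are the matrices with rows \<open>(0, u)\<close>, \<open>(-u\<^sup>-\<^sup>1, 0)\<close> and \<open>(u, 0)\<close>, \<open>(0, u\<^sup>-\<^sup>1)\<close>
in the rows and columns \<open>i, j\<close>. The argument \<open>u'\<close> stands for \<open>u\<^sup>-\<^sup>1\<close>.\<close>
definition w :: "'i \<Rightarrow> 'i \<Rightarrow> int \<Rightarrow> int \<Rightarrow> 'g" where
  "w i j u u' = x i j u + x j i (- u') + x i j u"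

definition h :: "'i \<Rightarrow> 'i \<Rightarrow> int \<Rightarrow> int \<Rightarrow> 'g" where
  "h i j u u' = w i j u u' - w i j 1 1"

lemma w_uminus: "\<lbrakk>i \<in> I; j \<in> I; i \<noteq> j\<rbrakk> \<Longrightarrow> w i j (- u) (- u') = - w i j u u'"
  by (simp add: w_def x_minus free_group_simps del: add_uminus_conv_diff)

lemma w_cong: "\<lbrakk>i \<in> I; j \<in> I; i \<noteq> j; [u = v] (mod q); [u' = v'] (mod q)\<rbrakk> \<Longrightarrow> w i j u u' = w i j v v'"
  unfolding w_def using x_cong[of i j u v] x_cong[of j i "- u'" "- v'"] by (simp add: cong_minus_minus_iff)

lemma h_cong: "\<lbrakk>i \<in> I; j \<in> I; i \<noteq> j; [u = v] (mod q); [u' = v'] (mod q)\<rbrakk> \<Longrightarrow> h i j u u' = h i j v v'"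
  unfolding h_def using w_cong by metis

context
  fixes i j k u u'
  assumes ijk: "i \<in> I" "j \<in> I" "k \<in> I" "i \<noteq> j" "j \<noteq> k" "i \<noteq> k"
    and uu: "inv_pair u u'"
begin

lemma cj_w_ik: "cj (w i j u u') (x i k t) = x j k (- (u' * t))"
proof -
  note [simp] = ijk ijk(4-6)[symmetric]
  have "cj (w i j u u') (x i k t) = x i k (- (u * u' * t)) + x j k (- (u' * t)) + x i k t"
    by (simp add: w_def cj_cj cj_add cj_x mult.assoc)
  also have "\<dots> = x j k (- (u' * t)) + (x i k (- (u * u' * t)) + x i k t)"
    by (simp add: x_comm[of i k j k] add.assoc[symmetric])
  also have "x i k (- (u * u' * t)) + x i k t = x i k (- (u * u' * t) + t)"
    by (rule x_add[symmetric]) simp_all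
  also have "\<dots> = x i k 0" by (rule x_inv_pair[OF uu, where c = "- t"]) (simp_all add: algebra_simps)
  finally show ?thesis by (simp add: x_zero)
qed

lemma cj_w_jk: "cj (w i j u u') (x j k t) = x i k (u * t)"
proof -
  note [simp] = ijk ijk(4-6)[symmetric]
  have "cj (w i j u u') (x j k t) = x i k (- (u * (u' * (u * t)))) + (x j k (- (u' * (u * t))) +
     (x i k (u * t) + (x i k (u * t) + x j k t)))"
    by (simp add: w_def cj_cj cj_add cj_x mult.assoc add.assoc)
  also have "x j k (- (u' * (u * t))) = x j k (- t)"
    by (rule x_inv_pair[OF uu, where c = "- t"]) (simp_all add: algebra_simps)
  also have "x i k (- (u * (u' * (u * t)))) = x i k (- (u * t))"
    by (rule x_inv_pair[OF uu, where c = "- (u * t)"]) (simp_all add: algebra_simps)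
  also have "x i k (- (u * t)) + (x j k (- t) + (x i k (u * t) + (x i k (u * t) + x j k t)))
      = x i k (- (u * t)) + (x i k (u * t) + (x i k (u * t) + (x j k (- t) + x j k t)))"
    using x_comm[of j k i k] x_left_comm[of j k i k] by simp
  also have "\<dots> = x i k (u * t)" by (simp add: x_minus)
  finally show ?thesis .
qed

lemma cj_w_ki: "cj (w i j u u') (x k i t) = x k j (- (u * t))"
proof -
  note [simp] = ijk ijk(4-6)[symmetric]
  have "cj (w i j u u') (x k i t) = x k j (t * (u * (u' * u))) + (x k i (- (t * (u * u'))) +
     (x k j (- (t * u)) + (x k j (- (t * u)) + x k i t)))"
    by (simp add: w_def cj_cj cj_add cj_x mult.assoc add.assoc)
  also have "x k i (- (t * (u * u'))) = x k i (- t)"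
    by (rule x_inv_pair[OF uu, where c = "- t"]) (simp_all add: algebra_simps)
  also have "x k j (t * (u * (u' * u))) = x k j (t * u)"
    by (rule x_inv_pair[OF uu, where c = "t * u"]) (simp_all add: algebra_simps)
  also have "x k j (t * u) + (x k i (- t) + (x k j (- (t * u)) + (x k j (- (t * u)) + x k i t)))
     = x k j (t * u) + (x k j (- (t * u)) + (x k j (- (t * u)) + (x k i (- t) + x k i t)))"
    using x_comm[of k i k j] x_left_comm[of k i k j] by simp
  also have "\<dots> = x k j (- (u * t))"
    by (simp add: x_minus mult.commute free_group_simps del: add_uminus_conv_diff)
  finally show ?thesis .
qed

lemma cj_w_kj: "cj (w i j u u') (x k j t) = x k i (u' * t)"
proof -
  note [simp] = ijk ijk(4-6)[symmetric]
  have "cj (w i j u u') (x k j t) = x k j (- (t * (u' * u))) + (x k i (t * u') + x k j t)"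
    by (simp add: w_def cj_cj cj_add cj_x mult.assoc add.assoc)
  also have "x k j (- (t * (u' * u))) = x k j (- t)"
    by (rule x_inv_pair[OF uu, where c = "- t"]) (simp_all add: algebra_simps)
  also have "x k j (- t) + (x k i (t * u') + x k j t) = x k j (- t) + (x k j t + x k i (t * u'))"
    by (simp only: x_comm[of k j k i, simplified])
  also have "\<dots> = x k i (u' * t)"
    by (simp add: x_minus mult.commute)
  finally show ?thesis .
qed

end

text \<open>The relations for the indices \<open>i, j\<close> alone do not give this. A third index \<open>k\<close> and
\<open>x\<^sub>i\<^sub>j(t) = [x\<^sub>i\<^sub>k(t), x\<^sub>k\<^sub>j(1)]\<close> reduce it to the formulas above.\<close>
lemma cj_w_ij:
  assumes ij: "i \<in> I" "j \<in> I" "i \<noteq> j" and uu: "inv_pair u u'"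
  shows "cj (w i j u u') (x i j t) = x j i (- (u'^2 * t))"
proof -
  obtain k where k: "k \<in> I" "k \<noteq> i" "k \<noteq> j" using third_index ij by blast
  note [simp] = ij k k(2,3)[symmetric] ij(3)[symmetric]
  have "x i j t = cj (x i k t) (x k j 1) - x k j 1" by (simp add: cj_x)
  then have "cj (w i j u u') (x i j t)
      = cj (cj (w i j u u') (x i k t)) (cj (w i j u u') (x k j 1)) - cj (w i j u u') (x k j 1)"
    by (simp only: cj_diff cj_distrib[of "w i j u u'"])
  also have "\<dots> = x j i (- (u' * t) * u')"
    by (simp add: cj_w_ik uu cj_w_kj cj_x)
  finally show ?thesis by (simp add: power2_eq_square mult_ac)
qed

lemma cj_w_ji:
  assumes ij: "i \<in> I" "j \<in> I" "i \<noteq> j" and uu: "inv_pair u u'"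
  shows "cj (w i j u u') (x j i t) = x i j (- (u^2 * t))"
proof -
  obtain k where k: "k \<in> I" "k \<noteq> i" "k \<noteq> j" using third_index ij by blast
  note [simp] = ij k k(2,3)[symmetric] ij(3)[symmetric]
  have "x j i t = cj (x j k t) (x k i 1) - x k i 1" by (simp add: cj_x)
  then have "cj (w i j u u') (x j i t)
      = cj (cj (w i j u u') (x j k t)) (cj (w i j u u') (x k i 1)) - cj (w i j u u') (x k i 1)"
    by (simp only: cj_diff cj_distrib[of "w i j u u'"])
  also have "\<dots> = x i j (- (u * t * u))"
    by (simp add: cj_w_jk uu cj_w_ki cj_x)
  finally show ?thesis by (simp add: power2_eq_square mult_ac)
qed

lemma cj_w_kl: "\<lbrakk>i \<in> I; j \<in> I; k \<in> I; l \<in> I; i \<noteq> j; k \<noteq> l; k \<noteq> i; k \<noteq> j; l \<noteq> i; l \<noteq> j\<rbrakk>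
  \<Longrightarrow> cj (w i j u u') (x k l t) = x k l t"
  by (simp add: w_def cj_cj cj_x_commute)

lemmas cj_w = cj_w_ij cj_w_ji cj_w_ik cj_w_jk cj_w_ki cj_w_kj cj_w_kl

text \<open>Conjugate \<open>w\<close> by itself.\<close>
lemma w_swap:
  assumes ij: "i \<in> I" "j \<in> I" "i \<noteq> j" and uu: "inv_pair u u'"
  shows "x j i (- u') + x i j u + x j i (- u') = w i j u u'"
proof -
  have 1: "x j i (- (u'\<^sup>2 * u)) = x j i (- u')"
    by (rule x_inv_pair[OF uu, where c = "- u'"]) (use ij in \<open>simp_all add: algebra_simps power2_eq_square\<close>)
  have 2: "x i j (u\<^sup>2 * u') = x i j u"
    by (rule x_inv_pair[OF uu, where c = "u"]) (use ij in \<open>simp_all add: algebra_simps power2_eq_square\<close>)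
  have "w i j u u' = cj (w i j u u') (w i j u u')" by (simp add: cj_def)
  also have "\<dots> = x j i (- (u'\<^sup>2 * u)) + x i j (u\<^sup>2 * u') + x j i (- (u'\<^sup>2 * u))"
    by (subst (2) w_def) (use ij uu in \<open>simp add: cj_add cj_w_ij cj_w_ji\<close>)
  finally show ?thesis using 1 2 by simp
qed

text \<open>\<open>g\<close> acts on the \<open>x\<^sub>k\<^sub>l(t)\<close> like the diagonal matrix with entries \<open>r k\<close>, whose inverse has the entries
\<open>r' k\<close>.\<close>
definition diag :: "'g \<Rightarrow> ('i \<Rightarrow> int) \<Rightarrow> ('i \<Rightarrow> int) \<Rightarrow> bool" where
  "diag g r r' \<longleftrightarrow> (\<forall>k\<in>I. inv_pair (r k) (r' k)) \<and>
     (\<forall>k\<in>I. \<forall>l\<in>I. \<forall>t. k \<noteq> l \<longrightarrow> cj g (x k l t) = x k l (r k * r' l * t))"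

lemma diag_add: "diag g r r' \<Longrightarrow> diag g' s s' \<Longrightarrow> diag (g + g') (\<lambda>k. r k * s k) (\<lambda>k. r' k * s' k)"
  by (auto simp: diag_def inv_pair_mult cj_cj mult_ac)

lemma diag_uminus:
  assumes "diag g r r'"
  shows "diag (- g) r' r"
proof -
  have "cj (- g) (x k l t) = x k l (r' k * r l * t)" if kl: "k \<in> I" "l \<in> I" "k \<noteq> l" for k l t
  proof -
    have "cj g (x k l (r' k * r l * t)) = x k l (r k * r' l * (r' k * r l * t))"
      using assms kl by (simp add: diag_def)
    also have "\<dots> = x k l (r k * r' k * t)"
      by (rule x_inv_pair[of "r l" "r' l", where c = "r k * r' k * t"])
         (use assms kl in \<open>auto simp: diag_def algebra_simps\<close>)
    also have "\<dots> = x k l t"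
      by (rule x_inv_pair[of "r k" "r' k", where c = "t"])
         (use assms kl in \<open>auto simp: diag_def algebra_simps\<close>)
    finally show ?thesis by (metis cj_minus_cancel(1))
  qed
  then show ?thesis using assms by (auto simp: diag_def inv_pair_commute)
qed

lemma diag_w:
  assumes "diag g r r'" and kl: "k \<in> I" "l \<in> I" "k \<noteq> l" and vv: "inv_pair v v'"
  shows "cj g (w k l v v') = w k l (r k * r' l * v) (r' k * r l * v')"
  using assms by (auto simp: diag_def w_def cj_add mult_ac)

lemma diag_h:
  assumes "diag g r r'" and kl: "k \<in> I" "l \<in> I" "k \<noteq> l" and vv: "inv_pair v v'"
  shows "cj g (h k l v v') = h k l (r k * r' l * v) (r' k * r l * v') - h k l (r k * r' l) (r' k * r l)"
  using diag_w[OF assms] diag_w[OF assms(1-4), of 1 1]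
  by (simp only: h_def cj_diff) (simp add: free_group_simps del: add_uminus_conv_diff)

lemma h_diag:
  assumes ij: "i \<in> I" "j \<in> I" "i \<noteq> j" and uu: "inv_pair u u'"
  shows "diag (h i j u u') (\<lambda>k. if k = i then u else if k = j then u' else 1)
     (\<lambda>k. if k = i then u' else if k = j then u else 1)"
proof -
  have h: "h i j u u' = w i j u u' + w i j (- 1) (- 1)"
    using ij w_uminus[of i j 1 1] by (simp add: h_def)
  have m1: "inv_pair (- 1) (- 1)" using inv_pair_uminus[OF inv_pair_one] .
  note [simp] = ij ij(3)[symmetric] uu m1 inv_pair_commute[OF uu]
  have "cj (h i j u u') (x k l t) = x k l ((if k = i then u else if k = j then u' else 1)
       * (if l = i then u' else if l = j then u else 1) * t)"
    if kl: "k \<in> I" "l \<in> I" "k \<noteq> l" for k l t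
  proof -
    consider "k = i" "l = j" | "k = j" "l = i" | "k = i" "l \<noteq> j" | "k = j" "l \<noteq> i" 
      | "k \<noteq> i" "k \<noteq> j" "l = i" | "k \<noteq> i" "k \<noteq> j" "l = j"
      | "k \<noteq> i" "k \<noteq> j" "l \<noteq> i" "l \<noteq> j"
      using kl by blast
    then show ?thesis
      by cases (use kl in \<open>simp_all add: h cj_cj cj_w power2_eq_square mult_ac\<close>)
  qed
  then show ?thesis by (auto simp: diag_def)
qed

end

section \<open>Steinberg symbols\<close>

context steinberg_mod begin

lemma inv_pair_unique:
  assumes "inv_pair u u'" "inv_pair v v'" "[u = v] (mod q)"
  shows "[u' = v'] (mod q)"
proof -
  have "[u' * (v * v') = u' * 1] (mod q)"
    using assms(2) by (intro cong_scalar_left) (simp add: inv_pair_def)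
  moreover have "[u' * (v * v') = v' * (u * u')] (mod q)"
    using cong_scalar_left[OF assms(3), of "u' * v'"] by (simp add: mult_ac cong_sym)
  moreover have "[v' * (u * u') = v' * 1] (mod q)"
    using assms(1) by (intro cong_scalar_left) (simp add: inv_pair_def)
  ultimately show ?thesis by (metis cong_sym cong_trans mult.right_neutral)
qed

lemma h_cong_unit: "\<lbrakk>i \<in> I; j \<in> I; i \<noteq> j; inv_pair u u'; inv_pair v v'; [u = v] (mod q)\<rbrakk>
  \<Longrightarrow> h i j u u' = h i j v v'"
  using h_cong inv_pair_unique by metis

lemma w_cong_unit: "\<lbrakk>i \<in> I; j \<in> I; i \<noteq> j; inv_pair u u'; inv_pair v v'; [u = v] (mod q)\<rbrakk>
  \<Longrightarrow> w i j u u' = w i j v v'"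
  using w_cong inv_pair_unique by metis

lemma h_one [simp]: "h i j 1 1 = 0"
  by (simp add: h_def)

definition central :: "'g \<Rightarrow> bool" where
  "central c \<longleftrightarrow> (\<forall>i\<in>I. \<forall>j\<in>I. \<forall>t. i \<noteq> j \<longrightarrow> cj c (x i j t) = x i j t)"

lemma central_w: "\<lbrakk>central c; i \<in> I; j \<in> I; i \<noteq> j\<rbrakk> \<Longrightarrow> cj c (w i j u u') = w i j u u'"
  by (simp add: central_def w_def cj_add)

lemma central_h: "\<lbrakk>central c; i \<in> I; j \<in> I; i \<noteq> j\<rbrakk> \<Longrightarrow> cj c (h i j u u') = h i j u u'"
  by (simp add: h_def central_w cj_diff)

lemma central_diag:
  assumes d: "diag g r r'" and r: "\<And>k. k \<in> I \<Longrightarrow> [r k = 1] (mod q)"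
  shows "central g"
  unfolding central_def
proof (intro ballI allI impI)
  fix i j t assume ij: "i \<in> I" "j \<in> I" "i \<noteq> j"
  have "inv_pair (r j) (r' j)" using d ij by (simp add: diag_def)
  then have "[r' j = 1] (mod q)" using inv_pair_unique[OF _ inv_pair_one] r ij by blast
  then have "[r i * r' j * t = 1 * 1 * t] (mod q)"
    using r ij by (intro cong_mult) auto
  then show "cj g (x i j t) = x i j t"
    using d ij x_cong[of i j "r i * r' j * t" t] by (simp add: diag_def)
qed

text \<open>The Steinberg symbol \<open>{u, v}\<close>. It measures the failure of \<open>h\<close> to be multiplicative.\<close>
definition symb :: "'i \<Rightarrow> 'i \<Rightarrow> int \<Rightarrow> int \<Rightarrow> int \<Rightarrow> int \<Rightarrow> 'g" where
  "symb i j u u' v v' = h i j (u * v) (u' * v') - h i j u u' - h i j v v'"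

lemma symb_cong: "\<lbrakk>i \<in> I; j \<in> I; i \<noteq> j; inv_pair u u'; inv_pair v v'; inv_pair a a'; inv_pair b b';
   [u = a] (mod q); [v = b] (mod q)\<rbrakk> \<Longrightarrow> symb i j u u' v v' = symb i j a a' b b'"
  unfolding symb_def
  using h_cong_unit[of i j "u * v" "u' * v'" "a * b" "a' * b'"] h_cong_unit[of i j u u' a a']
    h_cong_unit[of i j v v' b b'] by (simp add: inv_pair_mult cong_mult)

lemma symb_one: "symb i j 1 1 v v' = 0"
  by (simp add: symb_def)

text \<open>The three factors act as diagonal matrices whose product is the identity.\<close>
lemma symb_central:
  assumes ij: "i \<in> I" "j \<in> I" "i \<noteq> j" and p: "inv_pair u u'" "inv_pair v v'"
  shows "central (symb i j u u' v v')"
proof -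
  note d = diag_add[OF diag_add[OF h_diag[OF ij inv_pair_mult[OF p]] diag_uminus[OF h_diag[OF ij p(1)]]]
      diag_uminus[OF h_diag[OF ij p(2)]]]
  have 1: "[u * v * u' * v' = 1] (mod q)" "[u' * v' * u * v = 1] (mod q)"
    using inv_pair_mult[OF p] by (simp_all add: inv_pair_def mult_ac)
  have "central (h i j (u * v) (u' * v') + - h i j u u' + - h i j v v')"
    by (rule central_diag[OF d]) (use 1 in auto)
  then show ?thesis by (simp add: symb_def)
qed

text \<open>The key to the formal properties of symbols: with a third index \<open>k\<close>, the element \<open>h\<^sub>i\<^sub>k(u)\<close> acts on the
indices \<open>i, j\<close> like the diagonal matrix with entries \<open>u, 1\<close>, so that \<open>{u, v}\<close> is the commutator of
\<open>h\<^sub>i\<^sub>k(u)\<close> and \<open>h\<^sub>i\<^sub>j(v)\<close>. Bimultiplicativity and skew symmetry follow, as commutators with central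
values are bimultiplicative.\<close>
lemma cj_h_h:
  assumes "i \<in> I" "j \<in> I" "k \<in> I" "i \<noteq> j" "j \<noteq> k" "i \<noteq> k" and p: "inv_pair u u'" "inv_pair v v'"
  shows "cj (h i k u u') (h i j v v') = symb i j u u' v v' + h i j v v'"
  using diag_h[OF h_diag[of i k u u'], of i j v v'] assms by (simp add: symb_def)

lemma cj_h_symb:
  assumes "i \<in> I" "j \<in> I" "i \<noteq> j" "a \<in> I" "b \<in> I" "a \<noteq> b" and p: "inv_pair u u'" "inv_pair v v'"
  shows "cj (h a b z z') (symb i j u u' v v') = symb i j u u' v v'"
  by (rule cj_fixed_sym[THEN iffD1, OF central_h[OF symb_central[OF assms(1-3) p] assms(4-6)]])

lemma symb_commute:
  assumes "i \<in> I" "j \<in> I" "i \<noteq> j" "central c"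
  shows "c + symb i j u u' v v' = symb i j u u' v v' + c"
proof -
  have "cj c (symb i j u u' v v') = symb i j u u' v v'"
    using assms by (simp add: symb_def cj_diff central_h)
  then show ?thesis by (simp add: cj_eq_iff)
qed

lemma cj_symb: "\<lbrakk>central c; i \<in> I; j \<in> I; i \<noteq> j\<rbrakk> \<Longrightarrow> cj c (symb i j u u' v v') = symb i j u u' v v'"
  by (simp add: cj_eq_iff symb_commute)

lemma symb_mult_left:
  assumes ij: "i \<in> I" "j \<in> I" "i \<noteq> j" and p: "inv_pair u u'" "inv_pair v v'" "inv_pair z z'"
  shows "symb i j (u * v) (u' * v') z z' = symb i j u u' z z' + symb i j v v' z z'"
proof -
  obtain k where k: "k \<in> I" "k \<noteq> i" "k \<noteq> j" using third_index ij by blast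
  note [simp] = ij k k(2,3)[symmetric] ij(3)[symmetric] p inv_pair_mult
  have "h i k (u * v) (u' * v') = symb i k u u' v v' + (h i k v v' + h i k u u')"
    by (simp add: symb_def free_group_simps del: add_uminus_conv_diff)
  then have "cj (h i k (u * v) (u' * v')) (h i j z z')
     = cj (symb i k u u' v v') (cj (h i k v v') (cj (h i k u u') (h i j z z')))"
    by (simp add: cj_cj)
  also have "\<dots> = cj (symb i k u u' v v') (symb i j u u' z z' + (symb i j v v' z z' + h i j z z'))"
    by (simp add: cj_h_h cj_add cj_h_symb)
  also have "\<dots> = symb i j u u' z z' + (symb i j v v' z z' + h i j z z')"
    by (simp add: cj_add central_h symb_central cj_symb)
  finally show ?thesis by (simp add: cj_h_h add.assoc[symmetric])
qed

text \<open>Symbols are central, so conjugation by an element that moves \<open>j\<close> to \<open>k\<close> does not change them.\<close>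
lemma symb_index:
  assumes ijk: "i \<in> I" "j \<in> I" "k \<in> I" "i \<noteq> j" "j \<noteq> k" "i \<noteq> k" and p: "inv_pair u u'" "inv_pair v v'"
  shows "symb i j u u' v v' = symb i k u u' v v'"
proof -
  have m1: "inv_pair (- 1) (- 1)" using inv_pair_uminus[OF inv_pair_one] .
  note [simp] = ijk ijk(4-6)[symmetric] m1 p inv_pair_mult
  have h: "cj (w j k (- 1) (- 1)) (h i j z z') = h i k z z'" if "inv_pair z z'" for z z'
    by (simp add: h_def w_def[of i j] w_def[of i k] cj_add cj_diff cj_w_ki cj_w_ik)
  have "symb i j u u' v v' = cj (w j k (- 1) (- 1)) (symb i j u u' v v')"
    using cj_fixed_sym[THEN iffD1, OF central_w[OF symb_central[OF ijk(1,2,4) p], of j k "-1" "-1"]] by simp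
  also have "\<dots> = symb i k u u' v v'"
    by (simp add: symb_def cj_diff h)
  finally show ?thesis .
qed

lemma symb_skew:
  assumes ij: "i \<in> I" "j \<in> I" "i \<noteq> j" and p: "inv_pair u u'" "inv_pair v v'"
  shows "symb i j u u' v v' = - symb i j v v' u u'"
proof -
  obtain k where k: "k \<in> I" "k \<noteq> i" "k \<noteq> j" using third_index ij by blast
  note [simp] = ij k k(2,3)[symmetric] ij(3)[symmetric] p
  have "symb i j u u' v v' = cj (h i k u u') (h i j v v') - h i j v v'" by (simp add: cj_h_h)
  also have "\<dots> = - (cj (h i j v v') (h i k u u') - h i k u u')"
    by (simp add: cj_def free_group_simps del: add_uminus_conv_diff)
  also have "\<dots> = - symb i k v v' u u'" by (simp add: cj_h_h)
  also have "symb i k v v' u u' = symb i j v v' u u'"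
    using symb_index[of i j k v v' u u'] by simp
  finally show ?thesis .
qed

lemma symb_mult_right:
  assumes ij: "i \<in> I" "j \<in> I" "i \<noteq> j" and p: "inv_pair u u'" "inv_pair v v'" "inv_pair z z'"
  shows "symb i j z z' (u * v) (u' * v') = symb i j z z' u u' + symb i j z z' v v'"
proof -
  have "symb i j z z' (u * v) (u' * v') = - (symb i j u u' z z' + symb i j v v' z z')"
    using assms by (simp add: symb_skew[of i j z z' "u * v"] inv_pair_mult symb_mult_left)
  also have "symb i j u u' z z' + symb i j v v' z z' = symb i j v v' z z' + symb i j u u' z z'"
    using assms by (intro symb_commute symb_central)
  also have "- \<dots> = - symb i j u u' z z' - symb i j v v' z z'"
    by (simp only: minus_add) simp
  finally show ?thesis using assms by (simp add: symb_skew[of i j z])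
qed

text \<open>\<open>w(u)\<close> conjugates \<open>w(1)\<close> into \<open>w(u\<^sup>2)\<close>, which gives \<open>h(u) h(-u) = h(-u\<^sup>2)\<close>.\<close>
lemma symb_self_minus:
  assumes ij: "i \<in> I" "j \<in> I" "i \<noteq> j" and p: "inv_pair u u'"
  shows "symb i j (- u) (- u') u u' = 0"
proof -
  note [simp] = ij ij(3)[symmetric] p
  have "cj (w i j u u') (w i j 1 1) = x j i (- (u'^2)) + x i j (u^2) + x j i (- (u'^2))"
    by (simp add: w_def[of i j 1 1] cj_add cj_w_ij cj_w_ji)
  also have "\<dots> = w i j (u^2) (u'^2)"
    by (rule w_swap) (use inv_pair_mult[OF p p] in \<open>simp_all add: power2_eq_square\<close>)
  finally have 1: "w i j u u' + w i j 1 1 - w i j u u' = w i j (u^2) (u'^2)"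
    by (simp add: cj_def)
  have "h i j u u' + h i j (- u) (- u') = - (w i j u u' + w i j 1 1 - w i j u u') - w i j 1 1"
    using w_uminus[of i j u u'] by (simp add: h_def free_group_simps del: add_uminus_conv_diff)
  also have "\<dots> = h i j (- (u^2)) (- (u'^2))"
    unfolding 1 by (simp add: h_def w_uminus)
  finally have "h i j u u' + h i j (- u) (- u') = h i j (- (u^2)) (- (u'^2))" .
  then have "h i j (- u * u) (- u' * u') = h i j u u' + h i j (- u) (- u')"
    by (simp add: power2_eq_square)
  then show ?thesis by (simp add: symb_def free_group_simps del: add_uminus_conv_diff)
qed

lemma symb_inverse_zero:
  assumes ij: "i \<in> I" "j \<in> I" "i \<noteq> j" and p: "inv_pair u u'" "inv_pair v v'"
    and 0: "symb i j u' u v v' = 0"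
  shows "symb i j u u' v v' = 0"
proof -
  have "0 = symb i j 1 1 v v'" by (simp add: symb_one)
  also have "\<dots> = symb i j (u * u') (u' * u) v v'"
    by (rule symb_cong[OF ij inv_pair_one p(2) inv_pair_mult[OF p(1) inv_pair_commute[OF p(1)]] p(2)
        cong_sym[OF p(1)[unfolded inv_pair_def]] cong_refl])
  also have "\<dots> = symb i j u u' v v' + symb i j u' u v v'"
    by (rule symb_mult_left[OF ij p(1) inv_pair_commute[OF p(1)] p(2)])
  finally show ?thesis using 0 by simp
qed

lemma cj_w1_h:
  assumes ij: "i \<in> I" "j \<in> I" "i \<noteq> j" and p: "inv_pair v v'"
  shows "cj (w i j 1 1) (h i j v v') = h i j v' v"
proof -
  note [simp] = ij ij(3)[symmetric] p
  have "cj (w i j 1 1) (w i j v v') = x j i (- v) + x i j v' + x j i (- v)"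
    by (simp add: w_def[of i j v v'] cj_add cj_w_ij cj_w_ji)
  also have "\<dots> = w i j v' v"
    by (rule w_swap) (simp_all add: inv_pair_commute)
  finally show ?thesis by (simp add: h_def cj_diff) (simp add: cj_def)
qed

lemma w_add:
  assumes ij: "i \<in> I" "j \<in> I" "i \<noteq> j" and p: "inv_pair v v'"
  shows "w i j u u' + w i j v v' = h i j u u' + h i j v' v + (w i j 1 1 + w i j 1 1)"
proof -
  have "w i j u u' + w i j v v' = h i j u u' + (cj (w i j 1 1) (h i j v v') + (w i j 1 1 + w i j 1 1))"
    by (simp add: h_def cj_def free_group_simps del: add_uminus_conv_diff)
  then show ?thesis by (simp add: cj_w1_h[OF ij p] add.assoc)
qed

text \<open>For a unit \<open>u\<close>, upper triangular elements can be replaced by lower triangular ones and \<open>w(u)\<close>.\<close>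
lemma x_expand:
  assumes ij: "i \<in> I" "j \<in> I" "i \<noteq> j" and p: "inv_pair u u'"
  shows "x i j u = x j i u' + w i j u u' + x j i u'"
  unfolding w_swap[OF ij p, symmetric]
  using ij by (simp add: x_minus free_group_simps del: add_uminus_conv_diff)

lemma w_x_ji:
  assumes ij: "i \<in> I" "j \<in> I" "i \<noteq> j" and p: "inv_pair u u'"
  shows "w i j u u' + x j i t = x i j (- (u^2 * t)) + w i j u u'"
  using cj_w_ji[OF assms] by (simp add: cj_eq_iff)

lemma w_x_ij:
  assumes ij: "i \<in> I" "j \<in> I" "i \<noteq> j" and p: "inv_pair u u'"
  shows "w i j u u' + x i j t = x j i (- (u'^2 * t)) + w i j u u'"
  using cj_w_ij[OF assms] by (simp add: cj_eq_iff)

lemma x_ij_w: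
  assumes ij: "i \<in> I" "j \<in> I" "i \<noteq> j" and p: "inv_pair u u'"
  shows "x i j t + w i j u u' = w i j u u' + x j i (- (u'^2 * t))"
proof -
  obtain k where k: "u * u' = 1 + q * k" using p by (metis inv_pair_def cong_iff_lin cong_sym)
  have "u\<^sup>2 * (u'\<^sup>2 * t) = (u * u') * (u * u') * t" by (simp add: power2_eq_square)
  also have "\<dots> = t + q * (2 * k * t + q * k * k * t)"
    unfolding k by (simp add: algebra_simps)
  finally have "[u\<^sup>2 * (u'\<^sup>2 * t) = t] (mod q)" by (simp add: cong_iff_dvd_diff)
  then show ?thesis using w_x_ji[OF ij p, of "- (u'^2 * t)"] x_cong[OF ij] by simp
qed

lemma x_ji_w:
  assumes ij: "i \<in> I" "j \<in> I" "i \<noteq> j" and p: "inv_pair u u'"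
  shows "x j i t + w i j u u' = w i j u u' + x i j (- (u^2 * t))"
proof -
  obtain k where k: "u * u' = 1 + q * k" using p by (metis inv_pair_def cong_iff_lin cong_sym)
  have "u'\<^sup>2 * (u\<^sup>2 * t) = (u * u') * (u * u') * t" by (simp add: power2_eq_square)
  also have "\<dots> = t + q * (2 * k * t + q * k * k * t)"
    unfolding k by (simp add: algebra_simps)
  finally have "[u'\<^sup>2 * (u\<^sup>2 * t) = t] (mod q)" by (simp add: cong_iff_dvd_diff)
  then show ?thesis using w_x_ij[OF ij p, of "- (u^2 * t)"] x_cong[OF ij(2,1) ij(3)[symmetric]] by simp
qed

lemma h_x_ji: "\<lbrakk>i \<in> I; j \<in> I; i \<noteq> j; inv_pair u u'\<rbrakk> \<Longrightarrow> h i j u u' + x j i t = x j i (u' * u' * t) + h i j u u'"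
  using h_diag[of i j u u'] by (auto simp: diag_def cj_eq_iff)

text \<open>Insert \<open>x_expand\<close> for \<open>u\<close>, \<open>v\<close> and \<open>u + v = 1\<close> into \<open>x\<^sub>i\<^sub>j(u) x\<^sub>i\<^sub>j(v) = x\<^sub>i\<^sub>j(1)\<close>. Moving the triangular
elements to the left leaves \<open>w(u) w(v) = w(u v\<^sup>-\<^sup>1) w(1)\<close>, that is \<open>{v\<^sup>-\<^sup>1, u} = 1\<close>.\<close>
lemma symb_steinberg:
  assumes ij: "i \<in> I" "j \<in> I" "i \<noteq> j" and p: "inv_pair u u'" "inv_pair v v'"
    and uv: "[u + v = 1] (mod q)"
  shows "symb i j v v' u u' = 0"
proof -
  note [simp] = ij ij(3)[symmetric] p
  obtain a where a: "u * u' = 1 + q * a" using p(1) by (metis inv_pair_def cong_iff_lin cong_sym)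
  obtain b where b: "v * v' = 1 + q * b" using p(2) by (metis inv_pair_def cong_iff_lin cong_sym)
  obtain c where c: "u + v = 1 + q * c" using uv by (metis cong_iff_lin cong_sym)
  have u: "1 - u = v - q * c" using c by simp
  have "- (u^2 * (u' + v')) - - (u * v') = - u * (u * u') + u * v' * (1 - u)"
    by (simp add: algebra_simps power2_eq_square)
  also have "\<dots> = - u * (1 + q * a) + u * v' * (v - q * c)"
    unfolding a u ..
  also have "\<dots> = - u * (1 + q * a) + u * (v * v') - u * v' * q * c"
    by (simp add: algebra_simps)
  also have "\<dots> = q * (- u * a + u * b - u * v' * c)"
    unfolding b by (simp add: algebra_simps)
  finally have 1: "[- (u^2 * (u' + v')) = - (u * v')] (mod q)"
    unfolding cong_iff_dvd_diff by simp
  have "1 - u' - - (v * u') = (u + v) * u' - u' - (u * u' - 1)"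
    by (simp add: algebra_simps)
  also have "\<dots> = q * (c * u' - a)" unfolding a c by (simp add: algebra_simps)
  finally have 2: "[1 - u' = - (v * u')] (mod q)" unfolding cong_iff_dvd_diff by simp
  have "1 - v' - - (u * v') = (u + v) * v' - v' - (v * v' - 1)"
    by (simp add: algebra_simps)
  also have "\<dots> = q * (c * v' - b)" unfolding b c by (simp add: algebra_simps)
  finally have 3: "[1 - v' = - (u * v')] (mod q)" unfolding cong_iff_dvd_diff by simp
  have "x j i 1 + w i j 1 1 + x j i 1 = x i j 1"
    using x_expand[of i j 1 1] by simp
  also have "\<dots> = x i j u + x i j v"
    using x_cong[OF ij uv] x_add[OF ij] by simp
  also have "\<dots> = x j i u' + (w i j u u' + x j i (u' + v')) + w i j v v' + x j i v'"
    by (simp add: x_expand[OF ij p(1)] x_expand[OF ij p(2)] x_add add.assoc)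
  also have "w i j u u' + x j i (u' + v') = x i j (- (u * v')) + w i j u u'"
    using x_cong[OF ij 1] by (simp add: w_x_ji)
  finally have F: "x j i 1 + w i j 1 1 + x j i 1
      = x j i u' + (x i j (- (u * v')) + w i j u u') + w i j v v' + x j i v'" .
  have "w i j u u' + w i j v v' = x i j (u * v') + - x j i u'
      + (x j i u' + (x i j (- (u * v')) + w i j u u') + w i j v v' + x j i v') + - x j i v'"
    by (simp add: x_minus free_group_simps del: add_uminus_conv_diff)
  also have "\<dots> = x i j (u * v') + (- x j i u' + x j i 1) + w i j 1 1 + (x j i 1 - x j i v')"
    unfolding F[symmetric] by (simp add: free_group_simps del: add_uminus_conv_diff)
  also have "- x j i u' + x j i 1 = x j i (1 - u')" 
    using x_add[of j i "- u'" 1] by (simp add: x_minus)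
  also have "x j i 1 - x j i v' = x j i (1 - v')"
    using x_add[of j i 1 "- v'"] by (simp add: x_minus)
  also have "x i j (u * v') + x j i (1 - u') + w i j 1 1 + x j i (1 - v') 
     = x i j (u * v') + x j i (- (v * u')) + (w i j 1 1 + x j i (- (u * v')))"
    using x_cong[of j i, OF _ _ _ 2] x_cong[of j i, OF _ _ _ 3] by (simp add: add.assoc)
  also have "w i j 1 1 + x j i (- (u * v')) = x i j (u * v') + w i j 1 1"
    by (simp add: w_x_ji)
  finally have "w i j u u' + w i j v v' = w i j (u * v') (u' * v) + w i j 1 1"
    by (simp add: w_def[of i j "u * v'"] mult_ac add.assoc)
  then have "h i j u u' + h i j v' v + (w i j 1 1 + w i j 1 1) = h i j (u * v') (u' * v) + (w i j 1 1 + w i j 1 1)"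
    using w_add[OF ij p(2), of u u'] w_add[OF ij inv_pair_one, of "u * v'" "u' * v"] by simp
  then have "h i j (u * v') (u' * v) = h i j u u' + h i j v' v" by simp
  then have "symb i j v' v u u' = 0"
    by (simp add: symb_def mult.commute free_group_simps del: add_uminus_conv_diff)
  then show ?thesis
    by (rule symb_inverse_zero[OF ij p(2,1)])
qed

end

section \<open>Words and their normal forms over a local ring\<close>

text \<open>A 2-by-2 matrix with rows \<open>(a, b)\<close> and \<open>(c, d)\<close> is a quadruple. A word is a list of elementary factors,
\<open>(True, s)\<close> for \<open>x\<^sub>1\<^sub>2(s)\<close> and \<open>(False, s)\<close> for \<open>x\<^sub>2\<^sub>1(s)\<close>; \<open>elem_step\<close> multiplies by such a factor from
the right.\<close>
fun elem_step :: "int \<times> int \<times> int \<times> int \<Rightarrow> bool \<times> int \<Rightarrow> int \<times> int \<times> int \<times> int" where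
  "elem_step (a, b, c, d) (True, s) = (a, b + s * a, c, d + s * c)"
| "elem_step (a, b, c, d) (False, s) = (a + s * b, b, c + s * d, d)"

definition word_matrix :: "(bool \<times> int) list \<Rightarrow> int \<times> int \<times> int \<times> int" where
  "word_matrix ws = foldl elem_step (1, 0, 0, 1) ws"

definition word_value :: "(int \<Rightarrow> 'g::group_add) \<Rightarrow> (int \<Rightarrow> 'g) \<Rightarrow> (bool \<times> int) list \<Rightarrow> 'g" where
  "word_value X Y ws = foldl (\<lambda>g (p, s). g + (if p then X s else Y s)) 0 ws"

lemma word_matrix_simps [simp]:
  "word_matrix [] = (1, 0, 0, 1)"
  "word_matrix (ws @ [v]) = elem_step (word_matrix ws) v"
  by (simp_all add: word_matrix_def)

lemma word_value_simps [simp]: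
  "word_value X Y [] = 0"
  "word_value X Y (ws @ [(p, s)]) = word_value X Y ws + (if p then X s else Y s)"
  by (simp_all add: word_value_def)

context steinberg_mod begin

definition inv_unit :: "int \<Rightarrow> bool" where
  "inv_unit a \<longleftrightarrow> (\<exists>a'. inv_pair a a')"

text \<open>\<open>g\<close> is a lift of the matrix in all ways in which the matrix can be decomposed: as lower triangular
times diagonal times upper triangular if \<open>a\<close> is a unit, and as lower triangular times antidiagonal
times lower triangular if \<open>b\<close> is a unit.\<close>
fun normal_form :: "'i \<Rightarrow> 'i \<Rightarrow> 'g \<Rightarrow> int \<times> int \<times> int \<times> int \<Rightarrow> bool" where
  "normal_form i j g (a, b, c, d) \<longleftrightarrow> [a * d - b * c = 1] (mod q) \<and>
     (\<forall>a'. inv_pair a a' \<longrightarrow> g = x j i (c * a') + h i j a a' + x i j (a' * b)) \<and>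
     (\<forall>b'. inv_pair b b' \<longrightarrow> g = x j i (d * b') + w i j b b' + x j i (a * b'))"

lemma inv_pair_cong: "\<lbrakk>inv_pair u u'; [u = v] (mod q)\<rbrakk> \<Longrightarrow> inv_pair v u'"
  unfolding inv_pair_def by (metis cong_scalar_right cong_sym cong_trans)

lemma normal_form_cong:
  assumes ij: "i \<in> I" "j \<in> I" "i \<noteq> j" and nf: "normal_form i j g (a, b, c, d)"
    and e: "[a = a1] (mod q)" "[b = b1] (mod q)" "[c = c1] (mod q)" "[d = d1] (mod q)"
  shows "normal_form i j g (a1, b1, c1, d1)"
proof -
  have det: "[a1 * d1 - b1 * c1 = 1] (mod q)"
    using nf cong_diff[OF cong_mult[OF e(1,4)] cong_mult[OF e(2,3)]] by (auto intro: cong_trans cong_sym)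
  have 1: "g = x j i (c1 * a') + h i j a1 a' + x i j (a' * b1)" if p: "inv_pair a1 a'" for a'
  proof -
    have p': "inv_pair a a'" using p e(1) inv_pair_cong cong_sym by blast
    then have "g = x j i (c * a') + h i j a a' + x i j (a' * b)" using nf by simp
    then show ?thesis
      using x_cong[of j i "c * a'" "c1 * a'"] x_cong[of i j "a' * b" "a' * b1"] h_cong_unit[OF ij p' p e(1)] ij e
      by (simp add: cong_scalar_left cong_scalar_right)
  qed
  have 2: "g = x j i (d1 * b') + w i j b1 b' + x j i (a1 * b')" if p: "inv_pair b1 b'" for b'
  proof -
    have p': "inv_pair b b'" using p e(2) inv_pair_cong cong_sym by blast
    then have "g = x j i (d * b') + w i j b b' + x j i (a * b')" using nf by simp
    then show ?thesis
      using x_cong[of j i "d * b'" "d1 * b'"] x_cong[of j i "a * b'" "a1 * b'"] w_cong_unit[OF ij p' p e(2)] ij e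
      by (simp add: cong_scalar_left cong_scalar_right)
  qed
  show ?thesis using det 1 2 by simp
qed

end

locale steinberg_local = steinberg_mod I x q for I :: "'i set" and x :: "'i \<Rightarrow> 'i \<Rightarrow> int \<Rightarrow> 'g::group_add" and q +
  fixes i j :: 'i
  assumes ij: "i \<in> I" "j \<in> I" "i \<noteq> j"
    and h_mult: "\<lbrakk>inv_pair u u'; inv_pair v v'\<rbrakk> \<Longrightarrow> h i j (u * v) (u' * v') = h i j u u' + h i j v v'"
    and local_ring: "inv_unit (a + b) \<Longrightarrow> inv_unit a \<or> inv_unit b"
    and nontrivial: "\<not> inv_unit 0"
begin

lemma h_w: "\<lbrakk>inv_pair u u'; inv_pair v v'\<rbrakk> \<Longrightarrow> h i j u u' + w i j v v' = w i j (u * v) (u' * v')"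
  using h_mult[of u u' v v'] by (simp add: h_def[of i j v] h_def[of i j "u * v"] free_group_simps del: add_uminus_conv_diff)
    (metis add.assoc add_right_cancel)

lemma w_w: 
  assumes "inv_pair u u'" "inv_pair v v'"
  shows "w i j u u' + w i j v v' = h i j (- u * v') (- u' * v)"
proof -
  have m1: "inv_pair (- 1) (- 1)" using inv_pair_uminus[OF inv_pair_one] .
  have 1: "h i j (- 1) (- 1) = - (w i j 1 1 + w i j 1 1)"
    using ij by (simp add: h_def w_uminus free_group_simps del: add_uminus_conv_diff)
  have "h i j (- 1) (- 1) + h i j (- 1) (- 1) = 0"
    using h_mult[OF m1 m1] by simp
  then have "w i j 1 1 + w i j 1 1 = h i j (- 1) (- 1)"
    unfolding 1 by (metis minus_unique minus_minus)
  then have "w i j u u' + w i j v v' = h i j (u * v') (u' * v) + h i j (- 1) (- 1)"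
    using assms by (simp add: w_add[OF ij assms(2), of u u'] h_mult inv_pair_commute)
  also have "\<dots> = h i j (u * v' * -1) (u' * v * -1)"
    using assms by (intro h_mult[symmetric] inv_pair_mult m1) (simp_all add: inv_pair_commute)
  finally show ?thesis by simp
qed

text \<open>If \<open>a\<close> and \<open>b\<close> are both units, the two decompositions give the same element: expand the upper
triangular factor of the first one by \<open>x_expand\<close> and collect \<open>h(a) w(a\<^sup>-\<^sup>1 b) = w(b)\<close>.\<close>
lemma forms_agree:
  assumes det: "[a * d - b * c = 1] (mod q)" and a: "inv_pair a a'" and b: "inv_pair b b'"
  shows "x j i (c * a') + h i j a a' + x i j (a' * b) = x j i (d * b') + w i j b b' + x j i (a * b')"
proof -
  note [simp] = ij ij(3)[symmetric] a b
  have y: "inv_pair (a' * b) (a * b')" by (simp add: inv_pair_mult inv_pair_commute)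
  have "x j i (c * a') + h i j a a' + x i j (a' * b)
     = x j i (c * a') + ((h i j a a' + x j i (a * b')) + w i j (a' * b) (a * b') + x j i (a * b'))"
    unfolding x_expand[OF ij y] by (simp add: add.assoc)
  also have "\<dots> = x j i (c * a' + a' * a' * (a * b')) + (h i j a a' + w i j (a' * b) (a * b')) + x j i (a * b')"
    by (simp add: h_x_ji x_add add.assoc)
  also have "h i j a a' + w i j (a' * b) (a * b') = w i j (a * (a' * b)) (a' * (a * b'))"
    using y by (simp add: h_w)
  also have "\<dots> = w i j b b'"
    by (rule w_cong_unit[OF ij inv_pair_mult[OF a y] b cong_of_inv_pair[OF a, where c = b]])
      (simp add: algebra_simps)
  also have "x j i (c * a' + a' * a' * (a * b')) = x j i (d * b')"
  proof (rule x_cong)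
    obtain k where k: "a * a' = 1 + q * k" using a by (metis inv_pair_def cong_iff_lin cong_sym)
    obtain l where l: "b * b' = 1 + q * l" using b by (metis inv_pair_def cong_iff_lin cong_sym)
    obtain m where m: "a * d - b * c = 1 + q * m" using det by (metis cong_iff_lin cong_sym)
    have "a' * b' * (a * d - b * c) = (a * a') * (d * b') - (b * b') * (c * a')"
      by (simp add: algebra_simps)
    then have "a' * b' * (1 + q * m) = (1 + q * k) * (d * b') - (1 + q * l) * (c * a')"
      unfolding k l m .
    moreover have "a' * a' * (a * b') = a' * b' * (a * a')" by (simp add: algebra_simps)
    then have "a' * a' * (a * b') = a' * b' * (1 + q * k)" unfolding k .
    ultimately have "c * a' + a' * a' * (a * b') - d * b'
        = q * (k * (a' * b') - m * (a' * b') - l * (c * a') + k * (d * b'))"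
      by (simp add: algebra_simps)
    then show "[c * a' + a' * a' * (a * b') = d * b'] (mod q)"
      unfolding cong_iff_dvd_diff by simp
  qed simp_all
  finally show ?thesis .
qed

lemma normal_form_one: "normal_form i j 0 (1, 0, 0, 1)"
proof -
  have "x j i (0 * a') + h i j 1 a' + x i j (a' * 0) = 0" if "inv_pair 1 a'" for a'
    using h_cong_unit[OF ij that inv_pair_one] ij by (simp add: x_zero)
  moreover have "\<not> inv_pair 0 b'" for b' using nontrivial by (auto simp: inv_unit_def)
  ultimately show ?thesis by simp
qed

text \<open>As long as \<open>a\<close> is a unit, multiplication by \<open>x\<^sub>i\<^sub>j(s)\<close> changes the last factor of the first
decomposition only, and the second decomposition follows from the first. The same holds for \<open>x\<^sub>j\<^sub>i(s)\<close>
and \<open>b\<close>.\<close>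
lemma normal_form_x_ij:
  assumes nf: "normal_form i j g (a, b, c, d)" and a: "inv_unit a"
  shows "normal_form i j (g + x i j s) (a, b + s * a, c, d + s * c)"
proof -
  have det: "[a * (d + s * c) - (b + s * a) * c = 1] (mod q)"
    using nf by (simp add: algebra_simps)
  have 1: "g + x i j s = x j i (c * a') + h i j a a' + x i j (a' * (b + s * a))" if p: "inv_pair a a'" for a'
  proof -
    have "x i j (a' * (b + s * a)) = x i j (a' * b + s)"
      by (rule x_inv_pair[OF p, where c = s]) (use ij in \<open>simp_all add: algebra_simps\<close>)
    then show ?thesis using nf p ij by (simp add: x_add add.assoc)
  qed
  obtain a' where a': "inv_pair a a'" using a by (auto simp: inv_unit_def)
  have "g + x i j s = x j i ((d + s * c) * b') + w i j (b + s * a) b' + x j i (a * b')"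
    if "inv_pair (b + s * a) b'" for b'
    using 1[OF a'] forms_agree[OF det a' that] by simp
  with 1 det show ?thesis by simp
qed

lemma normal_form_x_ji:
  assumes nf: "normal_form i j g (a, b, c, d)" and b: "inv_unit b"
  shows "normal_form i j (g + x j i s) (a + s * b, b, c + s * d, d)"
proof -
  have det: "[(a + s * b) * d - b * (c + s * d) = 1] (mod q)"
    using nf by (simp add: algebra_simps)
  have 1: "g + x j i s = x j i (d * b') + w i j b b' + x j i ((a + s * b) * b')" if p: "inv_pair b b'" for b'
  proof -
    have "x j i ((a + s * b) * b') = x j i (a * b' + s)"
      by (rule x_inv_pair[OF p, where c = s]) (use ij in \<open>simp_all add: algebra_simps\<close>)
    then show ?thesis using nf p ij by (simp add: x_add add.assoc)
  qed
  obtain b' where b': "inv_pair b b'" using b by (auto simp: inv_unit_def)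
  have "g + x j i s = x j i ((c + s * d) * a') + h i j (a + s * b) a' + x i j (a' * b)"
    if "inv_pair (a + s * b) a'" for a'
    using 1[OF b'] forms_agree[OF det that b'] by simp
  with 1 det show ?thesis by simp
qed

lemma normal_form_w:
  assumes nf: "normal_form i j g (a, b, c, d)" and s: "inv_pair s s'"
  shows "normal_form i j (g + w i j s s') (- b * s', a * s, - d * s', c * s)"
proof -
  obtain k where k: "s * s' = 1 + q * k" using s by (metis inv_pair_def cong_iff_lin cong_sym)
  have "[a * d - b * c = 1] (mod q)" using nf by simp
  then obtain m where m: "a * d - b * c = 1 + q * m" by (metis cong_iff_lin cong_sym)
  have "- b * s' * (c * s) - a * s * (- d * s') = (s * s') * (a * d - b * c)"
    by (simp add: algebra_simps)
  also have "\<dots> = 1 + q * (k + m + q * k * m)"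
    unfolding k m by (simp add: algebra_simps)
  finally have det: "[- b * s' * (c * s) - a * s * (- d * s') = 1] (mod q)"
    by (simp add: cong_iff_dvd_diff)
  have 1: "g + w i j s s' = x j i (- d * s' * e) + h i j (- b * s') e + x i j (e * (a * s))"
    if e: "inv_pair (- b * s') e" for e
  proof -
    have b: "inv_pair b (- s' * e)" using e by (simp add: inv_pair_def mult_ac)
    have bs: "inv_pair (- b * s') (- (- s' * e) * s)"
      using inv_pair_uminus[OF inv_pair_mult[OF b inv_pair_commute[OF s]]] by simp
    have "g + w i j s s' = x j i (d * (- s' * e)) + (w i j b (- s' * e) + (x j i (a * (- s' * e)) + w i j s s'))"
      using nf b by (simp add: add.assoc)
    also have "\<dots> = x j i (d * (- s' * e)) + ((w i j b (- s' * e) + w i j s s') + x i j (- (s^2 * (a * (- s' * e)))))"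
      by (simp only: x_ji_w[OF ij s] add.assoc)
    also have "w i j b (- s' * e) + w i j s s' = h i j (- b * s') (- (- s' * e) * s)"
      by (rule w_w[OF b s])
    also have "\<dots> = h i j (- b * s') e"
      by (rule h_cong_unit[OF ij bs e cong_refl])
    also have "x i j (- (s^2 * (a * (- s' * e)))) = x i j (e * (a * s))"
      by (rule x_inv_pair[OF s ij, where c = "a * e * s"]) (simp add: algebra_simps power2_eq_square)
    finally show ?thesis by (simp add: mult_ac add.assoc)
  qed
  have 2: "g + w i j s s' = x j i (c * s * e) + w i j (a * s) e + x j i (- b * s' * e)"
    if e: "inv_pair (a * s) e" for e
  proof -
    have a: "inv_pair a (s * e)" using e by (simp add: inv_pair_def mult_ac)
    have as: "inv_pair (a * s) (s * e * s')" by (rule inv_pair_mult[OF a s])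
    have "g + w i j s s' = x j i (c * (s * e)) + (h i j a (s * e) + (x i j (s * e * b) + w i j s s'))"
      using nf a by (simp add: add.assoc)
    also have "\<dots> = x j i (c * (s * e)) + ((h i j a (s * e) + w i j s s') + x j i (- (s'^2 * (s * e * b))))"
      by (simp only: x_ij_w[OF ij s] add.assoc)
    also have "h i j a (s * e) + w i j s s' = w i j (a * s) (s * e * s')"
      by (rule h_w[OF a s])
    also have "\<dots> = w i j (a * s) e"
      by (rule w_cong_unit[OF ij as e cong_refl])
    also have "x j i (- (s'^2 * (s * e * b))) = x j i (- b * s' * e)"
      by (rule x_inv_pair[OF s, where c = "- b * e * s'"]) (use ij in \<open>simp_all add: algebra_simps power2_eq_square\<close>)
    finally show ?thesis by (simp add: mult_ac add.assoc)
  qed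
  show ?thesis using det 1 2 by simp
qed

lemma inv_unit_one: "inv_unit 1"
  unfolding inv_unit_def by (rule exI[of _ 1]) simp

lemma inv_unit_factor: "inv_unit (a * b) \<Longrightarrow> inv_unit a"
  unfolding inv_unit_def inv_pair_def mult.assoc by blast

lemma inv_unit_minus: "inv_unit (- a) \<longleftrightarrow> inv_unit a"
  unfolding inv_unit_def using inv_pair_uminus[of a] inv_pair_uminus[of "- a"] by auto

lemma inv_unit_cong: "[a = b] (mod q) \<Longrightarrow> inv_unit a \<longleftrightarrow> inv_unit b"
  unfolding inv_unit_def using inv_pair_cong cong_sym by blast

lemma row_unit:
  assumes "normal_form i j g (a, b, c, d)"
  shows "inv_unit a \<or> inv_unit b"
proof -
  have "inv_unit (a * d + - (b * c))"
    using assms inv_unit_cong[of "a * d - b * c" 1] inv_unit_one by auto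
  then show ?thesis using local_ring inv_unit_factor inv_unit_minus by blast
qed

lemma nonunit_shift:
  assumes "inv_unit b" "\<not> inv_unit a"
  shows "inv_unit (b + s * a)"
proof (rule ccontr)
  assume "\<not> inv_unit (b + s * a)"
  moreover have "inv_unit ((b + s * a) + - (s * a))" using assms by simp
  ultimately have "inv_unit (- (s * a))" using local_ring by blast
  then have "inv_unit (a * s)" by (simp add: inv_unit_minus mult.commute)
  then show False using assms inv_unit_factor by blast
qed

text \<open>If \<open>a\<close> is not a unit, factor \<open>x\<^sub>i\<^sub>j(s) = x\<^sub>j\<^sub>i(s\<^sup>-\<^sup>1) w(s) x\<^sub>j\<^sub>i(s\<^sup>-\<^sup>1)\<close>. Then \<open>b\<close> is a unit, and the entry
in its place is still one when the last factor is applied, because \<open>b + s a\<close> is a unit; so each of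
the three steps preserves the normal form.\<close>
lemma normal_form_x_ij_unit:
  assumes nf: "normal_form i j g (a, b, c, d)" and s: "inv_pair s s'"
  shows "normal_form i j (g + x i j s) (a, b + s * a, c, d + s * c)"
proof (cases "inv_unit a")
  case True
  then show ?thesis using normal_form_x_ij[OF nf] by blast
next
  case False
  then have b: "inv_unit b" using row_unit[OF nf] by blast
  note nf1 = normal_form_x_ji[OF nf b, of s']
  note nf2 = normal_form_w[OF nf1 s]
  have e: "[(a + s' * b) * s = b + s * a] (mod q)"
    by (rule cong_of_inv_pair[OF s, where c = b]) (simp add: algebra_simps)
  have "inv_unit ((a + s' * b) * s)" using nonunit_shift[OF b False] inv_unit_cong[OF e] by blast
  note nf3 = normal_form_x_ji[OF nf2 this, of s']
  have eq: "g + x j i s' + w i j s s' + x j i s' = g + x i j s"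
    by (simp add: x_expand[OF ij s] add.assoc)
  show ?thesis
    by (rule normal_form_cong[OF ij nf3[unfolded eq] cong_of_inv_pair[OF s, where c = "a + s' * b"] e
        cong_of_inv_pair[OF s, where c = "c + s' * d"] cong_of_inv_pair[OF s, where c = d]])
      (simp_all add: algebra_simps)
qed

lemma normal_form_x_ji_unit:
  assumes nf: "normal_form i j g (a, b, c, d)" and s: "inv_pair s s'"
  shows "normal_form i j (g + x j i s) (a + s * b, b, c + s * d, d)"
proof (cases "inv_unit b")
  case True
  then show ?thesis using normal_form_x_ji[OF nf] by blast
next
  case False
  then have a: "inv_unit a" using row_unit[OF nf] by blast
  note nf1 = normal_form_x_ij[OF nf a, of s']
  note nf2 = normal_form_w[OF nf1 inv_pair_uminus[OF inv_pair_commute[OF s]]]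
  have e: "[- (b + s' * a) * - s = a + s * b] (mod q)"
    by (rule cong_of_inv_pair[OF s, where c = a]) (simp add: algebra_simps)
  have "inv_unit (- (b + s' * a) * - s)" using nonunit_shift[OF a False] inv_unit_cong[OF e] by blast
  note nf3 = normal_form_x_ij[OF nf2 this, of s']
  have "w i j (- s') (- s) = - x i j s' + x j i s - x i j s'"
    using ij by (simp add: w_def x_minus)
  then have eq: "g + x i j s' + w i j (- s') (- s) + x i j s' = g + x j i s"
    by (simp add: free_group_simps del: add_uminus_conv_diff)
  show ?thesis
    by (rule normal_form_cong[OF ij nf3[unfolded eq] e cong_of_inv_pair[OF s, where c = "b + s' * a"]
        cong_of_inv_pair[OF s, where c = c] cong_of_inv_pair[OF s, where c = "d + s' * c"]])
      (simp_all add: algebra_simps)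
qed

lemma nonunit_pred:
  assumes "\<not> inv_unit s"
  shows "inv_unit (s - 1)"
  using assms local_ring[of s "- (s - 1)"] inv_unit_one inv_unit_minus[of "s - 1"] by simp

text \<open>A coefficient \<open>s\<close> that is not a unit is the sum of the units \<open>1\<close> and \<open>s - 1\<close>.\<close>
lemma normal_form_step:
  assumes nf: "normal_form i j g m"
  shows "normal_form i j (g + (if p then x i j s else x j i s)) (elem_step m (p, s))"
proof -
  obtain a b c d where m: "m = (a, b, c, d)" by (metis prod_cases4)
  note one = inv_pair_one
  note nf' = nf[unfolded m]
  show ?thesis
  proof (cases "inv_unit s")
    case True
    then obtain s' where s: "inv_pair s s'" by (auto simp: inv_unit_def)
    show ?thesis using normal_form_x_ij_unit[OF nf' s] normal_form_x_ji_unit[OF nf' s]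
      by (cases p) (simp_all add: m)
  next
    case False
    then obtain t' where t: "inv_pair (s - 1) t'" using nonunit_pred by (auto simp: inv_unit_def)
    have "g + x i j 1 + x i j (s - 1) = g + x i j s" "g + x j i 1 + x j i (s - 1) = g + x j i s"
      using ij x_add[of i j 1 "s - 1"] x_add[of j i 1 "s - 1"] by (simp_all add: add.assoc)
    then show ?thesis
      using normal_form_x_ij_unit[OF normal_form_x_ij_unit[OF nf' one] t]
        normal_form_x_ji_unit[OF normal_form_x_ji_unit[OF nf' one] t]
      by (cases p) (simp_all add: m algebra_simps)
  qed
qed

lemma word_normal_form: "normal_form i j (word_value (x i j) (x j i) ws) (word_matrix ws)"
proof (induction ws rule: rev_induct)
  case Nil
  then show ?case using normal_form_one by simp
next
  case (snoc v ws)
  then show ?case using normal_form_step[OF snoc] by (cases v) simp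
qed

theorem word_value_zero:
  assumes "word_matrix ws = (a, b, c, d)" "[a = 1] (mod q)" "[b = 0] (mod q)" "[c = 0] (mod q)" "[d = 1] (mod q)"
  shows "word_value (x i j) (x j i) ws = 0"
proof -
  have "normal_form i j (word_value (x i j) (x j i) ws) (1, 0, 0, 1)"
    by (rule normal_form_cong[OF ij word_normal_form[of ws, unfolded assms(1)] assms(2-5)])
  then have "word_value (x i j) (x j i) ws = x j i (0 * 1) + h i j 1 1 + x i j (1 * 0)"
    unfolding normal_form.simps using inv_pair_one by blast
  then show ?thesis using ij by (simp add: x_zero)
qed

end

section \<open>Symbols modulo odd prime powers\<close>
lemma prime_power_cong_one:
  fixes a :: int
  assumes "[a = 1] (mod int p)"
  shows "[a ^ (p ^ k) = 1] (mod int p ^ Suc k)"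
proof (induction k)
  case 0
  then show ?case using assms by simp
next
  case (Suc k)
  let ?b = "a ^ (p ^ k)"
  have 1: "int p ^ Suc k dvd ?b - 1" using Suc by (simp add: cong_iff_dvd_diff)
  have "[?b = 1 ^ (p ^ k)] (mod int p)" by (intro cong_pow assms)
  then have "[(\<Sum>i<p. ?b ^ i) = (\<Sum>i<p. 1 ^ i)] (mod int p)"
    by (intro cong_sum cong_pow) simp
  then have 2: "int p dvd (\<Sum>i<p. ?b ^ i)" by (simp add: cong_0_iff cong_def dvd_eq_mod_eq_0)
  have "?b ^ p - 1 = (?b - 1) * (\<Sum>i<p. ?b ^ i)"
    by (simp add: power_diff_1_eq)
  then have "int p ^ Suc k * int p dvd ?b ^ p - 1" using 1 2 by (metis mult_dvd_mono)
  moreover have "a ^ (p ^ Suc k) = ?b ^ p" by (simp add: power_mult[symmetric] mult.commute)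
  ultimately show ?case by (simp add: cong_iff_dvd_diff mult_ac)
qed

lemma pow3_two_power: "[(3::int) ^ (2 ^ Suc m) = 1 + 2 ^ (m + 3)] (mod 2 ^ (m + 4))"
proof (induction m)
  case 0
  then show ?case by (simp add: cong_def)
next
  case (Suc m)
  then obtain t where t: "(3::int) ^ (2 ^ Suc m) = 1 + 2 ^ (m + 3) + 2 ^ (m + 4) * t"
    by (metis cong_iff_lin cong_sym)
  have "(3::int) ^ (2 ^ Suc (Suc m)) = (1 + 2 ^ (m + 3) + 2 ^ (m + 4) * t) ^ 2"
    unfolding t[symmetric] by (simp add: power_mult[symmetric] mult.commute)
  also have "\<dots> = 1 + 2 ^ (m + 4) + 2 ^ (m + 5) * (t + 2 ^ (m + 1) * (1 + 2 * t) ^ 2)"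
    by (simp add: power2_eq_square algebra_simps power_add)
  finally have "(3::int) ^ (2 ^ Suc (Suc m)) - (1 + 2 ^ (Suc m + 3))
      = 2 ^ (Suc m + 4) * (t + 2 ^ (m + 1) * (1 + 2 * t) ^ 2)"
    by (simp only: add_Suc) (simp add: algebra_simps)
  then show ?case unfolding cong_iff_dvd_diff by (metis dvd_triv_left)
qed

lemma odd_cong_plus_minus_pow3:
  fixes u :: int
  assumes "odd u"
  shows "\<exists>i s. (s = 1 \<or> s = -1) \<and> [u = s * 3 ^ i] (mod 2 ^ k)"
proof (induction k)
  case 0
  then show ?case by (auto intro!: exI[of _ "1::int"])
next
  case (Suc k)
  show ?case
  proof (cases "k < 3")
    case True
    have "u mod 8 = 1 \<or> u mod 8 = 3 \<or> u mod 8 = 5 \<or> u mod 8 = 7" using assms by presburger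
    then have d: "[u = 1 * 3 ^ 0] (mod 8) \<or> [u = 1 * 3 ^ 1] (mod 8) \<or> [u = -1 * 3 ^ 1] (mod 8) \<or> [u = -1 * 3 ^ 0] (mod 8)"
      by (auto simp: cong_def)
    have "\<exists>i s. (s = 1 \<or> s = -1) \<and> [u = s * 3 ^ i] (mod 8)"
      using d by (elim disjE) blast+
    moreover have "(2::int) ^ Suc k dvd 2 ^ 3" using True by (intro le_imp_power_dvd) simp
    then have "(2::int) ^ Suc k dvd 8" by simp
    ultimately show ?thesis using cong_dvd_modulus by blast
  next
    case False
    then obtain m where k: "k = m + 3" by (metis add.commute le_Suc_ex not_less)
    obtain i s where s: "s = 1 \<or> s = -1" and "[u = s * 3 ^ i] (mod 2 ^ k)" using Suc by blast
    then obtain t where t: "u = s * 3 ^ i + 2 ^ k * t" by (metis cong_iff_lin cong_sym)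
    show ?thesis
    proof (cases "even t")
      case True
      then obtain r where "t = 2 * r" by auto
      then have "[u = s * 3 ^ i] (mod 2 ^ Suc k)" using t by (simp add: cong_iff_dvd_diff)
      then show ?thesis using s by blast
    next
      case False
      have "odd (s * 3 ^ i)" using s by auto
      then have "even (t - s * 3 ^ i)" using False by simp
      then obtain r where r: "t - s * 3 ^ i = 2 * r" by (rule evenE)
      have "u - s * 3 ^ i * (1 + 2 ^ k) = 2 ^ k * (t - s * 3 ^ i)"
        using t by (simp add: algebra_simps)
      then have 1: "[u = s * 3 ^ i * (1 + 2 ^ k)] (mod 2 ^ Suc k)"
        unfolding r by (simp add: cong_iff_dvd_diff)
      have 2: "[s * 3 ^ i * (1 + 2 ^ k) = s * 3 ^ i * 3 ^ (2 ^ Suc m)] (mod 2 ^ Suc k)"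
        using cong_sym[OF pow3_two_power[of m]] k by (intro cong_scalar_left) (simp add: add.commute)
      show ?thesis
        by (rule exI[of _ "i + 2 ^ Suc m"], rule exI[of _ s])
          (use s cong_trans[OF 1 2] in \<open>simp add: power_add mult.assoc\<close>)
    qed
  qed
qed

context steinberg_mod begin

lemma inv_pair_power: "inv_pair u u' \<Longrightarrow> inv_pair (u ^ n) (u' ^ n)"
  by (induction n) (auto intro: inv_pair_mult)

lemma symb_power_left:
  assumes ij: "i \<in> I" "j \<in> I" "i \<noteq> j" and p: "inv_pair u u'" "inv_pair v v'"
    and two: "symb i j u u' v v' + symb i j u u' v v' = 0"
  shows "symb i j (u ^ n) (u' ^ n) v v' = (if odd n then symb i j u u' v v' else 0)"
proof (induction n)
  case 0
  then show ?case by (simp add: symb_one)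
next
  case (Suc n)
  then show ?case using symb_mult_left[OF ij p(1) inv_pair_power[OF p(1), of n] p(2)] two by auto
qed

lemma symb_power_right:
  assumes ij: "i \<in> I" "j \<in> I" "i \<noteq> j" and p: "inv_pair u u'" "inv_pair v v'"
    and two: "symb i j v v' u u' + symb i j v v' u u' = 0"
  shows "symb i j v v' (u ^ n) (u' ^ n) = (if odd n then symb i j v v' u u' else 0)"
proof (induction n)
  case 0
  then show ?case using symb_skew[OF ij p(2) inv_pair_one] by (simp add: symb_one)
next
  case (Suc n)
  then show ?case using symb_mult_right[OF ij p(1) inv_pair_power[OF p(1), of n] p(2)] two by auto
qed

lemma symb_self_two: "\<lbrakk>i \<in> I; j \<in> I; i \<noteq> j; inv_pair u u'\<rbrakk> \<Longrightarrow> symb i j u u' u u' + symb i j u u' u u' = 0"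
  using symb_skew[of i j u u' u u'] by (metis add.right_inverse)

text \<open>\<open>{u, u}\<close> has order at most 2 by skew symmetry, so only the parity of exponents matters.\<close>
lemma symb_powers:
  assumes ij: "i \<in> I" "j \<in> I" "i \<noteq> j" and p: "inv_pair u u'"
  shows "symb i j (u ^ m) (u' ^ m) (u ^ n) (u' ^ n) = (if odd m \<and> odd n then symb i j u u' u u' else 0)"
proof -
  note two = symb_self_two[OF ij p]
  have "symb i j u u' (u ^ n) (u' ^ n) = (if odd n then symb i j u u' u u' else 0)"
    by (rule symb_power_right[OF ij p p two])
  moreover from this have "symb i j (u ^ m) (u' ^ m) (u ^ n) (u' ^ n)
      = (if odd m then symb i j u u' (u ^ n) (u' ^ n) else 0)"
    using two by (intro symb_power_left[OF ij p inv_pair_power[OF p]]) auto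
  ultimately show ?thesis by simp
qed

lemma inv_pair_exists: "coprime u q \<Longrightarrow> \<exists>u'. inv_pair u u'"
  unfolding inv_pair_def by (rule cong_solve_coprime_int)

lemma inv_pair_coprime: "inv_pair u u' \<Longrightarrow> coprime u q"
  unfolding inv_pair_def using coprime_iff_invertible_int by blast

lemma symb_flip:
  assumes ij: "i \<in> I" "j \<in> I" "i \<noteq> j" and p: "inv_pair u u'" "inv_pair v v'"
    and 0: "symb i j u u' v v' = 0"
  shows "symb i j u u' v' v = 0"
proof -
  have "symb i j v v' u u' = 0" using symb_skew[OF ij p(2,1)] 0 by simp
  then have "symb i j v' v u u' = 0" by (rule symb_inverse_zero[OF ij inv_pair_commute[OF p(2)] p(1)])
  then show ?thesis using symb_skew[OF ij p(1) inv_pair_commute[OF p(2)]] by simp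
qed

text \<open>Let \<open>g\<close> be a primitive root and \<open>n\<close> the least positive integer that is an odd power of \<open>g\<close>. Then \<open>n\<close> is
not \<open>1\<close> modulo \<open>p\<close>, since otherwise its logarithm would be even; hence \<open>n - 1\<close> is a unit and, by
minimality, an even power of \<open>g\<close>. So \<open>1/n\<close> and \<open>1 - 1/n = (n - 1)/n\<close> are both odd powers of \<open>g\<close>, and
\<open>{1/n, 1 - 1/n} = 0\<close> means \<open>{g, g} = 0\<close>.\<close>
lemma symb_zero_odd_prime_power:
  assumes ij: "i \<in> I" "j \<in> I" "i \<noteq> j" and p: "prime p" "odd p" and q: "q = int (p ^ Suc k)"
    and u: "inv_pair u u'" and v: "inv_pair v v'"
  shows "symb i j u u' v v' = 0"
proof -
  obtain g where g: "residue_primroot (p ^ Suc k) g"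
    using residue_primroot_odd_prime_power_exists[OF p] by (metis zero_less_Suc)
  have p3: "p > 2" using p prime_ge_2_nat[of p] by (cases "p = 2") auto
  have "p ^ 1 \<le> p ^ Suc k" using p3 by (intro power_increasing) auto
  then have m2: "p ^ Suc k > 2" using p3 by (simp only: power_one_right)
  have cop: "coprime g (p ^ Suc k)" and ord: "ord (p ^ Suc k) g = totient (p ^ Suc k)"
    using g by (auto simp: residue_primroot_def coprime_commute)
  have ev: "even (totient (p ^ Suc k))" using totient_even m2 by blast
  obtain g' where gg: "inv_pair (int g) g'"
    using inv_pair_exists[of "int g"] cop unfolding q by (auto simp: coprime_int_iff)
  let ?t = "symb i j (int g) g' (int g) g'"
  have dlog: "\<exists>m. [z = int g ^ m] (mod q)" if z: "inv_pair z z'" for z z'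
  proof -
    let ?z = "nat (z mod q)"
    have q0: "q > 2" using m2 unfolding q by linarith
    then have zz: "int ?z = z mod q" by simp
    have "coprime (int ?z) q" unfolding zz using inv_pair_coprime[OF z] q0 by (simp add: coprime_mod_left_iff)
    then have c: "coprime ?z (p ^ Suc k)" unfolding q by (simp only: coprime_int_iff)
    have "?z \<noteq> 0"
    proof
      assume "?z = 0"
      then have "coprime 0 (p ^ Suc k)" using c by simp
      then show False using m2 by simp
    qed
    moreover have "?z \<le> p ^ Suc k"
      using pos_mod_bound[of q z] q0 unfolding q by linarith
    ultimately have "?z \<in> totatives (p ^ Suc k)" using c by (simp add: totatives_def)
    then obtain l where "g ^ l mod p ^ Suc k = ?z"
      using residue_primroot_is_generator[OF _ g] m2 unfolding bij_betw_def by force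
    then have "int (g ^ l) mod q = z mod q" using zz unfolding q by (metis of_nat_mod)
    then show ?thesis by (intro exI[of _ l]) (simp add: cong_def)
  qed
  \<comment> \<open>a power of \<open>g\<close> that is 1 modulo \<open>p\<close> has order a power of \<open>p\<close>, while the order of \<open>g\<close> itself is even\<close>
  have even_log: "even m" if "[int g ^ m = 1] (mod int p)" for m
  proof -
    have "[(int g ^ m) ^ (p ^ k) = 1] (mod q)"
      using prime_power_cong_one[OF that, of k] by (simp add: q)
    then have "[g ^ (m * p ^ k) = 1] (mod (p ^ Suc k))"
      unfolding q using cong_int_iff[of "g ^ (m * p ^ k)" 1 "p ^ Suc k"] by (simp add: power_mult)
    then have "totient (p ^ Suc k) dvd m * p ^ k" using ord by (simp add: ord_divides')
    then have "even (m * p ^ k)" using ev by (meson dvd_trans)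
    then show ?thesis using p by simp
  qed
  let ?P = "\<lambda>n::nat. n \<ge> 1 \<and> (\<exists>m. odd m \<and> [int n = int g ^ m] (mod q))"
  define n where "n = (LEAST n. ?P n)"
  have "g \<noteq> 0"
  proof
    assume "g = 0"
    then show False using cop m2 by simp
  qed
  then have "?P g" by (intro conjI exI[of _ 1]) auto
  then have n: "?P n" unfolding n_def by (rule LeastI)
  then obtain m where m: "odd m" "[int n = int g ^ m] (mod q)" by blast
  have min: "\<not> ?P l" if "l < n" for l using that unfolding n_def by (rule not_less_Least)
  have nn: "inv_pair (int n) (g' ^ m)"
    using inv_pair_cong[OF inv_pair_power[OF gg] cong_sym[OF m(2)]] .
  have pq: "int p dvd q" by (simp add: q)
  have n1: "\<not> [int n = 1] (mod int p)"
    using even_log[of m] m cong_dvd_modulus[OF m(2) pq] cong_trans cong_sym by metis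
  then have "n \<noteq> 1" by auto
  then have n2: "n \<ge> 2" using n by simp
  have "coprime (int n - 1) (int p)"
    using n1 p by (metis cong_iff_dvd_diff coprime_commute prime_imp_coprime prime_nat_int_transfer)
  then have "coprime (int n - 1) q" unfolding q by simp
  then obtain e where e: "inv_pair (int n - 1) e" using inv_pair_exists by blast
  then obtain l where l: "[int n - 1 = int g ^ l] (mod q)" using dlog by blast
  have "even l"
    using min[of "n - 1"] l n2 by (auto simp: of_nat_diff)
  note powers = symb_powers[OF ij gg]
  let ?n' = "g' ^ m"
  have nn': "inv_pair ?n' (int n)" by (rule inv_pair_commute[OF nn])
  have st: "[?n' + (int n - 1) * ?n' = 1] (mod q)"
    using nn by (simp add: inv_pair_def algebra_simps)
  \<comment> \<open>the Steinberg relation for \<open>1/n\<close> and \<open>(n - 1)/n\<close>\<close>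
  have "0 = symb i j ((int n - 1) * ?n') (e * int n) ?n' (int n)"
    by (rule sym, rule symb_steinberg[OF ij nn' inv_pair_mult[OF e nn'] st])
  also have "\<dots> = symb i j (int n - 1) e ?n' (int n) + symb i j ?n' (int n) ?n' (int n)"
    by (rule symb_mult_left[OF ij e nn' nn'])
  also have "symb i j (int n - 1) e ?n' (int n) = symb i j (int g ^ l) (g' ^ l) (g' ^ m) (int g ^ m)"
    by (rule symb_cong[OF ij e nn' inv_pair_power[OF gg] inv_pair_commute[OF inv_pair_power[OF gg]] l cong_refl])
  also have "\<dots> = 0"
  proof (rule symb_flip[OF ij inv_pair_power[OF gg] inv_pair_power[OF gg]])
    show "symb i j (int g ^ l) (g' ^ l) (int g ^ m) (g' ^ m) = 0" using powers \<open>even l\<close> by simp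
  qed
  finally have "symb i j ?n' (int n) ?n' (int n) = 0" by simp
  then have "symb i j ?n' (int n) (int n) ?n' = 0"
    by (rule symb_flip[OF ij nn' nn'])
  then have "symb i j (int n) ?n' (int n) ?n' = 0"
    by (rule symb_inverse_zero[OF ij nn nn])
  then have "symb i j (int g ^ m) (g' ^ m) (int g ^ m) (g' ^ m) = 0"
    using symb_cong[OF ij nn nn inv_pair_power[OF gg] inv_pair_power[OF gg] m(2) m(2)] by simp
  then have t0: "?t = 0" using powers[of m m] m by simp
  obtain a b where ab: "[u = int g ^ a] (mod q)" "[v = int g ^ b] (mod q)"
    using dlog u v by blast
  show ?thesis
    using symb_cong[OF ij u v inv_pair_power[OF gg] inv_pair_power[OF gg] ab] powers[of a b] t0 by simp
qed

end

section \<open>Symbols modulo powers of two\<close>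
lemma five_cong_minus_pow3: "\<exists>l. odd l \<and> [5 = - (3 ^ l)] (mod (2::int) ^ k)"
proof (cases "k \<le> 3")
  case True
  then have "(2::int) ^ k dvd 2 ^ 3" by (rule le_imp_power_dvd)
  then have "[5 = - (3 ^ 1)] (mod (2::int) ^ k)" by (simp add: cong_iff_dvd_diff)
  then show ?thesis by (intro exI[of _ 1]) simp
next
  case False
  obtain l s where s: "s = 1 \<or> s = - 1" and l: "[5 = s * 3 ^ l] (mod (2::int) ^ k)"
    using odd_cong_plus_minus_pow3[of 5 k] by auto
  have "(2::int) ^ 3 dvd 2 ^ k" using False by (intro le_imp_power_dvd) simp
  then have l8: "[5 = s * 3 ^ l] (mod 8)" using cong_dvd_modulus[OF l] by simp
  have sq: "[(3::int) ^ (2 * n) = 1] (mod 8)" for n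
    using cong_pow[of "9::int" 1 8 n] by (simp add: power_mult cong_def)
  have "odd l \<and> s = - 1"
  proof (cases "even l")
    case True
    then obtain n where "l = 2 * n" by auto
    then have "[5 = s * 3 ^ (2 * n)] (mod 8)" using l8 by simp
    then have "[5 = s * 1] (mod 8)" using cong_trans cong_scalar_left[OF sq] by blast
    then show ?thesis using s by (auto simp: cong_def)
  next
    case False
    then obtain n where n: "l = Suc (2 * n)" by (elim oddE) simp
    then have "[5 = s * 3 * 3 ^ (2 * n)] (mod 8)" using l8 by (simp add: mult.assoc)
    then have "[5 = s * 3 * 1] (mod 8)" using cong_trans cong_scalar_left[OF sq] by blast
    then show ?thesis using s False by (auto simp: cong_def)
  qed
  then show ?thesis using l by auto
qed

context steinberg_mod begin

lemma h_mult_of_symb_zero: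
  "symb i j u u' v v' = 0 \<Longrightarrow> h i j (u * v) (u' * v') = h i j v v' + h i j u u'"
  unfolding symb_def by (metis diff_add_cancel add.left_neutral)

lemma inv_pair_minus_one: "inv_pair (- 1) (- 1)"
  using inv_pair_uminus[OF inv_pair_one] .

lemma h_minus_one_twice:
  assumes ij: "i \<in> I" "j \<in> I" "i \<noteq> j"
  shows "h i j (- 1) (- 1) + h i j (- 1) (- 1) = - (w i j 1 1 + w i j 1 1 + (w i j 1 1 + w i j 1 1))"
proof -
  have "h i j (- 1) (- 1) = - (w i j 1 1 + w i j 1 1)"
    using ij by (simp add: h_def w_uminus free_group_simps del: add_uminus_conv_diff)
  then show ?thesis by (simp only: minus_add)
qed

lemma x_ji_expand:
  assumes ij: "i \<in> I" "j \<in> I" "i \<noteq> j"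
  shows "x j i s = x i j s' + w i j (- s') (- s) + x i j s'"
proof -
  have "w i j (- s') (- s) = - x i j s' + x j i s - x i j s'"
    using ij by (simp add: w_def x_minus)
  then show ?thesis
    by (simp add: free_group_simps del: add_uminus_conv_diff)
qed

lemma cj_w1_w1_h:
  assumes ij: "i \<in> I" "j \<in> I" "i \<noteq> j" and p: "inv_pair v v'"
  shows "(w i j 1 1 + w i j 1 1) + h i j v v' = h i j v v' + (w i j 1 1 + w i j 1 1)"
proof -
  have "cj (w i j 1 1 + w i j 1 1) (h i j v v') = h i j v v'"
    by (simp add: cj_cj cj_w1_h[OF ij p] cj_w1_h[OF ij inv_pair_commute[OF p]])
  then show ?thesis by (simp add: cj_eq_iff)
qed

lemma w1_w1_x_ji:
  assumes ij: "i \<in> I" "j \<in> I" "i \<noteq> j"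
  shows "(w i j 1 1 + w i j 1 1) + x j i t = x j i t + (w i j 1 1 + w i j 1 1)"
proof -
  have "cj (w i j 1 1 + w i j 1 1) (x j i t) = x j i t"
    using ij by (simp add: cj_cj cj_w_ij cj_w_ji)
  then show ?thesis by (simp add: cj_eq_iff)
qed

text \<open>The decomposition of \<open>x\<^sub>i\<^sub>j(y) x\<^sub>j\<^sub>i(s)\<close> as lower triangular times diagonal times upper triangular for
units \<open>s\<close> and \<open>r = 1 + y s\<close>, with the diagonal part as an explicit product of elements \<open>h\<close>.\<close>
lemma x_ij_x_ji_unit:
  assumes ij: "i \<in> I" "j \<in> I" "i \<noteq> j" and s: "inv_pair s s'" and r: "inv_pair r v"
    and rys: "[r = 1 + y * s] (mod q)"
  shows "x i j y + x j i s = x j i (s * v)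
     + (h i j (r * s') (v * s) + h i j (- s) (- s') + (w i j 1 1 + w i j 1 1)) + x i j (y * v)"
proof -
  note ms = inv_pair_uminus[OF inv_pair_commute[OF s]]
  note rs = inv_pair_mult[OF r inv_pair_commute[OF s]]
  obtain a where a: "s * s' = 1 + q * a" using s by (metis inv_pair_def cong_iff_lin cong_sym)
  obtain b where b: "r * v = 1 + q * b" using r by (metis inv_pair_def cong_iff_lin cong_sym)
  obtain c where c: "r = 1 + y * s + q * c" using rys by (metis cong_iff_lin cong_sym)
  have "y + s' - r * s' = y + s' - (1 + y * s + q * c) * s'" unfolding c ..
  also have "\<dots> = y * (1 - s * s') - q * c * s'" by (simp add: algebra_simps)
  also have "\<dots> = q * (- y * a - c * s')" unfolding a by (simp add: algebra_simps)
  finally have 1: "[y + s' = r * s'] (mod q)" unfolding cong_iff_dvd_diff by simp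
  have "- ((- s')^2 * (v * s)) + s' - y * v = s' - (s * s') * s' * v - y * v"
    by (simp add: power2_eq_square)
  also have "\<dots> = s' - s' * v - y * v - q * (a * s' * v)" unfolding a by (simp add: algebra_simps)
  also have "s' - s' * v - y * v = s' - s' * v - y * (s * s' - q * a) * v"
    unfolding a by simp
  also have "\<dots> = s' - s' * v * (1 + y * s) + q * (a * y * v)"
    by (simp add: algebra_simps)
  also have "1 + y * s = r - q * c" using c by simp
  also have "s' - s' * v * (r - q * c) + q * (a * y * v) - q * (a * s' * v)
     = s' * (1 - r * v) + q * (s' * v * c + a * y * v - a * s' * v)"
    by (simp add: algebra_simps)
  also have "\<dots> = q * (- s' * b + s' * v * c + a * y * v - a * s' * v)"
    unfolding b by (simp add: algebra_simps)
  finally have 2: "[- ((- s')^2 * (v * s)) + s' = y * v] (mod q)" unfolding cong_iff_dvd_diff by simp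
  have "x i j y + x j i s = x i j (y + s') + w i j (- s') (- s) + x i j s'"
    by (subst x_ji_expand[OF ij, of s s']) (simp add: x_add[OF ij] add.assoc)
  also have "x i j (y + s') = x i j (r * s')" by (rule x_cong[OF ij 1])
  also have "\<dots> = x j i (v * s) + w i j (r * s') (v * s) + x j i (v * s)"
    by (rule x_expand[OF ij rs])
  also have "x j i (v * s) + w i j (r * s') (v * s) + x j i (v * s) + w i j (- s') (- s) + x i j s'
     = x j i (v * s) + (w i j (r * s') (v * s) + (x j i (v * s) + w i j (- s') (- s))) + x i j s'"
    by (simp add: add.assoc)
  also have "x j i (v * s) + w i j (- s') (- s) = w i j (- s') (- s) + x i j (- ((- s')^2 * (v * s)))"
    by (rule x_ji_w[OF ij ms])
  also have "x j i (v * s) + (w i j (r * s') (v * s) + (w i j (- s') (- s) + x i j (- ((- s')^2 * (v * s))))) + x i j s'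
    = x j i (v * s) + (w i j (r * s') (v * s) + w i j (- s') (- s)) + x i j (- ((- s')^2 * (v * s)) + s')"
    by (simp only: x_add[OF ij] add.assoc)
  also have "x i j (- ((- s')^2 * (v * s)) + s') = x i j (y * v)" by (rule x_cong[OF ij 2])
  also have "w i j (r * s') (v * s) + w i j (- s') (- s)
     = h i j (r * s') (v * s) + h i j (- s) (- s') + (w i j 1 1 + w i j 1 1)"
    by (rule w_add[OF ij ms])
  finally show ?thesis by (simp add: mult.commute)
qed

lemma x_ij_x_ji_x_ji:
  assumes ij: "i \<in> I" "j \<in> I" "i \<noteq> j" and s: "inv_pair s s'" and r: "inv_pair r v"
    and rys: "[r = 1 + y * s] (mod q)"
    and t: "inv_pair t t'" and m: "inv_pair m n" and mys: "[m = 1 + y * v * t] (mod q)"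
  shows "x i j y + x j i (s + t) = x j i (s * v + v * v * (t * n))
     + (h i j (r * s') (v * s) + h i j (- s) (- s') + (h i j (m * t') (n * t) + h i j (- t) (- t')))
     + (w i j 1 1 + w i j 1 1 + (w i j 1 1 + w i j 1 1)) + x i j (y * v * n)"
proof -
  let ?W = "w i j 1 1 + w i j 1 1"
  note ms = inv_pair_uminus[OF s] and mt = inv_pair_uminus[OF t]
  note rs = inv_pair_mult[OF r inv_pair_commute[OF s]]
  note mt' = inv_pair_mult[OF m inv_pair_commute[OF t]]
  let ?T1 = "h i j (r * s') (v * s) + h i j (- s) (- s') + ?W"
  let ?T2 = "h i j (m * t') (n * t) + h i j (- t) (- t') + ?W"
  have T1: "?T1 + x j i z = x j i (v * v * z) + ?T1" for z
  proof -
    have "?T1 + x j i z = h i j (r * s') (v * s) + (h i j (- s) (- s') + x j i z) + ?W"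
      by (simp only: add.assoc w1_w1_x_ji[OF ij, unfolded add.assoc])
    also have "\<dots> = x j i (v * s * (v * s) * (- s' * - s' * z)) + ?T1"
      by (simp add: h_x_ji[OF ij ms] add.assoc[symmetric]) (simp add: h_x_ji[OF ij rs] add.assoc)
    also have "x j i (v * s * (v * s) * (- s' * - s' * z)) = x j i (v * v * s * s' * z)"
      by (rule x_inv_pair[OF s, where c = "v * v * s * s' * z"]) (use ij in \<open>simp_all add: algebra_simps\<close>)
    also have "\<dots> = x j i (v * v * z)"
      by (rule x_inv_pair[OF s, where c = "v * v * z"]) (use ij in \<open>simp_all add: algebra_simps\<close>)
    finally show ?thesis .
  qed
  have "x i j y + x j i (s + t) = x j i (s * v) + ?T1 + (x i j (y * v) + x j i t)"
    using ij by (simp add: x_add x_ij_x_ji_unit[OF ij s r rys] add.assoc[symmetric])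
  also have "x i j (y * v) + x j i t = x j i (t * n) + ?T2 + x i j (y * v * n)"
    by (rule x_ij_x_ji_unit[OF ij t m mys])
  also have "x j i (s * v) + ?T1 + (x j i (t * n) + ?T2 + x i j (y * v * n))
    = x j i (s * v) + (?T1 + x j i (t * n)) + ?T2 + x i j (y * v * n)"
    by (simp only: add.assoc)
  also have "\<dots> = x j i (s * v + v * v * (t * n)) + (?T1 + ?T2) + x i j (y * v * n)"
    unfolding T1 using ij by (simp add: x_add add.assoc)
  also have "?T1 + ?T2 = h i j (r * s') (v * s) + h i j (- s) (- s') + (?W + h i j (m * t') (n * t)) + h i j (- t) (- t') + ?W"
    by (simp only: add.assoc)
  also have "\<dots> = h i j (r * s') (v * s) + h i j (- s) (- s') + h i j (m * t') (n * t) + (?W + h i j (- t) (- t')) + ?W"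
    by (simp only: cj_w1_w1_h[OF ij mt']) (simp only: add.assoc)
  also have "\<dots> = h i j (r * s') (v * s) + h i j (- s) (- s') + (h i j (m * t') (n * t) + h i j (- t) (- t')) + (?W + ?W)"
    by (simp only: cj_w1_w1_h[OF ij mt]) (simp only: add.assoc)
  finally show ?thesis by (simp only: add.assoc)
qed

text \<open>Two evaluations of \<open>x\<^sub>i\<^sub>j(-2) x\<^sub>j\<^sub>i(2)\<close>: up to the common factor \<open>w(1)\<^sup>4\<close>, both sides of the
equation are the diagonal part of the result, for \<open>2 = 1 + 1\<close> and for \<open>2 = 3 + (-1)\<close>.\<close>
lemma h_relation:
  assumes ij: "i \<in> I" "j \<in> I" "i \<noteq> j" and three: "inv_pair 3 a" and five: "inv_pair 5 b"
  shows "h i j (- 1) (- 1) + h i j (- 1) (- 1) + (h i j 3 a + h i j (- 1) (- 1))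
    = h i j (- 5 * a) (- b * 3) + h i j (- 3) (- a) + h i j (- 3 * b) (- 5 * a)"
proof -
  note m1 = inv_pair_minus_one
  let ?Z = "w i j 1 1 + w i j 1 1 + (w i j 1 1 + w i j 1 1)"
  \<comment> \<open>intermediate upper entries \<open>-2, 2\<close>, diagonal entries \<open>-1, 3\<close>\<close>
  have A: "x i j (- 2) + x j i (1 + 1) = x j i (1 * -1 + -1 * -1 * (1 * a))
     + (h i j (- 1 * 1) (- 1 * 1) + h i j (- 1) (- 1) + (h i j (3 * 1) (a * 1) + h i j (- 1) (- 1)))
     + ?Z + x i j (- 2 * - 1 * a)"
    by (rule x_ij_x_ji_x_ji[OF ij inv_pair_one m1 _ inv_pair_one three]) simp_all
  \<comment> \<open>diagonal entries \<open>1 - 6 = -5\<close> and \<open>1 - 2/5 = 3/5\<close>\<close>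
  have B: "x i j (- 2) + x j i (3 + - 1) = x j i (3 * - b + - b * - b * (- 1 * (5 * a)))
     + (h i j (- 5 * a) (- b * 3) + h i j (- 3) (- a) + (h i j (3 * b * - 1) (5 * a * - 1) + h i j (- (- 1)) (- (- 1))))
     + ?Z + x i j (- 2 * - b * (5 * a))"
  proof (rule x_ij_x_ji_x_ji[OF ij three inv_pair_uminus[OF five] _ m1])
    show "inv_pair (3 * b) (5 * a)" 
      using inv_pair_mult[OF three inv_pair_commute[OF five]] by (simp add: mult.commute)
    show "[3 * b = 1 + - 2 * - b * - 1] (mod q)"
      by (rule cong_of_inv_pair[OF five, where c = 1]) simp
  qed simp
  have "x j i (1 * -1 + -1 * -1 * (1 * a)) = x j i (- 3 * b - a * b * (5 * b) + 2 * b * (3 * a - 1))"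
    by (rule x_inv_pair[OF five, where c = "1 - a + a * b"]) (use ij in \<open>simp_all add: algebra_simps\<close>)
  also have "\<dots> = x j i (3 * - b + - b * - b * (- 1 * (5 * a)))"
    by (rule x_inv_pair[OF three, where c = "2 * b"]) (use ij in \<open>simp_all add: algebra_simps\<close>)
  finally have 1: "x j i (1 * -1 + -1 * -1 * (1 * a)) = x j i (3 * - b + - b * - b * (- 1 * (5 * a)))" .
  have 2: "x i j (- 2 * - 1 * a) = x i j (- 2 * - b * (5 * a))"
    by (rule x_inv_pair[OF five ij, where c = "- 2 * a"]) (simp add: algebra_simps)
  have e: "x i j (- 2) + x j i (1 + 1) = x i j (- 2) + x j i (3 + - 1)" by simp
  show ?thesis using A[unfolded e B 1 2] by (simp add: mult.commute)
qed


text \<open>Modulo a power of 2, \<open>5 = -3\<^sup>l\<close> with \<open>l\<close> odd. The units \<open>-5/3\<close> and \<open>-3/5\<close> in \<open>h_relation\<close> are thus an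
even power \<open>A\<close> of 3 and its inverse. As symbols with \<open>A\<close> vanish, the relation reduces to
\<open>h(3) h(-1) = h(-3)\<close>.\<close>
lemma symb_three_minus_one:
  assumes ij: "i \<in> I" "j \<in> I" "i \<noteq> j" and q: "q = 2 ^ k" and three: "inv_pair 3 a"
    and w4: "w i j 1 1 + w i j 1 1 + (w i j 1 1 + w i j 1 1) = 0"
  shows "symb i j 3 a (- 1) (- 1) = 0"
proof -
  note m1 = inv_pair_minus_one
  let ?t = "symb i j 3 a (- 1) (- 1)"
  obtain b where five: "inv_pair 5 b"
    using inv_pair_exists[of 5] unfolding q by (auto simp: coprime_power_right_iff)
  have "symb i j (- 3) (- a) 3 a = symb i j (- 1 * 3) (- 1 * a) 3 a" by simp
  also have "\<dots> = symb i j (- 1) (- 1) 3 a + symb i j 3 a 3 a"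
    by (rule symb_mult_left[OF ij m1 three three])
  finally have "- symb i j (- 1) (- 1) 3 a = symb i j 3 a 3 a"
    using symb_self_minus[OF ij three] by (simp add: minus_unique)
  then have t3: "symb i j 3 a 3 a = ?t" using symb_skew[OF ij three m1] by simp
  have two: "?t + ?t = 0" using symb_self_two[OF ij three] t3 by simp
  obtain l where l: "odd l" "[5 = - (3 ^ l)] (mod q)"
    using five_cong_minus_pow3[of k] unfolding q by blast
  then obtain m where m: "l = Suc (2 * m)" by (elim oddE) simp
  let ?A = "3 ^ (2 * m)" and ?A' = "a ^ (2 * m)"
  note A = inv_pair_power[OF three, of "2 * m"]
  have "[- 5 * a = - (- (3 ^ l)) * a] (mod q)"
    using l(2) by (intro cong_mult cong_refl) (simp only: cong_minus_minus_iff)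
  also have "[- (- (3 ^ l)) * a = ?A] (mod q)"
    by (rule cong_of_inv_pair[OF three, where c = ?A]) (simp add: m algebra_simps)
  finally have A1: "[- 5 * a = ?A] (mod q)" .
  note p1 = inv_pair_mult[OF inv_pair_uminus[OF five] inv_pair_commute[OF three]]
  have A2: "[- 3 * b = ?A'] (mod q)"
    using inv_pair_unique[OF p1 A A1] by (simp add: mult.commute)
  note p2 = inv_pair_mult[OF inv_pair_uminus[OF three] inv_pair_commute[OF five]]
  note n3 = inv_pair_uminus[OF three]
  have z: "symb i j 3 a ?A ?A' = 0" "symb i j (-1) (-1) ?A ?A' = 0"
    using symb_power_right[OF ij three three, of "2 * m"] symb_power_right[OF ij three m1, of "2 * m"] two t3
      symb_mult_left[OF ij m1 m1 three] by (simp_all add: symb_one)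
  have n3A: "symb i j (- 3) (- a) ?A ?A' = 0"
    using symb_mult_left[OF ij m1 three A] z by simp
  have "h i j (- 1) (- 1) + h i j (- 1) (- 1) = 0"
    using h_minus_one_twice[OF ij] w4 by simp
  then have "h i j 3 a + h i j (- 1) (- 1)
    = h i j (- 5 * a) (- b * 3) + h i j (- 3) (- a) + h i j (- 3 * b) (- a * 5)"
    using h_relation[OF ij three five] by (simp add: mult.commute)
  also have "h i j (- 5 * a) (- b * 3) = h i j ?A ?A'"
    by (rule h_cong_unit[OF ij p1 A]) (use A1 in simp)
  also have "h i j (- 3 * b) (- a * 5) = h i j ?A' ?A"
    by (rule h_cong_unit[OF ij p2 inv_pair_commute[OF A]]) (use A2 in simp)
  also have "h i j ?A ?A' + h i j (- 3) (- a) + h i j ?A' ?A = h i j (- 3) (- a)"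
  proof -
    note A' = inv_pair_commute[OF A]
    have "h i j ?A ?A' + h i j (- 3) (- a) = h i j (- 3 * ?A) (- a * ?A')"
      using h_mult_of_symb_zero[OF n3A] by simp
    moreover have "symb i j ?A' ?A (- 3) (- a) = 0"
      using symb_flip[OF ij n3 A n3A] symb_skew[OF ij A' n3] by simp
    moreover have "symb i j ?A ?A' ?A ?A' = 0" using symb_powers[OF ij three, of "2 * m" "2 * m"] by simp
    then have "symb i j ?A' ?A ?A ?A' = 0"
      using symb_flip[OF ij A A] symb_skew[OF ij A' A] by simp
    ultimately have "symb i j ?A' ?A (- 3 * ?A) (- a * ?A') = 0"
      using symb_mult_right[OF ij n3 A A'] by simp
    then have "h i j (?A' * (- 3 * ?A)) (?A * (- a * ?A')) = h i j (- 3 * ?A) (- a * ?A') + h i j ?A' ?A"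
      by (rule h_mult_of_symb_zero)
    moreover have "h i j (?A' * (- 3 * ?A)) (?A * (- a * ?A')) = h i j (- 3) (- a)"
      by (rule h_cong_unit[OF ij inv_pair_mult[OF A' inv_pair_mult[OF n3 A]] n3
            cong_of_inv_pair[OF A, where c = "- 3"]]) (simp add: algebra_simps)
    ultimately show ?thesis
      using \<open>h i j ?A ?A' + h i j (- 3) (- a) = h i j (- 3 * ?A) (- a * ?A')\<close> by simp
  qed
  finally have "symb i j (- 1) (- 1) 3 a = 0"
    by (simp add: symb_def free_group_simps minus_add[symmetric] del: add_uminus_conv_diff minus_add)
  then show ?thesis using symb_skew[OF ij three m1] by simp
qed

text \<open>The units are \<open>\<plusminus>3\<^sup>i\<close>, and \<open>{3, 3} = {3, -1}\<close> by \<open>symb_self_minus\<close>. The hypothesis \<open>w4\<close> is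
\<open>{-1, -1} = 0\<close>.\<close>
lemma symb_zero_two_power:
  assumes ij: "i \<in> I" "j \<in> I" "i \<noteq> j" and q: "q = 2 ^ k"
    and w4: "w i j 1 1 + w i j 1 1 + (w i j 1 1 + w i j 1 1) = 0"
    and u: "inv_pair u u'" and v: "inv_pair v v'"
  shows "symb i j u u' v v' = 0"
proof (cases "k = 0")
  case True
  then have "[u = 1] (mod q)" using q by simp
  then show ?thesis
    using symb_cong[OF ij u v inv_pair_one v _ cong_refl] by (simp add: symb_one)
next
  case False
  note m1 = inv_pair_minus_one
  obtain a where three: "inv_pair 3 a"
    using inv_pair_exists[of 3] unfolding q by (auto simp: coprime_power_right_iff)
  have gen: "symb i j z z' y y' = 0"
    if z: "inv_pair z z'" and y: "inv_pair y y'" and z3: "symb i j z z' 3 a = 0" and z1: "symb i j z z' (- 1) (- 1) = 0"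
    for z z' y y'
  proof -
    have "odd y" using inv_pair_coprime[OF y] False unfolding q by (auto simp: coprime_power_right_iff)
    then obtain n s where s: "s = 1 \<or> s = -1" and n: "[y = s * 3 ^ n] (mod q)"
      using odd_cong_plus_minus_pow3 unfolding q by blast
    have ss: "inv_pair s s" using s m1 by auto
    have "symb i j z z' s s = 0" using s z1 symb_skew[OF ij z inv_pair_one] by (auto simp: symb_one)
    moreover have "symb i j z z' (3 ^ n) (a ^ n) = 0"
      using symb_power_right[OF ij three z, of n] z3 by simp
    moreover have "symb i j z z' y y' = symb i j z z' (s * 3 ^ n) (s * a ^ n)"
      by (rule symb_cong[OF ij z y z inv_pair_mult[OF ss inv_pair_power[OF three]] cong_refl n])
    ultimately show ?thesis using symb_mult_right[OF ij ss inv_pair_power[OF three] z] by simp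
  qed
  have "symb i j (- 1) (- 1) (- 1) (- 1) = 0"
    using h_minus_one_twice[OF ij] w4 by (simp add: symb_def minus_add[symmetric] free_group_simps del: add_uminus_conv_diff minus_add)
  moreover have t: "symb i j 3 a (- 1) (- 1) = 0" by (rule symb_three_minus_one[OF ij q three w4])
  moreover have t': "symb i j (- 1) (- 1) 3 a = 0" using t symb_skew[OF ij m1 three] by simp
  moreover have "symb i j (- 3) (- a) 3 a = symb i j (- 1) (- 1) 3 a + symb i j 3 a 3 a"
    using symb_mult_left[OF ij m1 three three] by simp
  then have "symb i j 3 a 3 a = 0" using t' symb_self_minus[OF ij three] by simp
  ultimately have "symb i j (- 1) (- 1) v v' = 0" "symb i j 3 a v v' = 0"
    using gen[OF m1 v] gen[OF three v] by simp_all
  then have "symb i j v v' (- 1) (- 1) = 0" "symb i j v v' 3 a = 0"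
    using symb_skew[OF ij v m1] symb_skew[OF ij v three] by simp_all
  then have "symb i j v v' u u' = 0" using gen[OF v u] by simp
  then show ?thesis using symb_skew[OF ij u v] by simp
qed

end

section \<open>Arbitrary moduli\<close>
definition cong_identity :: "int \<Rightarrow> int \<times> int \<times> int \<times> int \<Rightarrow> bool" where
  "cong_identity q m \<longleftrightarrow> (case m of (a, b, c, d) \<Rightarrow> [a = 1] (mod q) \<and> [b = 0] (mod q) \<and> [c = 0] (mod q) \<and> [d = 1] (mod q))"

lemma cong_identity_dvd: "cong_identity q m \<Longrightarrow> r dvd q \<Longrightarrow> cong_identity r m"
  unfolding cong_identity_def by (auto intro: cong_dvd_modulus split: prod.splits)

definition w_word :: "(bool \<times> int) list" where
  "w_word = [(True, 1), (False, - 1), (True, 1)]"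

lemma word_value_append: "word_value X Y (ws @ vs) = word_value X Y ws + word_value X Y vs"
  by (induction vs rule: rev_induct) (auto simp: append_assoc[symmetric] add.assoc simp del: append_assoc)

lemma word_matrix_w4: "word_matrix (w_word @ w_word @ w_word @ w_word) = (1, 0, 0, 1)"
  by (simp add: word_matrix_def w_word_def)

lemma word_value_w4:
  "word_value X Y (w_word @ w_word @ w_word @ w_word)
     = (X 1 + Y (- 1) + X 1) + (X 1 + Y (- 1) + X 1) + ((X 1 + Y (- 1) + X 1) + (X 1 + Y (- 1) + X 1))"
  unfolding word_value_append by (simp add: word_value_def w_word_def add.assoc)

context steinberg_mod begin

lemma word_value_zero_trivial:
  assumes "i \<in> I" "j \<in> I" "i \<noteq> j" "q = 1"
  shows "word_value (x i j) (x j i) ws = 0"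
proof -
  have "x i j s = 0" "x j i s = 0" for s
    using x_cong[of i j s 0] x_cong[of j i s 0] assms x_zero by simp_all
  then show ?thesis by (induction ws rule: rev_induct) auto
qed

lemma word_value_zero_prime_power:
  assumes ij: "i \<in> I" "j \<in> I" "i \<noteq> j" and p: "prime p" and q: "q = int (p ^ Suc k)"
    and w4: "p = 2 \<Longrightarrow> w i j 1 1 + w i j 1 1 + (w i j 1 1 + w i j 1 1) = 0"
    and M: "cong_identity q (word_matrix ws)"
  shows "word_value (x i j) (x j i) ws = 0"
proof -
  have C0: "symb i j u u' v v' = 0" if "inv_pair u u'" "inv_pair v v'" for u u' v v'
  proof (cases "p = 2")
    case True
    then show ?thesis using symb_zero_two_power[OF ij _ w4 that, of "Suc k"] q by simp
  next
    case False
    then have "odd p" using p prime_odd_nat[of p] prime_ge_2_nat[of p] by simp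
    then show ?thesis using symb_zero_odd_prime_power[OF ij p _ q that] by simp
  qed
  have unit_iff: "inv_unit a \<longleftrightarrow> \<not> int p dvd a" for a
  proof -
    have "inv_unit a \<longleftrightarrow> coprime a q"
      unfolding inv_unit_def using inv_pair_exists inv_pair_coprime by blast
    also have "\<dots> \<longleftrightarrow> coprime a (int p)" unfolding q by auto
    also have "\<dots> \<longleftrightarrow> \<not> int p dvd a"
      using p by (metis coprime_absorb_right coprime_commute not_prime_unit prime_imp_coprime prime_nat_int_transfer)
    finally show ?thesis .
  qed
  interpret steinberg_local I x q i j
  proof
    show "h i j (u * v) (u' * v') = h i j u u' + h i j v v'" if "inv_pair u u'" "inv_pair v v'" for u u' v v'
      using h_mult_of_symb_zero[OF C0[OF that(2,1)]] by (simp add: mult.commute)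
    show "inv_unit a \<or> inv_unit b" if "inv_unit (a + b)" for a b
      using that unfolding unit_iff by auto
    show "\<not> inv_unit 0" unfolding unit_iff by simp
  qed (use ij in auto)
  obtain a b c d where abcd: "word_matrix ws = (a, b, c, d)" by (metis prod_cases4)
  show ?thesis by (rule word_value_zero[OF abcd]) (use M in \<open>simp_all add: abcd cong_identity_def\<close>)
qed

text \<open>\<open>e1\<close> is an idempotent modulo \<open>q\<close> which is \<open>1\<close> modulo \<open>q1\<close> and \<open>0\<close> modulo \<open>q2\<close>. Restricting the
coefficients to its multiples gives a system over the integers modulo \<open>q1\<close>.\<close>
lemma idempotent_part:
  assumes q: "q = q1 * q2" and e: "e1 + e2 = 1" "q2 dvd e1" "q1 dvd e2"
  shows "steinberg_mod I (\<lambda>i j s. x i j (e1 * s)) q1"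
proof
  have "q dvd e1 * e2" using mult_dvd_mono[OF e(2,3)] q by (simp add: mult.commute)
  moreover have "e1 - e1 * e1 = e1 * e2" using e(1) by (metis mult.right_neutral add_diff_cancel_left' distrib_left)
  ultimately have idem: "q dvd e1 - e1 * e1" by simp
  show "x i j (e1 * (s + t)) = x i j (e1 * s) + x i j (e1 * t)" if "i \<in> I" "j \<in> I" "i \<noteq> j" for i j s t
    using x_add[OF that] by (simp add: distrib_left)
  show "x i j (e1 * s) + x j k (e1 * t) = x i k (e1 * (s * t)) + x j k (e1 * t) + x i j (e1 * s)"
    if "i \<in> I" "j \<in> I" "k \<in> I" "i \<noteq> j" "j \<noteq> k" "i \<noteq> k" for i j k s t
  proof -
    have "e1 * (s * t) - (e1 * s) * (e1 * t) = (e1 - e1 * e1) * (s * t)" by (simp add: algebra_simps)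
    then have "[e1 * (s * t) = (e1 * s) * (e1 * t)] (mod q)"
      using idem unfolding cong_iff_dvd_diff by simp
    then have "x i k (e1 * (s * t)) = x i k ((e1 * s) * (e1 * t))" by (intro x_cong that)
    then show ?thesis using x_chain[OF that] by simp
  qed
  show "x i j (e1 * s) + x k l (e1 * t) = x k l (e1 * t) + x i j (e1 * s)"
    if "i \<in> I" "j \<in> I" "k \<in> I" "l \<in> I" "i \<noteq> j" "k \<noteq> l" "j \<noteq> k" "i \<noteq> l" for i j k l s t
    by (rule x_comm[OF that])
  show "x i j (e1 * q1) = 0" if "i \<in> I" "j \<in> I" "i \<noteq> j" for i j
  proof -
    have "[e1 * q1 = 0] (mod q)" using mult_dvd_mono[OF e(2) dvd_refl, of q1] q
      by (simp add: cong_0_iff mult.commute)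
    then show ?thesis using x_cong[OF that] x_zero[OF that] by simp
  qed
  show "\<exists>k\<in>I. k \<noteq> i \<and> k \<noteq> j" if "i \<in> I" "j \<in> I" for i j by (rule third_index[OF that])
qed

text \<open>Elements \<open>x\<^sub>i\<^sub>j(s)\<close> and \<open>x\<^sub>j\<^sub>i(t)\<close> with coefficients from the two complementary ideals commute: since \<open>e2\<close> is
idempotent, \<open>x\<^sub>j\<^sub>i(e2 t) = [x\<^sub>j\<^sub>k(e2 t), x\<^sub>k\<^sub>i(e2)]\<close>, and \<open>x\<^sub>i\<^sub>j(e1 s)\<close> commutes with both factors.\<close>
lemma annihilating_commute:
  assumes ij: "i \<in> I" "j \<in> I" "i \<noteq> j" and e: "e1 + e2 = 1" "q dvd e1 * e2"
  shows "cj (x i j (e1 * s)) (x i j (e2 * t)) = x i j (e2 * t)"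
    and "cj (x i j (e1 * s)) (x j i (e2 * t)) = x j i (e2 * t)"
proof -
  show "cj (x i j (e1 * s)) (x i j (e2 * t)) = x i j (e2 * t)"
    using ij by (simp add: cj_x)
  obtain k where k: "k \<in> I" "k \<noteq> i" "k \<noteq> j" using third_index ij by blast
  note [simp] = ij k k(2,3)[symmetric] ij(3)[symmetric]
  have zero: "x a b (e1 * e2 * r) = 0" if "a \<in> I" "b \<in> I" "a \<noteq> b" for a b r
    using x_cong[OF that, of "e1 * e2 * r" 0] x_zero[OF that] e(2) by (simp add: cong_0_iff)
  have "e2 * t - (e2 * t) * e2 = e1 * e2 * t"
    using e(1) by (metis (no_types, opaque_lifting) add_diff_cancel_right' distrib_right mult.assoc mult.commute mult_1)
  then have "[e2 * t = (e2 * t) * e2] (mod q)" using e(2) by (simp add: cong_iff_dvd_diff)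
  then have eq: "x j i (e2 * t) = cj (x j k (e2 * t)) (x k i e2) - x k i e2"
    using x_cong[of j i "e2 * t" "(e2 * t) * e2"] by (simp add: cj_x)
  have "cj (x i j (e1 * s)) (x j k (e2 * t)) = x i k (e1 * e2 * (s * t)) + x j k (e2 * t)"
    by (simp add: cj_x mult_ac)
  then have 1: "cj (x i j (e1 * s)) (x j k (e2 * t)) = x j k (e2 * t)" by (simp only: zero) (simp add: zero)
  have "cj (x i j (e1 * s)) (x k i e2) = x k j (e1 * e2 * (- s)) + x k i e2"
    by (simp add: cj_x mult_ac)
  then have 2: "cj (x i j (e1 * s)) (x k i e2) = x k i e2" using zero[of k j "- s"] by simp
  show "cj (x i j (e1 * s)) (x j i (e2 * t)) = x j i (e2 * t)"
    unfolding eq cj_diff cj_distrib[of "x i j (e1 * s)"] 1 2 ..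
qed

lemma word_value_split:
  assumes ij: "i \<in> I" "j \<in> I" "i \<noteq> j" and e: "e1 + e2 = 1" "q dvd e1 * e2"
  shows "word_value (x i j) (x j i) ws
    = word_value (\<lambda>s. x i j (e1 * s)) (\<lambda>s. x j i (e1 * s)) ws + word_value (\<lambda>s. x i j (e2 * s)) (\<lambda>s. x j i (e2 * s)) ws"
proof -
  let ?V = "word_value (\<lambda>s. x i j (e2 * s)) (\<lambda>s. x j i (e2 * s))"
  have ji: "j \<in> I" "i \<in> I" "j \<noteq> i" using ij by auto
  note com = annihilating_commute[OF ij e] annihilating_commute[OF ji e]
  have V: "cj (x i j (e1 * s)) (?V vs) = ?V vs" "cj (x j i (e1 * s)) (?V vs) = ?V vs" for s vs
    by (induction vs rule: rev_induct) (auto simp: cj_add com)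
  have sum: "x i j s = x i j (e1 * s) + x i j (e2 * s)" "x j i s = x j i (e1 * s) + x j i (e2 * s)" for s
    using x_add[OF ij, of "e1 * s" "e2 * s"] x_add[OF ji, of "e1 * s" "e2 * s"] e(1)
    by (simp_all add: distrib_right[symmetric])
  show ?thesis
  proof (induction ws rule: rev_induct)
    case Nil
    then show ?case by simp
  next
    case (snoc v ws)
    obtain p s where v: "v = (p, s)" by fastforce
    have "?V ws + x i j (e1 * s) = x i j (e1 * s) + ?V ws" "?V ws + x j i (e1 * s) = x j i (e1 * s) + ?V ws"
      using V[of s ws] by (simp_all add: cj_eq_iff)
    then have "?V ws + (x i j (e1 * s) + z) = x i j (e1 * s) + (?V ws + z)"
      "?V ws + (x j i (e1 * s) + z) = x j i (e1 * s) + (?V ws + z)" for z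
      by (simp_all add: add.assoc[symmetric])
    then show ?case using snoc sum[of s] by (simp add: v add.assoc)
  qed
qed

end

lemma coprime_idempotents:
  fixes q1 q2 :: int
  assumes "coprime q1 q2"
  obtains e1 e2 where "e1 + e2 = 1" "q2 dvd e1" "q1 dvd e2"
proof -
  obtain a b where "a * q1 + b * q2 = 1" using assms bezout_int[of q1 q2] by auto
  then show ?thesis using that[of "b * q2" "a * q1"] by (simp add: add.commute)
qed

text \<open>Split off one prime power at a time. The induction runs over all systems, as the two parts are again
systems in the same group.\<close>
lemma word_value_zero_odd:
  fixes x :: "'i \<Rightarrow> 'i \<Rightarrow> int \<Rightarrow> 'g::group_add"
  assumes "odd n" "steinberg_mod I x (int n)" and ij: "i \<in> I" "j \<in> I" "i \<noteq> j"
    and "cong_identity (int n) (word_matrix ws)"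
  shows "word_value (x i j) (x j i) ws = 0"
  using assms(1,2,6)
proof (induction n arbitrary: x rule: less_induct)
  case (less n)
  interpret steinberg_mod I x "int n" by (rule less.prems(2))
  show ?case
  proof (cases "n = 1")
    case True
    then show ?thesis using word_value_zero_trivial[OF ij] by simp
  next
    case False
    then obtain p where p: "prime p" "p dvd n" by (meson prime_factor_nat)
    have n0: "n \<noteq> 0" using less.prems(1) by (cases n) auto
    have op: "odd p" using p less.prems(1) by (meson dvd_trans)
    obtain r where r: "n = p ^ multiplicity p n * r" "\<not> p dvd r"
      using multiplicity_decompose'[of n p] n0 p by (metis not_prime_unit)
    have "multiplicity p n > 0" using p n0 by (simp add: prime_multiplicity_gt_zero_iff)
    then obtain k where k: "multiplicity p n = Suc k" by (metis gr0_implies_Suc)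
    have n: "n = p ^ Suc k * r" using r k by simp
    have orr: "odd r" using less.prems(1) n by simp
    then have r0: "r > 0" by (cases r) auto
    have "p ^ Suc k > 1" using prime_gt_1_nat[OF p(1)] by (intro one_less_power) auto
    then have rn: "r < n" using n r0 by simp
    have cop: "coprime (int (p ^ Suc k)) (int r)"
      using prime_imp_coprime[OF p(1) r(2)] by (simp only: coprime_int_iff) simp
    obtain e1 e2 where e: "e1 + e2 = 1" "int r dvd e1" "int (p ^ Suc k) dvd e2"
      using coprime_idempotents[OF cop] .
    have q: "int n = int (p ^ Suc k) * int r" using n by (metis of_nat_mult)
    have ee: "int n dvd e1 * e2" using mult_dvd_mono[OF e(2,3)] q by (simp only: mult.commute)
    interpret A: steinberg_mod I "\<lambda>i j s. x i j (e1 * s)" "int (p ^ Suc k)"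
      by (rule idempotent_part[OF q e])
    have B: "steinberg_mod I (\<lambda>i j s. x i j (e2 * s)) (int r)"
      by (rule idempotent_part[of "int r" "int (p ^ Suc k)" e2 e1]) (use q e in \<open>simp_all only: mult.commute add.commute\<close>)
    have "p \<noteq> 2" using op by auto
    moreover have "cong_identity (int r) (word_matrix ws)" "cong_identity (int (p ^ Suc k)) (word_matrix ws)"
      using cong_identity_dvd[OF less.prems(3)] q by (metis dvd_triv_right, metis dvd_triv_left)
    ultimately have "word_value (\<lambda>s. x i j (e2 * s)) (\<lambda>s. x j i (e2 * s)) ws = 0"
      "word_value (\<lambda>s. x i j (e1 * s)) (\<lambda>s. x j i (e1 * s)) ws = 0"
      using less.IH[OF rn orr B] A.word_value_zero_prime_power[OF ij p(1) refl, of ws] by auto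
    then show ?thesis using word_value_split[OF ij e(1) ee, of ws] by simp
  qed
qed

text \<open>The hypothesis \<open>w4\<close> concerns one word whose integral matrix is the identity. It is what
\<open>symb_zero_two_power\<close> asks of the 2-primary part, where it holds because the odd part of the word
vanishes by the previous lemma.\<close>
theorem word_value_zero_mod:
  fixes x :: "'i \<Rightarrow> 'i \<Rightarrow> int \<Rightarrow> 'g::group_add"
  assumes "n > 0" "steinberg_mod I x (int n)" and ij: "i \<in> I" "j \<in> I" "i \<noteq> j"
    and w4: "word_value (x i j) (x j i) (w_word @ w_word @ w_word @ w_word) = 0"
    and ws: "cong_identity (int n) (word_matrix ws)"
  shows "word_value (x i j) (x j i) ws = 0"
proof -
  interpret steinberg_mod I x "int n" by (rule assms(2))
  obtain r where r: "n = 2 ^ multiplicity 2 n * r" "\<not> 2 dvd r"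
    using multiplicity_decompose'[of n 2] assms(1) by auto
  define k where "k = multiplicity 2 n"
  have n: "n = 2 ^ k * r" using r k_def by simp
  have cop: "coprime (int (2 ^ k)) (int r)" using r(2) by (simp add: coprime_left_2_iff_odd)
  obtain e1 e2 where e: "e1 + e2 = 1" "int r dvd e1" "int (2 ^ k) dvd e2"
    using coprime_idempotents[OF cop] .
  have q: "int n = int (2 ^ k) * int r" using n by (metis of_nat_mult)
  have ee: "int n dvd e1 * e2" using mult_dvd_mono[OF e(2,3)] q by (simp only: mult.commute)
  interpret A: steinberg_mod I "\<lambda>i j s. x i j (e1 * s)" "int (2 ^ k)"
    by (rule idempotent_part[OF q e])
  have B: "steinberg_mod I (\<lambda>i j s. x i j (e2 * s)) (int r)"
    by (rule idempotent_part[of "int r" "int (2 ^ k)" e2 e1]) (use q e in \<open>simp_all only: mult.commute add.commute\<close>)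
  have odd_part: "word_value (\<lambda>s. x i j (e2 * s)) (\<lambda>s. x j i (e2 * s)) vs = 0"
    if "cong_identity (int r) (word_matrix vs)" for vs
    by (rule word_value_zero_odd[OF _ B ij that]) (use r(2) in simp)
  have split: "word_value (x i j) (x j i) vs = word_value (\<lambda>s. x i j (e1 * s)) (\<lambda>s. x j i (e1 * s)) vs"
    if "cong_identity (int r) (word_matrix vs)" for vs
    using word_value_split[OF ij e(1) ee, of vs] odd_part[OF that] by simp
  have "word_value (\<lambda>s. x i j (e1 * s)) (\<lambda>s. x j i (e1 * s)) ws = 0"
  proof (cases k)
    case 0
    then show ?thesis using A.word_value_zero_trivial[OF ij] by simp
  next
    case (Suc l)
    have "word_value (\<lambda>s. x i j (e1 * s)) (\<lambda>s. x j i (e1 * s)) (w_word @ w_word @ w_word @ w_word) = 0"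
      using split[of "w_word @ w_word @ w_word @ w_word"] w4 by (simp only: word_matrix_w4) (simp add: cong_identity_def)
    then have "A.w i j 1 1 + A.w i j 1 1 + (A.w i j 1 1 + A.w i j 1 1) = 0"
      unfolding word_value_w4 A.w_def .
    moreover have "cong_identity (int (2 ^ k)) (word_matrix ws)" using cong_identity_dvd[OF ws] q by simp
    ultimately show ?thesis
      using A.word_value_zero_prime_power[OF ij two_is_prime_nat, of l ws] Suc by simp
  qed
  moreover have "cong_identity (int r) (word_matrix ws)" using cong_identity_dvd[OF ws] q by simp
  ultimately show ?thesis using split by simp
qed

section \<open>The Euclidean algorithm for 2-by-2 matrices\<close>
definition word_reachable :: "int \<times> int \<times> int \<times> int \<Rightarrow> bool" where
  "word_reachable m \<longleftrightarrow> (\<exists>ws. word_matrix ws = m)"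

lemma word_reachable_step: "word_reachable m \<Longrightarrow> word_reachable (elem_step m v)"
  unfolding word_reachable_def by (metis word_matrix_simps(2))

lemma elem_step_cancel: "elem_step (elem_step m (p, s)) (p, - s) = m"
  by (cases m; cases p) (simp_all add: algebra_simps)

lemma word_reachable_step_iff: "word_reachable (elem_step m (p, s)) \<longleftrightarrow> word_reachable m"
  by (metis word_reachable_step elem_step_cancel)

lemma word_reachable_one: "word_reachable (1, 0, 0, 1)"
  unfolding word_reachable_def by (metis word_matrix_simps(1))

lemma word_reachable_minus_one: "word_reachable (- 1, 0, 0, - 1)"
  unfolding word_reachable_def
  by (rule exI[of _ "w_word @ w_word"]) (simp add: word_matrix_def w_word_def)

lemma det_one_word_reachable:
  "a * d - b * c = 1 \<Longrightarrow> word_reachable (a, b, c, d)"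
proof (induction "nat \<bar>a\<bar> + nat \<bar>b\<bar>" arbitrary: a b c d rule: less_induct)
  case less
  have b0: "word_reachable (a, 0, c, d)" if "a * d - 0 * c = 1" for a c d
  proof -
    have "(a = 1 \<and> d = 1) \<or> (a = - 1 \<and> d = - 1)" using that by (simp add: zmult_eq_1_iff)
    then show ?thesis
      using word_reachable_step[OF word_reachable_one, of "(False, c)"]
        word_reachable_step[OF word_reachable_minus_one, of "(False, - c)"] by auto
  qed
  consider "b = 0" | "a = 0" "b \<noteq> 0" | "a \<noteq> 0" "b \<noteq> 0" "\<bar>b\<bar> \<le> \<bar>a\<bar>" | "a \<noteq> 0" "b \<noteq> 0" "\<bar>a\<bar> < \<bar>b\<bar>"
    by linarith
  then show ?case
  proof cases
    case 1
    then show ?thesis using b0 less.prems by simp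
  next
    case 2
    then have "b * (- c) = 1" using less.prems by simp
    then have bb: "b * b = 1" unfolding zmult_eq_1_iff by auto
    \<comment> \<open>here \<open>b = \<plusminus>1\<close>; a detour by a larger matrix, with upper row \<open>(1, b)\<close> and then \<open>(1, 0)\<close>\<close>
    let ?m = "elem_step (elem_step (a, b, c, d) (False, b)) (True, - b)"
    have m: "?m = (1, 0, c + b * d, d - b * (c + b * d))" using 2 bb by (simp add: algebra_simps)
    have "1 * (d - b * (c + b * d)) - 0 * (c + b * d) = a * d - b * c + d * (1 - b * b)"
      using 2 by (simp add: algebra_simps)
    then have "word_reachable ?m" unfolding m using b0 less.prems bb by simp
    then show ?thesis by (simp only: word_reachable_step_iff)
  next
    case 3
    define s where "s = - sgn a * sgn b"
    have "\<bar>a + s * b\<bar> < \<bar>a\<bar>" using 3 unfolding s_def by (auto simp: sgn_if split: if_splits)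
    then have "word_reachable (elem_step (a, b, c, d) (False, s))"
      using less.prems by (simp, intro less.hyps) (simp_all add: algebra_simps)
    then show ?thesis by (simp only: word_reachable_step_iff)
  next
    case 4
    define s where "s = - sgn a * sgn b"
    have "\<bar>b + s * a\<bar> < \<bar>b\<bar>" using 4 unfolding s_def by (auto simp: sgn_if split: if_splits)
    then have "word_reachable (elem_step (a, b, c, d) (True, s))"
      using less.prems by (simp, intro less.hyps) (simp_all add: algebra_simps)
    then show ?thesis by (simp only: word_reachable_step_iff)
  qed
qed

section \<open>Groups as permutation groups, and quotients\<close>

text \<open>Carrier-based groups enter the class \<open>group_add\<close> through their action on themselves by left
multiplication. The bijections of a type, under composition, are the target.\<close>
typedef 'a bijection = "{f :: 'a \<Rightarrow> 'a. bij f}"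
  morphisms apply_bijection Bijection
  by (rule exI[of _ id]) simp

setup_lifting type_definition_bijection

instantiation bijection :: (type) group_add
begin

lift_definition zero_bijection :: "'a bijection" is id by simp
lift_definition plus_bijection :: "'a bijection \<Rightarrow> 'a bijection \<Rightarrow> 'a bijection" is "(\<circ>)" by (rule bij_comp)
lift_definition uminus_bijection :: "'a bijection \<Rightarrow> 'a bijection" is "inv_into UNIV" by (rule bij_imp_bij_inv)
definition minus_bijection :: "'a bijection \<Rightarrow> 'a bijection \<Rightarrow> 'a bijection" where
  "minus_bijection f g = f + - g"

instance
proof
  fix f g h :: "'a bijection"
  show "f + g + h = f + (g + h)" by transfer (simp add: comp_assoc)
  show "0 + f = f" "f + 0 = f" by (transfer, simp)+
  show "- f + f = 0" by transfer (simp add: bij_is_inj)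
  show "f + - g = f - g" by (simp add: minus_bijection_def)
qed

end

definition cayley :: "('a, 'b) monoid_scheme \<Rightarrow> 'a \<Rightarrow> 'a bijection" where
  "cayley G g = Bijection (\<lambda>m. if m \<in> carrier G then g \<otimes>\<^bsub>G\<^esub> m else m)"

context group begin

lemma cayley_bij:
  assumes g: "g \<in> carrier G"
  shows "bij (\<lambda>m. if m \<in> carrier G then g \<otimes> m else m)"
proof (rule o_bij[where g = "\<lambda>m. if m \<in> carrier G then inv g \<otimes> m else m"])
  show "(\<lambda>m. if m \<in> carrier G then inv g \<otimes> m else m) \<circ> (\<lambda>m. if m \<in> carrier G then g \<otimes> m else m) = id"
    "(\<lambda>m. if m \<in> carrier G then g \<otimes> m else m) \<circ> (\<lambda>m. if m \<in> carrier G then inv g \<otimes> m else m) = id"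
    using g by (auto simp: fun_eq_iff m_assoc[symmetric])
qed

lemma apply_cayley: "g \<in> carrier G \<Longrightarrow> apply_bijection (cayley G g) = (\<lambda>m. if m \<in> carrier G then g \<otimes> m else m)"
  unfolding cayley_def using cayley_bij by (intro Bijection_inverse) simp

lemma cayley_mult: "g \<in> carrier G \<Longrightarrow> h \<in> carrier G \<Longrightarrow> cayley G (g \<otimes> h) = cayley G g + cayley G h"
  by (rule apply_bijection_inject[THEN iffD1])
    (auto simp: apply_cayley plus_bijection.rep_eq fun_eq_iff m_assoc)

lemma cayley_one: "cayley G \<one> = 0"
  using cayley_mult[of \<one> \<one>] by (metis add_left_imp_eq add.right_neutral l_one one_closed)

lemma cayley_inv: "g \<in> carrier G \<Longrightarrow> cayley G (inv g) = - cayley G g"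
  using cayley_mult[of g "inv g"] cayley_one by (metis inv_closed minus_unique r_inv)

lemma cayley_inj:
  assumes g: "g \<in> carrier G" "h \<in> carrier G" and eq: "cayley G g = cayley G h"
  shows "g = h"
proof -
  have "apply_bijection (cayley G g) \<one> = apply_bijection (cayley G h) \<one>" by (simp add: eq)
  then show ?thesis using g by (simp add: apply_cayley)
qed

lemma normaliser_subgroup:
  assumes H: "H \<subseteq> carrier G"
  shows "subgroup {g \<in> carrier G. (\<forall>h\<in>H. g \<otimes> h \<otimes> inv g \<in> H) \<and> (\<forall>h\<in>H. inv g \<otimes> h \<otimes> g \<in> H)} G"
    (is "subgroup ?N G")
proof (rule subgroupI)
  show "?N \<noteq> {}" using H by (auto intro!: exI[of _ \<one>])
next
  fix g g' assume g: "g \<in> ?N" "g' \<in> ?N"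
  have "(g \<otimes> g') \<otimes> h \<otimes> inv (g \<otimes> g') = g \<otimes> (g' \<otimes> h \<otimes> inv g') \<otimes> inv g"
    "inv (g \<otimes> g') \<otimes> h \<otimes> (g \<otimes> g') = inv g' \<otimes> (inv g \<otimes> h \<otimes> g) \<otimes> g'" if "h \<in> H" for h
    using g that H by (auto simp: inv_mult_group m_assoc subset_iff)
  then show "g \<otimes> g' \<in> ?N" using g by simp
qed auto

end

text \<open>The quotient of \<open>N\<close> by its normal subgroup \<open>H\<close>, again made additive by the action on itself.\<close>
lemma quotient_embedding:
  fixes G (structure)
  assumes G: "group G" and H: "subgroup H G" and N: "subgroup N G" and HN: "H \<subseteq> N"
    and norm: "\<And>g h. g \<in> N \<Longrightarrow> h \<in> H \<Longrightarrow> g \<otimes> h \<otimes> inv g \<in> H"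
  obtains \<phi> :: "'a \<Rightarrow> 'a set bijection"
    where "\<And>g h. g \<in> N \<Longrightarrow> h \<in> N \<Longrightarrow> \<phi> (g \<otimes> h) = \<phi> g + \<phi> h"
      and "\<And>g. g \<in> N \<Longrightarrow> \<phi> g = 0 \<longleftrightarrow> g \<in> H"
proof -
  let ?K = "G\<lparr>carrier := N\<rparr>"
  have K: "group ?K" by (rule group.subgroup_imp_group[OF G N])
  have HK: "subgroup H ?K" using group.subgroup_incl[OF G H N HN] .
  have "H \<lhd> ?K"
  proof (rule group.normal_invI[OF K HK])
    fix g h assume gh: "g \<in> carrier ?K" "h \<in> H"
    have "inv\<^bsub>?K\<^esub> g = inv g" using group.m_inv_consistent[OF G N] gh by simp
    then show "g \<otimes>\<^bsub>?K\<^esub> h \<otimes>\<^bsub>?K\<^esub> inv\<^bsub>?K\<^esub> g \<in> H" using norm gh by simp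
  qed
  then interpret K: normal H ?K .
  let ?Q = "?K Mod H"
  have Q: "group ?Q" by (rule K.factorgroup_is_group)
  have co: "H #>\<^bsub>?K\<^esub> g \<in> carrier ?Q" if "g \<in> N" for g
    using K.rcosetsI[OF K.subset, of g] that by (simp add: FactGroup_def)
  have m: "(H #>\<^bsub>?K\<^esub> g) \<otimes>\<^bsub>?Q\<^esub> (H #>\<^bsub>?K\<^esub> h) = H #>\<^bsub>?K\<^esub> (g \<otimes> h)" if "g \<in> N" "h \<in> N" for g h
    using K.rcos_sum[of g h] that by (simp add: FactGroup_def)
  show ?thesis
  proof (rule that[of "\<lambda>g. cayley ?Q (H #>\<^bsub>?K\<^esub> g)"])
    fix g h assume gh: "g \<in> N" "h \<in> N"
    show "cayley ?Q (H #>\<^bsub>?K\<^esub> (g \<otimes> h)) = cayley ?Q (H #>\<^bsub>?K\<^esub> g) + cayley ?Q (H #>\<^bsub>?K\<^esub> h)"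
      using group.cayley_mult[OF Q co[OF gh(1)] co[OF gh(2)]] m[OF gh] by simp
  next
    fix g assume g: "g \<in> N"
    have "cayley ?Q (H #>\<^bsub>?K\<^esub> g) = 0 \<longleftrightarrow> H #>\<^bsub>?K\<^esub> g = \<one>\<^bsub>?Q\<^esub>"
      using group.cayley_inj[OF Q co[OF g] monoid.one_closed[OF group.is_monoid[OF Q]]] group.cayley_one[OF Q]
      by metis
    also have "\<dots> \<longleftrightarrow> H #>\<^bsub>?K\<^esub> g = H" by (simp add: FactGroup_def)
    also have "\<dots> \<longleftrightarrow> g \<in> H"
      using g K.coset_join1[OF _ _ HK, of g] K.coset_join2[OF _ HK, of g] by auto
    finally show "cayley ?Q (H #>\<^bsub>?K\<^esub> g) = 0 \<longleftrightarrow> g \<in> H" .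
  qed
qed

section \<open>Reduction of congruence subgroups to 2-by-2 blocks\<close>

text \<open>Rows and columns are counted from \<open>0\<close> from here on, and \<open>addrow_mat n t i j\<close> is the elementary matrix
\<open>x\<^sub>i\<^sub>j(t)\<close>.\<close>
lemma elem_left_index:
  assumes "X \<in> carrier_mat n n" "i < n" "j < n" "r < n" "s < n"
  shows "(addrow_mat n t i j * X) $$ (r, s) = (if r = i then t * X $$ (j, s) + X $$ (i, s) else X $$ (r, s))"
  using assms by (simp add: addrow_mat[symmetric, of X n n])

lemma elem_right_index:
  fixes X :: "'a::comm_semiring_1 mat"
  assumes "X \<in> carrier_mat n n" "i < n" "j < n" "r < n" "s < n"
  shows "(X * addrow_mat n t i j) $$ (r, s) = (if s = j then t * X $$ (r, i) + X $$ (r, j) else X $$ (r, s))"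
  using assms by (simp add: addcol_mat[symmetric, of X n n])

lemma SL_ops [simp]: "mult (SL n) = (*)" "one (SL n) = 1\<^sub>m n"
  by (simp_all add: SL_def)

lemma SL_carrier [simp]: "carrier (SL n) = {X \<in> carrier_mat n n. det X = 1}"
  by (simp add: SL_def)

lemma addrow_mat_SL: "i \<noteq> j \<Longrightarrow> addrow_mat n t i j \<in> carrier (SL n)"
  by (simp add: det_addrow_mat)

lemma Gamma_iff:
  "X \<in> Gamma d n \<longleftrightarrow> X \<in> carrier (SL n) \<and> (\<exists>Y \<in> carrier_mat n n. X = 1\<^sub>m n + int d \<cdot>\<^sub>m Y)"
proof
  assume X: "X \<in> Gamma d n"
  then have Xc: "X \<in> carrier_mat n n" and cong: "\<And>r s. r < n \<Longrightarrow> s < n \<Longrightarrow> [X $$ (r, s) = 1\<^sub>m n $$ (r, s)] (mod int d)"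
    by (auto simp: Gamma_def)
  let ?Y = "mat n n (\<lambda>(r, s). (X $$ (r, s) - 1\<^sub>m n $$ (r, s)) div int d)"
  have "X = 1\<^sub>m n + int d \<cdot>\<^sub>m ?Y"
  proof (rule eq_matI)
    fix r s assume rs: "r < dim_row (1\<^sub>m n + int d \<cdot>\<^sub>m ?Y)" "s < dim_col (1\<^sub>m n + int d \<cdot>\<^sub>m ?Y)"
    then have "int d dvd X $$ (r, s) - 1\<^sub>m n $$ (r, s)"
      using cong[of r s] by (simp add: cong_iff_dvd_diff)
    then show "X $$ (r, s) = (1\<^sub>m n + int d \<cdot>\<^sub>m ?Y) $$ (r, s)" using rs by simp
  qed (use Xc in auto)
  then show "X \<in> carrier (SL n) \<and> (\<exists>Y \<in> carrier_mat n n. X = 1\<^sub>m n + int d \<cdot>\<^sub>m Y)"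
    using X by (auto simp: Gamma_def intro!: bexI[of _ ?Y])
next
  assume "X \<in> carrier (SL n) \<and> (\<exists>Y \<in> carrier_mat n n. X = 1\<^sub>m n + int d \<cdot>\<^sub>m Y)"
  then show "X \<in> Gamma d n" by (auto simp: Gamma_def cong_iff_dvd_diff)
qed

lemma Gamma_subset: "X \<in> Gamma d n \<Longrightarrow> X \<in> carrier (SL n)"
  by (simp add: Gamma_iff)

lemma Gamma_entry_cong:
  "\<lbrakk>X \<in> Gamma d n; r < n; s < n\<rbrakk> \<Longrightarrow> [X $$ (r, s) = (if r = s then 1 else 0)] (mod int d)"
  unfolding Gamma_def using index_one_mat(1)[of r n s] by fastforce

lemma Gamma_conj:
  assumes X: "X \<in> Gamma d n" and A: "A \<in> carrier (SL n)"
  shows "A \<otimes>\<^bsub>SL n\<^esub> X \<otimes>\<^bsub>SL n\<^esub> inv\<^bsub>SL n\<^esub> A \<in> Gamma d n"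
proof -
  interpret group "SL n" by (rule group_SL)
  let ?B = "inv\<^bsub>SL n\<^esub> A"
  have B: "?B \<in> carrier (SL n)" using A inv_closed by blast
  obtain Y where Y: "Y \<in> carrier_mat n n" "X = 1\<^sub>m n + int d \<cdot>\<^sub>m Y" using X Gamma_iff by blast
  have c: "A \<in> carrier_mat n n" "?B \<in> carrier_mat n n" "A * ?B = 1\<^sub>m n"
    using A B r_inv[OF A] by simp_all
  have "A * X * ?B = (A + int d \<cdot>\<^sub>m (A * Y)) * ?B"
    unfolding Y(2) using c Y(1) by (simp add: mult_add_distrib_mat[of A n n _ n] mult_smult_distrib[of A n n _ n])
  also have "\<dots> = 1\<^sub>m n + int d \<cdot>\<^sub>m (A * Y * ?B)"
    using c Y(1) by (simp add: add_mult_distrib_mat[of A n n] mult_smult_assoc_mat[of "A * Y" n n])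
  finally have "A * X * ?B = 1\<^sub>m n + int d \<cdot>\<^sub>m (A * Y * ?B)" .
  moreover have "A * Y * ?B \<in> carrier_mat n n" using c Y by simp
  moreover have "A \<otimes>\<^bsub>SL n\<^esub> X \<otimes>\<^bsub>SL n\<^esub> ?B \<in> carrier (SL n)"
    using A B Gamma_subset[OF X] m_closed by blast
  ultimately show ?thesis unfolding Gamma_iff by auto
qed

lemma Gamma_subgroup: "subgroup (Gamma d n) (SL n)"
proof -
  interpret group "SL n" by (rule group_SL)
  show ?thesis
  proof (rule subgroupI)
    show "Gamma d n \<subseteq> carrier (SL n)" using Gamma_subset by blast
    have "\<one>\<^bsub>SL n\<^esub> \<in> Gamma d n" by (auto simp: Gamma_def)
    then show "Gamma d n \<noteq> {}" by blast
  next
    fix X assume X: "X \<in> Gamma d n"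
    obtain Y where Y: "Y \<in> carrier_mat n n" "X = 1\<^sub>m n + int d \<cdot>\<^sub>m Y" using X Gamma_iff by blast
    let ?B = "inv\<^bsub>SL n\<^esub> X"
    have B: "?B \<in> carrier (SL n)" using Gamma_subset[OF X] inv_closed by blast
    then have Bc: "?B \<in> carrier_mat n n" by simp
    have "1\<^sub>m n = X * ?B" using r_inv[OF Gamma_subset[OF X]] by simp
    also have "\<dots> = ?B + int d \<cdot>\<^sub>m (Y * ?B)"
      by (subst Y(2)) (use Bc Y(1) in \<open>simp add: add_mult_distrib_mat[of _ n n] mult_smult_assoc_mat[of Y n n]\<close>)
    finally have e: "1\<^sub>m n = ?B + int d \<cdot>\<^sub>m (Y * ?B)" .
    have "?B = 1\<^sub>m n + int d \<cdot>\<^sub>m (- (Y * ?B))"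
      by (subst e, rule eq_matI) (use Bc Y(1) in auto)
    moreover have "- (Y * ?B) \<in> carrier_mat n n" using Bc Y(1) by simp
    ultimately show "?B \<in> Gamma d n" unfolding Gamma_iff using B by blast
  next
    fix X X' assume X: "X \<in> Gamma d n" "X' \<in> Gamma d n"
    obtain Y where Y: "Y \<in> carrier_mat n n" "X = 1\<^sub>m n + int d \<cdot>\<^sub>m Y" using X Gamma_iff by blast
    obtain Y' where Y': "Y' \<in> carrier_mat n n" "X' = 1\<^sub>m n + int d \<cdot>\<^sub>m Y'" using X Gamma_iff by blast
    have c: "X' \<in> carrier_mat n n" using Gamma_subset[OF X(2)] by simp
    have "X * X' = X' + int d \<cdot>\<^sub>m (Y * X')"
      unfolding Y(2) using c Y(1) by (simp add: add_mult_distrib_mat[of _ n n] mult_smult_assoc_mat[of Y n n])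
    also have "\<dots> = 1\<^sub>m n + int d \<cdot>\<^sub>m (Y' + Y * X')"
      by (subst Y'(2), rule eq_matI) (use c Y(1) Y'(1) in \<open>auto simp: algebra_simps\<close>)
    finally have "X * X' = 1\<^sub>m n + int d \<cdot>\<^sub>m (Y' + Y * X')" .
    moreover have "X \<otimes>\<^bsub>SL n\<^esub> X' \<in> carrier (SL n)"
      using Gamma_subset[OF X(1)] Gamma_subset[OF X(2)] m_closed by blast
    ultimately show "X \<otimes>\<^bsub>SL n\<^esub> X' \<in> Gamma d n" unfolding Gamma_iff using c Y Y' by auto
  qed
qed

lemma addrow_mat_Gamma:
  assumes "i \<noteq> j"
  shows "addrow_mat n (int d * t) i j \<in> Gamma d n"
  using addrow_mat_SL[OF assms, of n "int d * t"] assms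
  by (auto simp: Gamma_def addrow_mat_def cong_iff_dvd_diff)

lemma inv_addrow_mat:
  assumes "i < n" "j < n" "i \<noteq> j"
  shows "inv\<^bsub>SL n\<^esub> (addrow_mat n t i j) = addrow_mat n (- t) i j"
proof -
  interpret group "SL n" by (rule group_SL)
  have "addrow_mat n (- t) i j * addrow_mat n t i j = 1\<^sub>m n"
    using addrow_mat_inv[of i n j "- t"] assms by simp
  then show ?thesis
    using inv_equality[of "addrow_mat n (- t) i j" "addrow_mat n t i j"] addrow_mat_SL assms by simp
qed

definition top_left_block :: "nat \<Rightarrow> nat \<Rightarrow> int mat \<Rightarrow> bool" where
  "top_left_block n m X \<longleftrightarrow> (\<forall>r<n. \<forall>s<n. r \<ge> m \<or> s \<ge> m \<longrightarrow> X $$ (r, s) = (if r = s then 1 else 0))"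

lemma top_left_block_mult:
  assumes X: "X \<in> carrier_mat n n" "top_left_block n m X" and ij: "i < m" "j < m" "m \<le> n" "i \<noteq> j"
  shows "top_left_block n m (addrow_mat n t i j * X)" "top_left_block n m (X * addrow_mat n t i j)"
  using assms unfolding top_left_block_def
  by (auto simp: elem_left_index elem_right_index simp del: index_mult_mat(1))

text \<open>The properties of a set \<open>R\<close> that make the reduction work. They hold for a subgroup that contains the
\<open>x\<^sub>i\<^sub>j(d t)\<close>, is normalised by the elementary matrices and contains the 2-by-2 blocks.\<close>
locale gamma_reduction =
  fixes n d :: nat and R :: "int mat set"
  assumes right: "\<And>X i j t. \<lbrakk>X \<in> Gamma d n; i < n; j < n; i \<noteq> j; X * addrow_mat n (int d * t) i j \<in> R\<rbrakk> \<Longrightarrow> X \<in> R"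
    and left: "\<And>X i j t. \<lbrakk>X \<in> Gamma d n; i < n; j < n; i \<noteq> j; addrow_mat n (int d * t) i j * X \<in> R\<rbrakk> \<Longrightarrow> X \<in> R"
    and conj: "\<And>X i j t. \<lbrakk>X \<in> Gamma d n; i < n; j < n; i \<noteq> j;
        addrow_mat n (- t) i j * X * addrow_mat n t i j \<in> R\<rbrakk> \<Longrightarrow> X \<in> R"
    and base: "\<And>X. \<lbrakk>X \<in> Gamma d n; top_left_block n 2 X\<rbrakk> \<Longrightarrow> X \<in> R"
begin

definition block_Gamma :: "nat \<Rightarrow> int mat set" where
  "block_Gamma m = {X \<in> Gamma d n. top_left_block n m X}"

lemma block_Gamma_carrier: "X \<in> block_Gamma m \<Longrightarrow> X \<in> carrier_mat n n"
  using Gamma_subset[of X d n] by (simp add: block_Gamma_def)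

lemma Gamma_mult: "X \<in> Gamma d n \<Longrightarrow> Y \<in> Gamma d n \<Longrightarrow> X * Y \<in> Gamma d n"
  using subgroup.m_closed[OF Gamma_subgroup] by fastforce

lemma block_Gamma_right:
  assumes "X \<in> block_Gamma m" "i < m" "j < m" "m \<le> n" "i \<noteq> j"
  shows "X * addrow_mat n (int d * t) i j \<in> block_Gamma m"
  using assms block_Gamma_carrier[OF assms(1)] top_left_block_mult(2)[of X n m i j "int d * t"]
    Gamma_mult[OF _ addrow_mat_Gamma[OF assms(5), of n d t]] by (simp add: block_Gamma_def)

lemma block_Gamma_left:
  assumes "X \<in> block_Gamma m" "i < m" "j < m" "m \<le> n" "i \<noteq> j"
  shows "addrow_mat n (int d * t) i j * X \<in> block_Gamma m"
  using assms block_Gamma_carrier[OF assms(1)] top_left_block_mult(1)[of X n m i j "int d * t"]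
    Gamma_mult[OF addrow_mat_Gamma[OF assms(5), of n d t]] by (simp add: block_Gamma_def)

lemma block_Gamma_conj:
  assumes "X \<in> block_Gamma m" "i < m" "j < m" "m \<le> n" "i \<noteq> j"
  shows "addrow_mat n (- t) i j * X * addrow_mat n t i j \<in> block_Gamma m"
proof -
  have "addrow_mat n (- t) i j * X * addrow_mat n t i j \<in> Gamma d n"
    using Gamma_conj[OF _ addrow_mat_SL[OF assms(5), of n "- t"], of X d] inv_addrow_mat[of i n j "- t"] assms
    by (simp add: block_Gamma_def)
  moreover have "top_left_block n m (addrow_mat n (- t) i j * X * addrow_mat n t i j)"
    using assms block_Gamma_carrier[OF assms(1)]
    by (intro top_left_block_mult) (auto simp: block_Gamma_def intro: top_left_block_mult)
  ultimately show ?thesis by (simp add: block_Gamma_def)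
qed

text \<open>Once the last row of the block is that of the identity, the entries above its last diagonal place are
multiples of \<open>d\<close> and can be removed by row operations that change nothing else.\<close>
lemma clear_column:
  assumes ml: "m = Suc l" "m \<le> n" and IH: "\<And>X. X \<in> block_Gamma l \<Longrightarrow> X \<in> R"
  shows "\<lbrakk>X \<in> block_Gamma m; \<And>s. s < n \<Longrightarrow> X $$ (l, s) = (if s = l then 1 else 0); k \<le> l;
      \<And>r. k \<le> r \<Longrightarrow> r < l \<Longrightarrow> X $$ (r, l) = 0\<rbrakk> \<Longrightarrow> X \<in> R"
proof (induction k arbitrary: X)
  case 0
  have "top_left_block n l X"
    unfolding top_left_block_def
  proof (intro allI impI)
    fix r s assume rs: "r < n" "s < n" "r \<ge> l \<or> s \<ge> l"
    have "r \<ge> m \<or> s \<ge> m \<or> r = l \<or> (s = l \<and> r < l)" using rs ml by auto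
    then show "X $$ (r, s) = (if r = s then 1 else 0)"
      using 0 rs by (auto simp: block_Gamma_def top_left_block_def)
  qed
  then show ?case using 0 by (intro IH) (simp add: block_Gamma_def)
next
  case (Suc k)
  note Xc = block_Gamma_carrier[OF Suc.prems(1)]
  have kl: "k < l" "l < n" using Suc.prems ml by auto
  have "[X $$ (k, l) = 0] (mod int d)"
    using Suc.prems(1) kl Gamma_entry_cong[of X d n k l] by (simp add: block_Gamma_def)
  then obtain t where t: "X $$ (k, l) = int d * t" by (auto simp: cong_0_iff)
  let ?X = "addrow_mat n (int d * - t) k l * X"
  note idx = elem_left_index[OF Xc, of k l _ _ "int d * - t"]
  have "?X \<in> R"
  proof (rule Suc.IH)
    show "?X \<in> block_Gamma m" using Suc.prems(1) kl ml by (intro block_Gamma_left) auto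
    show "?X $$ (l, s) = (if s = l then 1 else 0)" if "s < n" for s
      using Suc.prems(2)[OF that] idx[of l s] kl that by simp
    show "k \<le> l" using kl by simp
    show "?X $$ (r, l) = 0" if "k \<le> r" "r < l" for r
      using Suc.prems(4)[of r] idx[of r l] kl that Suc.prems(2)[of l] t by (cases "r = k") auto
  qed
  then show ?case using Suc.prems(1) kl by (intro left[of X k l "- t"]) (auto simp: block_Gamma_def)
qed

lemma row_unimodular:
  assumes X: "X \<in> block_Gamma m" and l: "l < n"
  obtains y where "(\<Sum>s<n. X $$ (l, s) * y s) = 1"
proof -
  interpret group "SL n" by (rule group_SL)
  have Xs: "X \<in> carrier (SL n)" using X Gamma_subset unfolding block_Gamma_def by blast
  let ?Y = "inv\<^bsub>SL n\<^esub> X"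
  have Y: "?Y \<in> carrier_mat n n" using inv_closed[OF Xs] by simp
  have XY: "X * ?Y = 1\<^sub>m n" using r_inv[OF Xs] by simp
  have "(X * ?Y) $$ (l, l) = (\<Sum>s<n. X $$ (l, s) * ?Y $$ (s, l))"
    using Y block_Gamma_carrier[OF X] l by (simp add: scalar_prod_def lessThan_atLeast0)
  then show ?thesis using that[of "\<lambda>s. ?Y $$ (s, l)"] l XY by simp
qed

text \<open>The last row of the block is \<open>(\<dots>, v\<^sub>j, \<dots>, v\<^sub>l)\<close> with zeros elsewhere, \<open>v\<^sub>l = 1 + d a\<close>, and there is an
index \<open>i < l\<close> with \<open>v\<^sub>i = 0\<close>. Since \<open>v\<^sub>j\<close> and \<open>v\<^sub>l\<close> are coprime, column operations by multiples of \<open>d\<close> make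
\<open>v\<^sub>i = -d a\<close>. Adding this column to column \<open>l\<close> makes \<open>v\<^sub>l = 1\<close>. That operation is by \<open>1\<close> and not by a
multiple of \<open>d\<close>; it is done by a conjugation, whose row operation does not affect row \<open>l\<close>. With
\<open>v\<^sub>l = 1\<close> the other entries are cleared.\<close>
lemma block_row_done:
  assumes ml: "m = Suc l" "m \<le> n" "2 \<le> l" and IH: "\<And>X. X \<in> block_Gamma l \<Longrightarrow> X \<in> R"
    and X: "X \<in> block_Gamma m" and j: "j < l" and others: "\<And>s. s < l \<Longrightarrow> s \<noteq> j \<Longrightarrow> X $$ (l, s) = 0"
  shows "X \<in> R"
proof -
  define i where "i = (if j = 0 then 1 else 0 :: nat)"
  have i: "i < l" "i \<noteq> j" using ml by (auto simp: i_def)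
  note Xc = block_Gamma_carrier[OF X]
  have ln: "l < n" "i < n" "j < n" using ml i j by auto
  note lt = i j ln ml
  obtain y where y: "(\<Sum>s<n. X $$ (l, s) * y s) = 1" using row_unimodular[OF X ln(1)] .
  have "(\<Sum>s<n. X $$ (l, s) * y s) = (\<Sum>s\<in>{j, l}. X $$ (l, s) * y s)"
  proof (rule sum.mono_neutral_right)
    show "\<forall>s\<in>{..<n} - {j, l}. X $$ (l, s) * y s = 0"
    proof
      fix s assume s: "s \<in> {..<n} - {j, l}"
      then consider "s < l" "s \<noteq> j" | "s \<ge> m" "s \<noteq> l" using ml by force
      then show "X $$ (l, s) * y s = 0"
      proof cases
        case 1 then show ?thesis using others by simp
      next
        case 2 then show ?thesis using X s ln by (simp add: block_Gamma_def top_left_block_def)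
      qed
    qed
  qed (use ln in auto)
  then have yy: "X $$ (l, j) * y j + X $$ (l, l) * y l = 1" using y j by simp
  have "[X $$ (l, l) = 1] (mod int d)" "[X $$ (l, j) = 0] (mod int d)"
    using X ln j Gamma_entry_cong[of X d n l l] Gamma_entry_cong[of X d n l j] by (simp_all add: block_Gamma_def)
  then obtain a b where a: "X $$ (l, l) - 1 = int d * a" and b: "X $$ (l, j) = int d * b"
    by (auto simp: cong_0_iff cong_iff_dvd_diff dvd_def)
  have i0: "X $$ (l, i) = 0" using others i by simp
  let ?X1 = "X * addrow_mat n (int d * (- a * y j)) j i"
  let ?X2 = "?X1 * addrow_mat n (int d * (- a * y l)) l i"
  let ?X3 = "addrow_mat n (- 1) i l * ?X2 * addrow_mat n 1 i l"
  let ?X4 = "?X3 * addrow_mat n (int d * a) l i"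
  let ?X5 = "?X4 * addrow_mat n (int d * (- b)) l j"
  have B1: "?X1 \<in> block_Gamma m" using lt by (intro block_Gamma_right[OF X]) auto
  have B2: "?X2 \<in> block_Gamma m" using lt by (intro block_Gamma_right[OF B1]) auto
  have B3: "?X3 \<in> block_Gamma m" using lt by (intro block_Gamma_conj[OF B2]) auto
  have B4: "?X4 \<in> block_Gamma m" using lt by (intro block_Gamma_right[OF B3]) auto
  have B5: "?X5 \<in> block_Gamma m" using lt by (intro block_Gamma_right[OF B4]) auto
  have r1: "?X1 $$ (l, s) = (if s = i then int d * (- a * y j) * X $$ (l, j) else X $$ (l, s))" if "s < n" for s
    using that lt i0 by (simp only: elem_right_index[OF Xc]) simp
  have r2: "?X2 $$ (l, s) = (if s = i then - (int d * a) else X $$ (l, s))" if "s < n" for s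
  proof -
    have "int d * (- a * y l) * X $$ (l, l) + int d * (- a * y j) * X $$ (l, j)
        = - (int d * a) * (X $$ (l, j) * y j + X $$ (l, l) * y l)" by (simp add: algebra_simps)
    then show ?thesis
      using that lt yy by (simp only: elem_right_index[OF block_Gamma_carrier[OF B1]] r1) simp
  qed
  have "addrow_mat n (- 1) i l * ?X2 \<in> carrier_mat n n" 
    by (rule mult_carrier_mat[OF _ block_Gamma_carrier[OF B2]]) (simp add: addrow_mat_def)
  note r3' = elem_right_index[OF this, of i l l _ 1]
  have r3: "?X3 $$ (l, s) = (if s = i then - (int d * a) else if s = l then 1 else X $$ (l, s))" if "s < n" for s
    using that lt a by (simp only: r3' elem_left_index[OF block_Gamma_carrier[OF B2]] r2) simp
  have r4: "?X4 $$ (l, s) = (if s = i then 0 else if s = l then 1 else X $$ (l, s))" if "s < n" for s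
    using that lt by (simp only: elem_right_index[OF block_Gamma_carrier[OF B3]] r3) simp
  have r5: "?X5 $$ (l, s) = (if s = l then 1 else 0)" if "s < n" for s
  proof -
    have "X $$ (l, s) = 0" if "s \<noteq> l" "s \<noteq> j" 
    proof (cases "s < l")
      case True then show ?thesis using others that by simp
    next
      case False
      then have "s \<ge> m" using that ml by simp
      then show ?thesis using X \<open>s < n\<close> ln that by (simp add: block_Gamma_def top_left_block_def)
    qed
    then show ?thesis
      using that lt b by (simp only: elem_right_index[OF block_Gamma_carrier[OF B4]] r4) simp
  qed
  have "?X5 \<in> R"
    by (rule clear_column[OF ml(1,2) IH B5 r5, of l]) auto
  then have "?X4 \<in> R" using B4 lt by (intro right[of ?X4 l j "- b"]) (auto simp: block_Gamma_def)
  then have "?X3 \<in> R" using B3 lt by (intro right[of ?X3 l i a]) (auto simp: block_Gamma_def)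
  then have "?X2 \<in> R" using B2 lt by (intro conj[of ?X2 i l 1]) (auto simp: block_Gamma_def)
  then have "?X1 \<in> R" using B1 lt by (intro right[of ?X1 l i "- a * y l"]) (auto simp: block_Gamma_def)
  then show "X \<in> R" using X lt by (intro right[of X j i "- a * y j"]) (auto simp: block_Gamma_def)
qed

text \<open>Conjugation by \<open>x\<^sub>i\<^sub>j(\<plusminus>1)\<close> with \<open>i, j < l\<close> acts on row \<open>l\<close> as a column operation, so the Euclidean
algorithm applies to its entries left of the diagonal, until at most one of them is nonzero.\<close>
lemma block_step:
  assumes ml: "m = Suc l" "m \<le> n" "2 \<le> l" and IH: "\<And>X. X \<in> block_Gamma l \<Longrightarrow> X \<in> R"
  shows "X \<in> block_Gamma m \<Longrightarrow> X \<in> R"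
proof (induction "\<Sum>s<l. nat \<bar>X $$ (l, s)\<bar>" arbitrary: X rule: less_induct)
  case less
  note Xc = block_Gamma_carrier[OF less.prems]
  show ?case
  proof (cases "\<exists>i<l. \<exists>j<l. i \<noteq> j \<and> X $$ (l, i) \<noteq> 0 \<and> X $$ (l, j) \<noteq> 0")
    case True
    then obtain i0 j0 where 0: "i0 < l" "j0 < l" "i0 \<noteq> j0" "X $$ (l, i0) \<noteq> 0" "X $$ (l, j0) \<noteq> 0" by blast
    obtain i j where ij: "i < l" "j < l" "i \<noteq> j" "X $$ (l, i) \<noteq> 0" "X $$ (l, j) \<noteq> 0"
      "\<bar>X $$ (l, j)\<bar> \<le> \<bar>X $$ (l, i)\<bar>"
      using 0 by (cases "\<bar>X $$ (l, j0)\<bar> \<le> \<bar>X $$ (l, i0)\<bar>") auto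
    have ln: "l < n" "i < n" "j < n" using ml ij by auto
    define t where "t = - sgn (X $$ (l, i)) * sgn (X $$ (l, j))"
    have small: "\<bar>t * X $$ (l, j) + X $$ (l, i)\<bar> < \<bar>X $$ (l, i)\<bar>"
      using ij unfolding t_def by (auto simp: sgn_if split: if_splits)
    let ?X = "addrow_mat n (- t) j i * X * addrow_mat n t j i"
    have B: "?X \<in> block_Gamma m" using less.prems ij ml by (intro block_Gamma_conj) auto
    have "addrow_mat n (- t) j i * X \<in> carrier_mat n n"
      by (rule mult_carrier_mat[OF _ Xc]) (simp add: addrow_mat_def)
    note r' = elem_right_index[OF this, of j i l _ t]
    have r: "?X $$ (l, s) = (if s = i then t * X $$ (l, j) + X $$ (l, i) else X $$ (l, s))" if "s < n" for s
      using that ij ln by (simp only: r' elem_left_index[OF Xc]) simp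
    have "(\<Sum>s<l. nat \<bar>?X $$ (l, s)\<bar>) < (\<Sum>s<l. nat \<bar>X $$ (l, s)\<bar>)"
    proof (rule sum_strict_mono_ex1)
      show "\<forall>s\<in>{..<l}. nat \<bar>?X $$ (l, s)\<bar> \<le> nat \<bar>X $$ (l, s)\<bar>"
        using small ln by (auto simp: r simp del: index_mult_mat)
      show "\<exists>s\<in>{..<l}. nat \<bar>?X $$ (l, s)\<bar> < nat \<bar>X $$ (l, s)\<bar>"
        using small ln ij by (intro bexI[of _ i]) (auto simp: r simp del: index_mult_mat)
    qed simp
    then have "?X \<in> R" using less.hyps B by blast
    then show ?thesis using less.prems ij ln by (intro conj[of X j i t]) (auto simp: block_Gamma_def)
  next
    case False
    show ?thesis
    proof (cases "\<exists>j<l. X $$ (l, j) \<noteq> 0")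
      case True
      then obtain j where "j < l" "X $$ (l, j) \<noteq> 0" by blast
      then show ?thesis using block_row_done[OF ml IH less.prems, of j] False by blast
    next
      case False
      then show ?thesis using block_row_done[OF ml IH less.prems, of 0] ml by simp
    qed
  qed
qed

lemma block_Gamma_subset_R: "m \<le> n \<Longrightarrow> X \<in> block_Gamma m \<Longrightarrow> 2 \<le> m \<Longrightarrow> X \<in> R"
proof (induction m arbitrary: X)
  case 0
  then show ?case by simp
next
  case (Suc m)
  show ?case
  proof (cases "m = 1")
    case True
    then show ?thesis using Suc.prems base by (simp add: block_Gamma_def numeral_2_eq_2)
  next
    case False
    then show ?thesis using block_step[of "Suc m" m X] Suc by simp
  qed
qed

theorem Gamma_subset_R: "2 \<le> n \<Longrightarrow> X \<in> Gamma d n \<Longrightarrow> X \<in> R"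
  by (rule block_Gamma_subset_R[of n]) (auto simp: block_Gamma_def top_left_block_def)

end

section \<open>Elementary matrices and 2-by-2 blocks\<close>
lemma addrow_mat_index:
  "\<lbrakk>r < n; s < n; i \<noteq> j\<rbrakk> \<Longrightarrow> addrow_mat n t i j $$ (r, s) = (if r = s then 1 else if r = i \<and> s = j then t else 0)"
  by (auto simp: addrow_mat_def)

lemma addrow_mat_closed: "addrow_mat n t i j \<in> carrier_mat n n"
  by (simp add: addrow_mat_def)

lemma addrow_mat_dims: "dim_row (addrow_mat n t i j) = n" "dim_col (addrow_mat n t i j) = n"
  by (simp_all add: addrow_mat_def)

lemmas elem_index = elem_left_index[OF addrow_mat_closed]
  elem_left_index[OF mult_carrier_mat[OF addrow_mat_closed addrow_mat_closed]] addrow_mat_index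

lemma elem_add:
  "\<lbrakk>i < n; j < n; i \<noteq> j\<rbrakk> \<Longrightarrow> addrow_mat n (s::int) i j * addrow_mat n t i j = addrow_mat n (s + t) i j"
  by (rule eq_matI)
    (simp_all add: elem_index addrow_mat_dims del: index_mult_mat(1))

lemma elem_chain:
  assumes "i < n" "j < n" "k < n" and ne: "i \<noteq> j" "j \<noteq> k" "i \<noteq> k"
  shows "addrow_mat n (s::int) i j * addrow_mat n t j k
    = addrow_mat n (s * t) i k * (addrow_mat n t j k * addrow_mat n s i j)"
proof (rule eq_matI)
  fix r c assume "r < dim_row (addrow_mat n (s * t) i k * (addrow_mat n t j k * addrow_mat n s i j))"
    "c < dim_col (addrow_mat n (s * t) i k * (addrow_mat n t j k * addrow_mat n s i j))"
  then have rc: "r < n" "c < n" by (simp_all add: addrow_mat_dims)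
  show "(addrow_mat n s i j * addrow_mat n t j k) $$ (r, c)
    = (addrow_mat n (s * t) i k * (addrow_mat n t j k * addrow_mat n s i j)) $$ (r, c)"
    using assms rc ne[symmetric] by (cases "r = i"; cases "r = j")
      (simp_all add: elem_index del: index_mult_mat(1))
qed (simp_all add: addrow_mat_dims)

lemma elem_comm:
  assumes "i < n" "j < n" "k < n" "l < n" and ne: "i \<noteq> j" "k \<noteq> l" "j \<noteq> k" "i \<noteq> l"
  shows "addrow_mat n (s::int) i j * addrow_mat n t k l = addrow_mat n t k l * addrow_mat n s i j"
proof (rule eq_matI)
  fix r c assume "r < dim_row (addrow_mat n t k l * addrow_mat n s i j)"
    "c < dim_col (addrow_mat n t k l * addrow_mat n s i j)"
  then have rc: "r < n" "c < n" by (simp_all add: addrow_mat_dims)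
  show "(addrow_mat n s i j * addrow_mat n t k l) $$ (r, c) = (addrow_mat n t k l * addrow_mat n s i j) $$ (r, c)"
    using assms rc ne[symmetric] by (cases "r = i"; cases "r = k")
      (simp_all add: elem_index del: index_mult_mat(1))
qed (simp_all add: addrow_mat_dims)

lemma elem_mat_addrow: "\<lbrakk>i < n; j < n; i \<noteq> j\<rbrakk> \<Longrightarrow> elem_mat n (Suc i) (Suc j) = addrow_mat n 1 i j"
  by (rule eq_matI) (auto simp: elem_mat_def addrow_mat_def)

lemma elem_pow:
  assumes "i < n" "j < n" "i \<noteq> j"
  shows "addrow_mat n 1 i j [^]\<^bsub>SL n\<^esub> (k::nat) = addrow_mat n (int k) i j"
proof (induction k)
  case 0
  have "1\<^sub>m n = addrow_mat n 0 i j" by (rule eq_matI) (auto simp: addrow_mat_def)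
  then show ?case by simp
next
  case (Suc k)
  then show ?case using elem_add[OF assms, of "int k" 1] by (simp add: add.commute)
qed

lemma elem_steinberg:
  fixes f :: "int mat \<Rightarrow> 'g::group_add"
  assumes N: "\<And>i j t. \<lbrakk>i < n; j < n; i \<noteq> j\<rbrakk> \<Longrightarrow> addrow_mat n t i j \<in> N"
    and m: "\<And>g h. g \<in> N \<Longrightarrow> h \<in> N \<Longrightarrow> g * h \<in> N"
    and f: "\<And>g h. g \<in> N \<Longrightarrow> h \<in> N \<Longrightarrow> f (g * h) = f g + f h"
  shows "steinberg {..<n} (\<lambda>i j t. f (addrow_mat n t i j))"
proof
  show "f (addrow_mat n (s + t) i j) = f (addrow_mat n s i j) + f (addrow_mat n t i j)"
    if "i \<in> {..<n}" "j \<in> {..<n}" "i \<noteq> j" for i j s t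
    using that by (simp add: f[symmetric] N elem_add)
  show "f (addrow_mat n s i j) + f (addrow_mat n t j k)
      = f (addrow_mat n (s * t) i k) + f (addrow_mat n t j k) + f (addrow_mat n s i j)"
    if "i \<in> {..<n}" "j \<in> {..<n}" "k \<in> {..<n}" "i \<noteq> j" "j \<noteq> k" "i \<noteq> k" for i j k s t
  proof -
    have "f (addrow_mat n s i j) + f (addrow_mat n t j k) = f (addrow_mat n s i j * addrow_mat n t j k)"
      using that by (simp add: f N)
    also have "\<dots> = f (addrow_mat n (s * t) i k) + (f (addrow_mat n t j k) + f (addrow_mat n s i j))"
      using that elem_chain[of i n j k s t] by (simp add: f N m)
    finally show ?thesis by (simp add: add.assoc)
  qed
  show "f (addrow_mat n s i j) + f (addrow_mat n t k l) = f (addrow_mat n t k l) + f (addrow_mat n s i j)"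
    if "i \<in> {..<n}" "j \<in> {..<n}" "k \<in> {..<n}" "l \<in> {..<n}" "i \<noteq> j" "k \<noteq> l" "j \<noteq> k" "i \<noteq> l" for i j k l s t
    using that elem_comm[of i n j k l s t] by (simp add: f[symmetric] N)
qed

definition block2 :: "nat \<Rightarrow> int \<times> int \<times> int \<times> int \<Rightarrow> int mat" where
  "block2 n m = (case m of (a, b, c, d) \<Rightarrow> mat n n (\<lambda>(r, s).
     if r = 0 \<and> s = 0 then a else if r = 0 \<and> s = 1 then b
     else if r = 1 \<and> s = 0 then c else if r = 1 \<and> s = 1 then d else if r = s then 1 else 0))"

lemma block2_index:
  "\<lbrakk>r < n; s < n\<rbrakk> \<Longrightarrow> block2 n (a, b, c, d) $$ (r, s) =
    (if r = 0 \<and> s = 0 then a else if r = 0 \<and> s = 1 then b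
     else if r = 1 \<and> s = 0 then c else if r = 1 \<and> s = 1 then d else if r = s then 1 else 0)"
  by (simp add: block2_def)

lemma block2_dims [simp]: "dim_row (block2 n m) = n" "dim_col (block2 n m) = n"
  by (simp_all add: block2_def split: prod.splits)

lemma block2_step:
  assumes "n \<ge> 2"
  shows "block2 n (elem_step m (p, s)) = block2 n m * (if p then addrow_mat n s 0 1 else addrow_mat n s 1 0)"
proof -
  obtain a b c d where m: "m = (a, b, c, d)" by (metis prod_cases4)
  have B: "block2 n (a, b, c, d) \<in> carrier_mat n n" by (rule carrier_matI) simp_all
  show ?thesis
    unfolding m
    by (cases p; rule eq_matI)
      (use assms in \<open>auto simp: elem_right_index[OF B] block2_index addrow_mat_dims simp del: index_mult_mat(1)\<close>)
qed

lemma det_two: 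
  assumes A: "(A :: int mat) \<in> carrier_mat 2 2"
  shows "det A = A $$ (0, 0) * A $$ (1, 1) - A $$ (0, 1) * A $$ (1, 0)"
proof -
  have "det (mat_delete A 0 j) = mat_delete A 0 j $$ (0, 0)" for j
    by (rule det_single) (use mat_delete_carrier[OF A] in simp)
  then show ?thesis
    using A by (simp add: laplace_expansion_row[OF A, of 0] cofactor_def numeral_2_eq_2 mat_delete_def)
qed

lemma det_block2:
  assumes "n \<ge> 2"
  shows "det (block2 n (a, b, c, d)) = a * d - b * c"
proof -
  let ?A = "mat 2 2 (\<lambda>(r, s). if r = 0 then if s = 0 then a else b else if s = 0 then c else d)"
  have "block2 n (a, b, c, d) = four_block_mat ?A (0\<^sub>m 2 (n - 2)) (0\<^sub>m (n - 2) 2) (1\<^sub>m (n - 2))"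
    by (rule eq_matI) (use assms in \<open>auto simp: block2_def\<close>)
  then have "det (block2 n (a, b, c, d)) = det ?A * det (1\<^sub>m (n - 2) :: int mat)"
    by (simp add: det_four_block_mat_lower_left_zero[of ?A 2 _ "n - 2"])
  then show ?thesis by (simp add: det_two[of ?A])
qed

lemma top_left_block_2:
  assumes "X \<in> carrier_mat n n" "top_left_block n 2 X" "n \<ge> 2"
  shows "X = block2 n (X $$ (0, 0), X $$ (0, 1), X $$ (1, 0), X $$ (1, 1))"
proof (rule eq_matI)
  fix r s assume "r < dim_row (block2 n (X $$ (0, 0), X $$ (0, 1), X $$ (1, 0), X $$ (1, 1)))"
    "s < dim_col (block2 n (X $$ (0, 0), X $$ (0, 1), X $$ (1, 0), X $$ (1, 1)))"
  then have rs: "r < n" "s < n" by (simp_all add: block2_def)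
  consider "r \<ge> 2 \<or> s \<ge> 2" | "r \<in> {0, 1}" "s \<in> {0, 1}" by fastforce
  then show "X $$ (r, s) = block2 n (X $$ (0, 0), X $$ (0, 1), X $$ (1, 0), X $$ (1, 1)) $$ (r, s)"
  proof cases
    case 1
    then show ?thesis using assms(2) rs by (auto simp: top_left_block_def block2_def)
  next
    case 2
    then show ?thesis using rs by (auto simp: block2_def)
  qed
qed (use assms in \<open>auto simp: block2_def\<close>)

section \<open>The congruence subgroup and its generators\<close>
definition generators :: "nat \<Rightarrow> nat \<Rightarrow> int mat set" where
  "generators n d = {addrow_mat n (int d) i j | i j. i < n \<and> j < n \<and> i \<noteq> j} \<union>
     {addrow_mat n 1 k 0 * addrow_mat n (int d) 0 k * addrow_mat n (- 1) k 0 | k. k < n \<and> k \<noteq> 0}"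

lemma generators_x: "\<lbrakk>i < n; j < n; i \<noteq> j\<rbrakk> \<Longrightarrow> addrow_mat n (int d) i j \<in> generators n d"
  unfolding generators_def by blast

lemma generators_z:
  "\<lbrakk>k < n; k \<noteq> 0\<rbrakk> \<Longrightarrow> addrow_mat n 1 k 0 * addrow_mat n (int d) 0 k * addrow_mat n (- 1) k 0 \<in> generators n d"
  unfolding generators_def by blast

lemma generators_cases [consumes 1, case_names x z]:
  assumes "X \<in> generators n d"
  obtains i j where "X = addrow_mat n (int d) i j" "i < n" "j < n" "i \<noteq> j"
    | k where "X = addrow_mat n 1 k 0 * addrow_mat n (int d) 0 k * addrow_mat n (- 1) k 0" "k < n" "k \<noteq> 0"
  using assms unfolding generators_def by blast

lemma generators_eq:
  "{elem_mat n i j [^]\<^bsub>SL n\<^esub> d | i j. i \<in> {1..n} \<and> j \<in> {1..n} \<and> i \<noteq> j} \<union>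
     {elem_mat n k 1 \<otimes>\<^bsub>SL n\<^esub> (elem_mat n 1 k [^]\<^bsub>SL n\<^esub> d) \<otimes>\<^bsub>SL n\<^esub> inv\<^bsub>SL n\<^esub> (elem_mat n k 1)
       | k. k \<in> {2..n}} = generators n d"
proof -
  have pow: "elem_mat n (Suc i) (Suc j) [^]\<^bsub>SL n\<^esub> d = addrow_mat n (int d) i j" if "i < n" "j < n" "i \<noteq> j" for i j
    using elem_pow[OF that, of d] elem_mat_addrow[OF that] by simp
  have 1: "{elem_mat n i j [^]\<^bsub>SL n\<^esub> d | i j. i \<in> {1..n} \<and> j \<in> {1..n} \<and> i \<noteq> j}
    = {addrow_mat n (int d) i j | i j. i < n \<and> j < n \<and> i \<noteq> j}" (is "?A = ?B")
  proof (intro equalityI subsetI)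
    fix X assume "X \<in> ?A"
    then obtain i j where ij: "X = elem_mat n i j [^]\<^bsub>SL n\<^esub> d" "i \<in> {1..n}" "j \<in> {1..n}" "i \<noteq> j" by blast
    then have "X = addrow_mat n (int d) (i - 1) (j - 1)" "i - 1 < n" "j - 1 < n" "i - 1 \<noteq> j - 1"
      using pow[of "i - 1" "j - 1"] by auto
    then show "X \<in> ?B" by blast
  next
    fix X assume "X \<in> ?B"
    then obtain i j where ij: "X = addrow_mat n (int d) i j" "i < n" "j < n" "i \<noteq> j" by blast
    then have "X = elem_mat n (Suc i) (Suc j) [^]\<^bsub>SL n\<^esub> d" using pow by simp
    moreover have "Suc i \<in> {1..n}" "Suc j \<in> {1..n}" "Suc i \<noteq> Suc j" using ij by auto
    ultimately show "X \<in> ?A" by blast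
  qed
  have conj: "elem_mat n (Suc k) 1 \<otimes>\<^bsub>SL n\<^esub> (elem_mat n 1 (Suc k) [^]\<^bsub>SL n\<^esub> d) \<otimes>\<^bsub>SL n\<^esub> inv\<^bsub>SL n\<^esub> (elem_mat n (Suc k) 1)
    = addrow_mat n 1 k 0 * addrow_mat n (int d) 0 k * addrow_mat n (- 1) k 0" if "k < n" "k \<noteq> 0" for k
    using that pow[of 0 k] elem_mat_addrow[of k n 0] inv_addrow_mat[of k n 0 1] by simp
  have 2: "{elem_mat n k 1 \<otimes>\<^bsub>SL n\<^esub> (elem_mat n 1 k [^]\<^bsub>SL n\<^esub> d) \<otimes>\<^bsub>SL n\<^esub> inv\<^bsub>SL n\<^esub> (elem_mat n k 1)
       | k. k \<in> {2..n}}
    = {addrow_mat n 1 k 0 * addrow_mat n (int d) 0 k * addrow_mat n (- 1) k 0 | k. k < n \<and> k \<noteq> 0}" (is "?A = ?B")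
  proof (intro equalityI subsetI)
    fix X assume "X \<in> ?A"
    then obtain k where k: "X = elem_mat n k 1 \<otimes>\<^bsub>SL n\<^esub> (elem_mat n 1 k [^]\<^bsub>SL n\<^esub> d) \<otimes>\<^bsub>SL n\<^esub> inv\<^bsub>SL n\<^esub> (elem_mat n k 1)"
      "k \<in> {2..n}" by blast
    then obtain l where l: "k = Suc l" "l < n" "l \<noteq> 0" by (cases k) auto
    show "X \<in> ?B" using k(1) conj[OF l(2,3)] l by auto
  next
    fix X assume "X \<in> ?B"
    then obtain k where k: "X = addrow_mat n 1 k 0 * addrow_mat n (int d) 0 k * addrow_mat n (- 1) k 0" "k < n" "k \<noteq> 0"
      by blast
    then have "Suc k \<in> {2..n}" by auto
    then show "X \<in> ?A" using k(1) conj[OF k(2,3)] by (metis (mono_tags, lifting) mem_Collect_eq)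
  qed
  show ?thesis unfolding generators_def 1 2 ..
qed

lemma generators_Gamma: "generators n d \<subseteq> Gamma d n"
proof
  interpret group "SL n" by (rule group_SL)
  fix X assume "X \<in> generators n d"
  then show "X \<in> Gamma d n"
  proof (cases rule: generators_cases)
    case (x i j)
    then show ?thesis using addrow_mat_Gamma[of i j n d 1] by simp
  next
    case (z k)
    have "addrow_mat n (int d) 0 k \<in> Gamma d n"
      using addrow_mat_Gamma[of 0 k n d 1] z by simp
    then show ?thesis
      using Gamma_conj[of "addrow_mat n (int d) 0 k" d n "addrow_mat n 1 k 0"] addrow_mat_SL[OF z(3), of n 1]
        inv_addrow_mat[of k n 0 1] z by simp
  qed
qed

context
  fixes n d :: nat
  assumes n: "n \<ge> 3"
begin

lemma generators_SL: "generators n d \<subseteq> carrier (SL n)"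
  using generators_Gamma Gamma_subset by blast

lemma gen_subgroup_subgroup: "subgroup (generate (SL n) (generators n d)) (SL n)"
  by (rule group.generate_is_subgroup[OF group_SL generators_SL])

text \<open>Transport of \<open>conj_x_closed\<close> along the regular representation of the special linear group.\<close>
lemma gen_subgroup_conj_elem:
  assumes ij: "i < n" "j < n" "i \<noteq> j" and h: "h \<in> generate (SL n) (generators n d)"
  shows "addrow_mat n t i j * h * addrow_mat n (- t) i j \<in> generate (SL n) (generators n d)"
proof -
  let ?H = "generate (SL n) (generators n d)"
  interpret group "SL n" by (rule group_SL)
  interpret S: subgroup ?H "SL n" by (rule gen_subgroup_subgroup)
  let ?c = "cayley (SL n)"
  let ?x = "\<lambda>i j t. ?c (addrow_mat n t i j)"
  have HS: "g \<in> carrier (SL n)" if "g \<in> ?H" for g using that S.subset by blast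
  have ES: "addrow_mat n t i j \<in> carrier (SL n)" if "i \<noteq> j" for t i j by (rule addrow_mat_SL[OF that])
  interpret X: steinberg "{..<n}" ?x
  proof (rule elem_steinberg[where N = "carrier (SL n)"])
    fix g h assume gh: "g \<in> carrier (SL n)" "h \<in> carrier (SL n)"
    show "g * h \<in> carrier (SL n)" using m_closed[OF gh] by (simp only: SL_ops)
    show "?c (g * h) = ?c g + ?c h" using cayley_mult[OF gh] by (simp only: SL_ops)
  qed (rule ES)
  have c_mult: "?c (A * B) = ?c A + ?c B" if "A \<in> carrier (SL n)" "B \<in> carrier (SL n)" for A B
    using cayley_mult[OF that] by (simp only: SL_ops)
  have c_conj: "?c (addrow_mat n s k l * A * addrow_mat n (- s) k l) = cj (?x k l s) (?c A)"
    if "A \<in> carrier (SL n)" "k < n" "l < n" "k \<noteq> l" for k l s A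
  proof -
    have m: "addrow_mat n s k l * A \<in> carrier (SL n)" using m_closed[OF ES[OF that(4)] that(1)] by (simp only: SL_ops)
    then have "?c (addrow_mat n s k l * A * addrow_mat n (- s) k l) = ?x k l s + ?c A + ?x k l (- s)"
      by (simp only: c_mult[OF m ES[OF that(4)]] c_mult[OF ES[OF that(4)] that(1)])
    then show ?thesis using X.x_minus[of k l s] that by (simp add: cj_def)
  qed
  interpret Y: steinberg_subgroup "{..<n}" ?x "?c ` ?H" "int d" 0
  proof
    show "a + b \<in> ?c ` ?H" if ab: "a \<in> ?c ` ?H" "b \<in> ?c ` ?H" for a b
    proof -
      obtain g h where gh: "a = ?c g" "b = ?c h" "g \<in> ?H" "h \<in> ?H" using ab by (elim imageE)
      then have "a + b = ?c (g \<otimes>\<^bsub>SL n\<^esub> h)" using cayley_mult[OF HS HS] by (simp only:)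
      then show ?thesis using S.m_closed[OF gh(3,4)] by (simp only: imageI)
    qed
    show "- a \<in> ?c ` ?H" if a: "a \<in> ?c ` ?H" for a
    proof -
      obtain g where g: "a = ?c g" "g \<in> ?H" using a by (elim imageE)
      then have "- a = ?c (inv\<^bsub>SL n\<^esub> g)" using cayley_inv[OF HS] by (simp only:)
      then show ?thesis using S.m_inv_closed[OF g(2)] by (simp only: imageI)
    qed
    show "0 \<in> {..<n}" using n by simp
    show "?x i j (int d) \<in> ?c ` ?H" if "i \<in> {..<n}" "j \<in> {..<n}" "i \<noteq> j" for i j
    proof -
      have "addrow_mat n (int d) i j \<in> generators n d" using that by (intro generators_x) auto
      then show ?thesis by (intro imageI generate.incl)
    qed
    show "cj (?x k 0 1) (?x 0 k (int d)) \<in> ?c ` ?H" if k: "k \<in> {..<n}" "k \<noteq> 0" for k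
    proof -
      have "addrow_mat n 1 k 0 * addrow_mat n (int d) 0 k * addrow_mat n (- 1) k 0 \<in> generators n d"
        using k by (intro generators_z) auto
      then have "?c (addrow_mat n 1 k 0 * addrow_mat n (int d) 0 k * addrow_mat n (- 1) k 0) \<in> ?c ` ?H"
        by (intro imageI generate.incl)
      then show ?thesis using c_conj[of "addrow_mat n (int d) 0 k" k 0 1] ES[of 0 k "int d"] k by (simp del: SL_carrier)
    qed
    show "\<exists>j\<in>{..<n}. j \<noteq> k \<and> j \<noteq> 0" for k
      using n by (intro bexI[of _ "if k = 1 then 2 else 1"]) auto
  qed
  have hH: "?c h \<in> ?c ` ?H" by (rule imageI[OF h])
  have "cj (?x i j t) (?c h) \<in> ?c ` ?H"
  proof (rule Y.conj_x_closed[OF _ _ _ _ hH])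
    fix a g assume cx: "\<And>i j. \<lbrakk>i \<in> {..<n}; j \<in> {..<n}; i \<noteq> j\<rbrakk> \<Longrightarrow> cj a (?x i j (int d)) \<in> ?c ` ?H"
      and cz: "\<And>k. \<lbrakk>k \<in> {..<n}; k \<noteq> 0\<rbrakk> \<Longrightarrow> cj a (cj (?x k 0 1) (?x 0 k (int d))) \<in> ?c ` ?H"
      and "g \<in> ?c ` ?H"
    then obtain h' where h': "g = ?c h'" "h' \<in> ?H" by (elim imageE)
    have base: "cj a (?c g) \<in> ?c ` ?H" if g: "g \<in> generators n d" for g
    proof -
      from g show ?thesis
      proof (cases rule: generators_cases)
        case x
        then show ?thesis using cx by simp
      next
        case (z k)
        have "?c g = cj (?x k 0 1) (?x 0 k (int d))"
          using c_conj[of "addrow_mat n (int d) 0 k" k 0 1] ES[of 0 k "int d"] z n by (simp del: SL_carrier)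
        then show ?thesis using cz z by simp
      qed
    qed
    have "cj a (?c h') \<in> ?c ` ?H"
      using h'(2)
    proof (induction h' rule: generate.induct)
      case one
      have "0 \<in> ?c ` ?H" using Y.H_diff[OF hH hH] by simp
      then show ?case by (simp only: cayley_one cj_zero)
    next
      case (incl g)
      then show ?case by (rule base)
    next
      case (inv g)
      then have "g \<in> carrier (SL n)" using generators_SL by blast
      then show ?case using Y.H_minus[OF base[OF inv]] cayley_inv[of g] by (simp only: cj_uminus)
    next
      case (eng g h)
      then have "g \<in> carrier (SL n)" "h \<in> carrier (SL n)" using HS by blast+
      then show ?case using Y.H_add[OF eng.IH] by (simp only: cayley_mult cj_add)
    qed
    then show "cj a g \<in> ?c ` ?H" using h' by simp
  qed (use ij in auto)
  then obtain g where g: "g \<in> ?H" "?c g = cj (?x i j t) (?c h)" by (elim imageE) simp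
  then have "?c g = ?c (addrow_mat n t i j * h * addrow_mat n (- t) i j)"
    using c_conj[OF HS[OF h] ij] by (simp only:)
  moreover have "addrow_mat n t i j * h * addrow_mat n (- t) i j \<in> carrier (SL n)"
    using m_closed[OF m_closed[OF ES[OF ij(3)] HS[OF h]] ES[OF ij(3)]] by (simp only: SL_ops)
  ultimately have "g = addrow_mat n t i j * h * addrow_mat n (- t) i j"
    using cayley_inj[OF HS[OF g(1)]] by blast
  then show ?thesis using g(1) by simp
qed

text \<open>\<open>N\<close> is the normaliser of \<open>H\<close>, which contains all elementary matrices. In \<open>N\<close> modulo \<open>H\<close> they form a
Steinberg system over the integers modulo \<open>d\<close>, so that 2-by-2 blocks in \<open>\<Gamma>\<^sub>d(n)\<close> have trivial image.\<close>
lemma Gamma_subset_gen_subgroup: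
  assumes d: "d \<ge> 1" and X: "X \<in> Gamma d n"
  shows "X \<in> generate (SL n) (generators n d)"
proof -
  let ?H = "generate (SL n) (generators n d)"
  interpret group "SL n" by (rule group_SL)
  interpret S: subgroup ?H "SL n" by (rule gen_subgroup_subgroup)
  have HS: "g \<in> carrier (SL n)" if "g \<in> ?H" for g using that S.subset by blast
  have ES: "addrow_mat n t i j \<in> carrier (SL n)" if "i \<noteq> j" for t i j by (rule addrow_mat_SL[OF that])
  define N where "N = {g \<in> carrier (SL n). (\<forall>h\<in>?H. g \<otimes>\<^bsub>SL n\<^esub> h \<otimes>\<^bsub>SL n\<^esub> inv\<^bsub>SL n\<^esub> g \<in> ?H)
      \<and> (\<forall>h\<in>?H. inv\<^bsub>SL n\<^esub> g \<otimes>\<^bsub>SL n\<^esub> h \<otimes>\<^bsub>SL n\<^esub> g \<in> ?H)}"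
  have N: "subgroup N (SL n)"
    unfolding N_def by (rule normaliser_subgroup[OF S.subset])
  have HN: "?H \<subseteq> N" unfolding N_def using HS S.m_closed S.m_inv_closed by (auto simp del: SL_carrier SL_ops)
  have EN: "addrow_mat n t i j \<in> N" if "i < n" "j < n" "i \<noteq> j" for t i j
    unfolding N_def using ES[OF that(3)] gen_subgroup_conj_elem[OF that] gen_subgroup_conj_elem[OF that, of _ "- t"] inv_addrow_mat[OF that]
    by (simp del: SL_carrier)
  obtain \<phi> :: "int mat \<Rightarrow> int mat set bijection"
    where \<phi>_mult: "\<And>g h. g \<in> N \<Longrightarrow> h \<in> N \<Longrightarrow> \<phi> (g \<otimes>\<^bsub>SL n\<^esub> h) = \<phi> g + \<phi> h"
      and \<phi>_zero: "\<And>g. g \<in> N \<Longrightarrow> \<phi> g = 0 \<longleftrightarrow> g \<in> ?H"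
    by (rule quotient_embedding[OF group_SL gen_subgroup_subgroup N HN]) (auto simp: N_def)
  have Nm: "g * h \<in> N" if "g \<in> N" "h \<in> N" for g h
    using subgroup.m_closed[OF N that] by simp
  let ?x = "\<lambda>i j t. \<phi> (addrow_mat n t i j)"
  interpret x: steinberg "{..<n}" ?x
    by (rule elem_steinberg[where N = N, OF EN Nm \<phi>_mult[simplified]])
  have dH: "addrow_mat n (int d * t) i j \<in> ?H" if ij: "i < n" "j < n" "i \<noteq> j" for i j t
  proof -
    have 1: "addrow_mat n (int d) i j \<in> ?H"
      by (intro generate.incl generators_x ij)
    then have p: "\<phi> (addrow_mat n (int d) i j) = 0" using \<phi>_zero EN[OF ij] by blast
    have "?x i j (int d * t) = 0"
    proof (induction t rule: int_induct[where k = 0])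
      case base
      then show ?case using x.x_zero[of i j] ij by simp
    next
      case (step1 t)
      then show ?case using x.x_add[of i j "int d * t" "int d"] ij p by (simp add: algebra_simps)
    next
      case (step2 t)
      then show ?case using x.x_add[of i j "int d * (t - 1)" "int d"] ij p by (simp add: algebra_simps)
    qed
    then show ?thesis using \<phi>_zero EN[OF ij] by blast
  qed
  have sm: "steinberg_mod {..<n} ?x (int d)"
  proof
    show "?x i j (int d) = 0" if "i \<in> {..<n}" "j \<in> {..<n}" "i \<noteq> j" for i j
      using dH[of i j 1] \<phi>_zero EN that by simp
    show "\<exists>k\<in>{..<n}. k \<noteq> i \<and> k \<noteq> j" for i j
      by (rule bexI[of _ "if 0 \<notin> {i, j} then 0 else if 1 \<notin> {i, j} then 1 else 2"]) (use n in auto)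
  qed
  have word: "block2 n (word_matrix ws) \<in> N \<and> word_value (?x 0 1) (?x 1 0) ws = \<phi> (block2 n (word_matrix ws))" for ws
  proof (induction ws rule: rev_induct)
    case Nil
    have "block2 n (1, 0, 0, 1) = \<one>\<^bsub>SL n\<^esub>"
      by (rule eq_matI) (auto simp: block2_index)
    moreover have oH: "\<one>\<^bsub>SL n\<^esub> \<in> ?H" by (rule S.one_closed)
    moreover have oN: "\<one>\<^bsub>SL n\<^esub> \<in> N" by (rule subsetD[OF HN oH])
    moreover have "\<phi> \<one>\<^bsub>SL n\<^esub> = 0" using \<phi>_zero[OF oN] oH by (simp only:)
    ultimately show ?case by (simp del: SL_ops)
  next
    case (snoc v ws)
    obtain p s where v: "v = (p, s)" by fastforce
    have E: "addrow_mat n s 0 1 \<in> N" "addrow_mat n s 1 0 \<in> N" using EN n by simp_all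
    have "block2 n (word_matrix (ws @ [v])) = block2 n (word_matrix ws) * (if p then addrow_mat n s 0 1 else addrow_mat n s 1 0)"
      using block2_step[of n "word_matrix ws" p s] n by (simp add: v)
    then show ?case using snoc E Nm \<phi>_mult[simplified] by (simp add: v)
  qed
  interpret R: gamma_reduction n d ?H
  proof
    fix Y :: "int mat" and i j :: nat and t :: int
    assume Y: "Y \<in> Gamma d n" and ij: "i < n" "j < n" "i \<noteq> j"
    note Yc = Gamma_subset[OF Y]
    note D = dH[OF ij, of t]
    show "Y \<in> ?H" if *: "Y * addrow_mat n (int d * t) i j \<in> ?H"
    proof -
      have "Y = Y \<otimes>\<^bsub>SL n\<^esub> addrow_mat n (int d * t) i j \<otimes>\<^bsub>SL n\<^esub> inv\<^bsub>SL n\<^esub> addrow_mat n (int d * t) i j"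
        using Yc HS[OF D] by (simp add: m_assoc del: SL_carrier SL_ops)
      moreover have "\<dots> \<in> ?H" using * D S.m_inv_closed[OF D] S.m_closed by simp
      ultimately show ?thesis by simp
    qed
    show "Y \<in> ?H" if *: "addrow_mat n (int d * t) i j * Y \<in> ?H"
    proof -
      have "Y = inv\<^bsub>SL n\<^esub> addrow_mat n (int d * t) i j \<otimes>\<^bsub>SL n\<^esub> (addrow_mat n (int d * t) i j \<otimes>\<^bsub>SL n\<^esub> Y)"
        using Yc HS[OF D] by (simp add: m_assoc[symmetric] del: SL_carrier SL_ops)
      moreover have "\<dots> \<in> ?H" using * D S.m_inv_closed[OF D] S.m_closed by simp
      ultimately show ?thesis by simp
    qed
    show "Y \<in> ?H" if *: "addrow_mat n (- t) i j * Y * addrow_mat n t i j \<in> ?H"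
    proof -
      let ?e = "addrow_mat n t i j"
      have e: "?e \<in> carrier (SL n)" "inv\<^bsub>SL n\<^esub> ?e = addrow_mat n (- t) i j"
        using ES[OF ij(3)] inv_addrow_mat[OF ij] by blast+
      have "Y = ?e \<otimes>\<^bsub>SL n\<^esub> (inv\<^bsub>SL n\<^esub> ?e \<otimes>\<^bsub>SL n\<^esub> Y \<otimes>\<^bsub>SL n\<^esub> ?e) \<otimes>\<^bsub>SL n\<^esub> inv\<^bsub>SL n\<^esub> ?e"
        using Yc e(1) by (simp add: m_assoc del: SL_carrier SL_ops) (simp add: m_assoc[symmetric] del: SL_carrier SL_ops)
      moreover have "\<dots> \<in> ?H" using gen_subgroup_conj_elem[OF ij *, of t] e(2) by simp
      ultimately show ?thesis by simp
    qed
  next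
    fix Y :: "int mat" assume Y: "Y \<in> Gamma d n" and B: "top_left_block n 2 Y"
    have Yc: "Y \<in> carrier_mat n n" "det Y = 1" using Gamma_subset[OF Y] by auto
    let ?m = "(Y $$ (0, 0), Y $$ (0, 1), Y $$ (1, 0), Y $$ (1, 1))"
    have Yb: "Y = block2 n ?m" using top_left_block_2[OF Yc(1) B] n by simp
    then have "Y $$ (0, 0) * Y $$ (1, 1) - Y $$ (0, 1) * Y $$ (1, 0) = 1"
      using det_block2[of n] Yc(2) n by (metis One_nat_def Suc_leD numeral_3_eq_3 numeral_2_eq_2)
    then obtain ws where ws: "word_matrix ws = ?m"
      using det_one_word_reachable unfolding word_reachable_def by blast
    have "cong_identity (int d) (word_matrix ws)"
      unfolding ws cong_identity_def using n Gamma_entry_cong[OF Y, of 0 0] Gamma_entry_cong[OF Y, of 0 1]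
        Gamma_entry_cong[OF Y, of 1 0] Gamma_entry_cong[OF Y, of 1 1] by simp
    moreover have "word_value (?x 0 1) (?x 1 0) (w_word @ w_word @ w_word @ w_word) = 0"
      using word[of "[]"] word[of "w_word @ w_word @ w_word @ w_word"]
      by (simp add: word_matrix_w4 del: append_assoc)
    ultimately have "word_value (?x 0 1) (?x 1 0) ws = 0"
      using word_value_zero_mod[OF _ sm, of 0 1 ws] d n by simp
    then have "Y \<in> N" "\<phi> Y = 0" using word[of ws] unfolding ws Yb[symmetric] by simp_all
    then show "Y \<in> ?H" using \<phi>_zero[of Y] by (simp only:)
  qed
  show ?thesis using R.Gamma_subset_R X n by simp
qed

end

theorem theorem1p2:
  fixes n d :: nat
  assumes "n \<ge> 3" and "d \<ge> 1"
  shows "Gamma d n = generate (SL n)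
    ({elem_mat n i j [^]\<^bsub>SL n\<^esub> d | i j. i \<in> {1..n} \<and> j \<in> {1..n} \<and> i \<noteq> j} \<union>
     {elem_mat n k 1 \<otimes>\<^bsub>SL n\<^esub> (elem_mat n 1 k [^]\<^bsub>SL n\<^esub> d) \<otimes>\<^bsub>SL n\<^esub> inv\<^bsub>SL n\<^esub> (elem_mat n k 1)
       | k. k \<in> {2..n}})"
proof -
  have "generate (SL n) (generators n d) \<subseteq> Gamma d n"
    by (rule group.generate_subgroup_incl[OF group_SL generators_Gamma Gamma_subgroup])
  then show ?thesis unfolding generators_eq using Gamma_subset_gen_subgroup[OF assms] by blast
qed

end
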